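(* Let $G_0:\mathbb{R}\to(0,1)$ be a continuous strictly increasing bijection with density $g_0=G_0'$, and for $\theta=(\mu,\sigma)\in\mathbb{R}\times(0,\infty)$ let $G_\theta(x)=G_0((x-\mu)/\sigma)$. Let $X,X_1,X_2,\ldots$ be i.i.d. real random variables with law $P$, and let $\widehat\theta_n$ be estimators (functions of $X_1,\ldots,X_n$) with probability limit $\theta_0\in\mathbb{R}\times(0,\infty)$. Put $m(\theta)=\mathbb{E}[G_\theta(X)]$, $b_0=G_{\theta_0}^{-1}(m(\theta_0))$, and $\widehat b_n^{\mathrm{ad}}=G_{\widehat\theta_n}^{-1}\left(\frac1n\sum_{i=1}^nG_{\widehat\theta_n}(X_i)\right)$. Assume: (i) $\sqrt n(\widehat\theta_n-\theta_0)=\frac1{\sqrt n}\sum_{i=1}^n\psi_\theta(X_i)+o_{\mathbb{P}}(1)$, where $\mathbb{E}[\psi_\theta(X)]=0$ and $\mathbb{E}\|\psi_\theta(X)\|^2<\infty$; (ii) the class $\{G_\theta:\theta\in\Theta_0\}$ is $P$-Donsker for a neighbourhood $\Theta_0$ of $\theta_0$, and $\theta\mapsto G_\theta$ is differentiable at $\theta_0$ in $L^2(P)$; (iii) $m$ is differentiable at $\theta_0$, $G_{\theta_0}$ is differentiable at $b_0$, and $G'_{\theta_0}(b_0)>0$. Let $N_1^*,\ldots,N_n^*$ be the multinomial counts of an ordinary nonparametric bootstrap sample $X_1^*,\ldots,X_n^*$ (i.i.d. from $\frac1n\sum_i\delta_{X_i}$ given the data), let $\widehat\theta_n^*$ be the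 preliminary estimator recomputed on the bootstrap sample, and let $\widehat b_n^{\mathrm{ad},*}=G_{\widehat\theta_n^*}^{-1}\left(\frac1n\sum_{i=1}^nG_{\widehat\theta_n^*}(X_i^* )\right)$. Assume bootstrap stochastic equicontinuity of the chart class at $\theta_0$, and that $$\sqrt n(\widehat\theta_n^*-\widehat\theta_n)=\frac1{\sqrt n}\sum_{i=1}^n(N_i^*-1)\psi_\theta(X_i)+o_{\mathbb{P}^*}(1)\quad\text{in probability}.$$ Then, conditionally on the data, $$\sqrt n\left(\widehat b_n^{\mathrm{ad},*}-\widehat b_n^{\mathrm{ad}}\right)\rightsquigarrow\mathcal N(0,\tau_{\mathrm{ad}}^2)\quad\text{in probability},$$ where $\tau_{\mathrm{ad}}^2=\mathbb{E}[\operatorname{IF}_{\mathrm{ad}}(X)^2]$, $\operatorname{IF}_{\mathrm{ad}}(x)=\dfrac{G_{\theta_0}(x)-m(\theta_0)+\Delta^\top\psi_\theta(x)}{G'_{\theta_0}(b_0)}$ and $\Delta=\nabla_\theta m(\theta_0)-\nabla_\theta G_\theta(b_0)|_{\theta=\theta_0}$.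
   Context: $G'_\theta(x)$ is the derivative in $x$; $\nabla_\theta G_\theta(b_0)|_{\theta=\theta_0}$ is the gradient in $\theta$ with $b_0$ held fixed. Differentiability in $L^2(P)$ at $\theta_0$: there is $\dot G\in L^2(P;\mathbb{R}^2)$ with $\|G_\theta-G_{\theta_0}-(\theta-\theta_0)^\top\dot G\|_{L^2(P)}=o(\|\theta-\theta_0\|)$. $\mathbb{P}^*$ is conditional probability given $X_1,\ldots,X_n$; "$R_n^*=o_{\mathbb{P}^*}(1)$ in probability" means that for each $\varepsilon>0$, $\mathbb{P}^*(\|R_n^*\|>\varepsilon)\to0$ in probability. With $\mathbb G_n^*h=\frac1{\sqrt n}\sum_{i=1}^n(N_i^*-1)h(X_i)$, bootstrap stochastic equicontinuity of the chart class at $\theta_0$ means that for every deterministic sequence $\delta_n\downarrow0$, $\sup_{\|\theta-\theta_0\|\le\delta_n}|\mathbb G_n^*(G_\theta-G_{\theta_0})|=o_{\mathbb{P}^*}(1)$ in probability. Conditional weak convergence in probability to a law $L$ means that the bounded-Lipschitz distance between the conditional law given the data and $L$ tends to $0$ in probability. $\mathcal N(0,0)$ is the point mass at $0$. The subscript in $\psi_\theta$ is only a name. *)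

theory Defs
  imports "HOL-Probability.Probability" "HOL-Library.Landau_Symbols"
begin

section \<open>Convergence in probability\<close>

text \<open>
  Outer probability is used so that no measurability has to be imposed on suprema or on functions
  of the estimators; for measurable \<open>R n\<close> this is ordinary convergence to 0 in probability.
\<close>

definition tendsto_zero_in_prob :: "'a measure \<Rightarrow> (nat \<Rightarrow> 'a \<Rightarrow> 'b::real_normed_vector) \<Rightarrow> bool" where
  "tendsto_zero_in_prob M R \<longleftrightarrow>
     (\<forall>\<epsilon>>0. (\<lambda>n. outer_measure_of M {\<omega> \<in> space M. \<epsilon> < norm (R n \<omega>)}) \<longlonglongrightarrow> 0)"


section \<open>Donsker classes\<close>

text \<open>Only meant for bounded \<open>h\<close>.\<close>

definition outer_expectation :: "'a measure \<Rightarrow> ('a \<Rightarrow> real) \<Rightarrow> real" where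
  "outer_expectation Q h =
     (INF U \<in> {U. integrable Q U \<and> (\<forall>\<omega>\<in>space Q. h \<omega> \<le> U \<omega>)}. integral\<^sup>L Q U)"

text \<open>The space of bounded real functions on the set \<open>F\<close>, with the supremum distance.\<close>

abbreviation ell_infty :: "'f set \<Rightarrow> ('f \<Rightarrow> real) metric" where
  "ell_infty F \<equiv> funspace F euclidean_metric"

definition tight_borel_prob :: "'b metric \<Rightarrow> 'b measure \<Rightarrow> bool" where
  "tight_borel_prob m L \<longleftrightarrow>
     prob_space L \<and> space L = mspace m \<and>
     sets L = sigma_sets (mspace m) {U. openin (mtopology_of m) U} \<and>
     (\<forall>\<epsilon>>0. \<exists>K. compactin (mtopology_of m) K \<and> measure L K \<ge> 1 - \<epsilon>)"

text \<open>Weak convergence in the sense of Hoffmann-Jorgensen.\<close>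

definition weakly_converges_outer ::
  "'a measure \<Rightarrow> (nat \<Rightarrow> 'a \<Rightarrow> 'b) \<Rightarrow> 'b metric \<Rightarrow> 'b measure \<Rightarrow> bool" where
  "weakly_converges_outer Q Z m L \<longleftrightarrow>
     (\<forall>h. continuous_map (mtopology_of m) euclideanreal h \<and> bounded (h ` mspace m) \<longrightarrow>
        (\<lambda>n. outer_expectation Q (\<lambda>\<omega>. h (Z n \<omega>))) \<longlonglongrightarrow> integral\<^sup>L L h)"

definition empirical_process ::
  "'b measure \<Rightarrow> ('b \<Rightarrow> real) set \<Rightarrow> nat \<Rightarrow> (nat \<Rightarrow> 'b) \<Rightarrow> ('b \<Rightarrow> real) \<Rightarrow> real" where
  "empirical_process P F n x =
     (\<lambda>f\<in>F. sqrt (real n) * ((\<Sum>i<n. f (x i)) / real n - integral\<^sup>L P f))"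

text \<open>
  The observations are the coordinate projections of the infinite product space. By the
  central limit theorem for the marginals, a tight limit is necessarily a \<open>P\<close>-Brownian bridge.
\<close>

definition donsker :: "'b measure \<Rightarrow> ('b \<Rightarrow> real) set \<Rightarrow> bool" where
  "donsker P F \<longleftrightarrow>
     (\<forall>f\<in>F. integrable P f) \<and>
     (\<forall>x\<in>space P. bounded ((\<lambda>f. f x - integral\<^sup>L P f) ` F)) \<and>
     (\<exists>L. tight_borel_prob (ell_infty F) L \<and>
          weakly_converges_outer (PiM UNIV (\<lambda>_::nat. P)) (empirical_process P F) (ell_infty F) L)"


section \<open>Differentiability\<close>

definition L2_differentiable_at ::
  "'b measure \<Rightarrow> ('t::euclidean_space \<Rightarrow> 'b \<Rightarrow> real) \<Rightarrow> 't \<Rightarrow> bool" where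
  "L2_differentiable_at P F \<theta>0 \<longleftrightarrow>
     (\<exists>F' :: 'b \<Rightarrow> 't. F' \<in> borel_measurable P \<and> integrable P (\<lambda>x. (norm (F' x))\<^sup>2) \<and>
        (\<lambda>\<theta>. sqrt (\<integral>x. (F \<theta> x - F \<theta>0 x - (\<theta> - \<theta>0) \<bullet> F' x)\<^sup>2 \<partial>P))
          \<in> o[at \<theta>0](\<lambda>\<theta>. norm (\<theta> - \<theta>0)))"

definition gradient :: "('t::real_inner \<Rightarrow> real) \<Rightarrow> 't \<Rightarrow> 't" where
  "gradient f \<theta> = (THE D. GDERIV f \<theta> :> D)"


section \<open>The location-scale chart and the adaptive estimator\<close>

text \<open>
  A parameter is a pair \<open>(\<mu>, \<sigma>)\<close>; the product norm and inner product are the Euclidean ones.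
\<close>

definition param_space :: "(real \<times> real) set" where
  "param_space = {\<theta>. 0 < snd \<theta>}"

definition chart :: "(real \<Rightarrow> real) \<Rightarrow> real \<times> real \<Rightarrow> real \<Rightarrow> real" where
  "chart G0 \<theta> x = G0 ((x - fst \<theta>) / snd \<theta>)"

definition chart_mean :: "(real \<Rightarrow> real) \<Rightarrow> real measure \<Rightarrow> real \<times> real \<Rightarrow> real" where
  "chart_mean G0 P \<theta> = (\<integral>x. chart G0 \<theta> x \<partial>P)"

definition chart_center :: "(real \<Rightarrow> real) \<Rightarrow> real measure \<Rightarrow> real \<times> real \<Rightarrow> real" where
  "chart_center G0 P \<theta> = inv (chart G0 \<theta>) (chart_mean G0 P \<theta>)"

text \<open>
  Data are sequences \<open>x\<close>, of which the first \<open>n\<close> entries \<open>x 0, \<dots>, x (n - 1)\<close> form the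
  sample of size \<open>n\<close>. The restriction makes the estimator a function of these entries only.
\<close>

definition estimate :: "(nat \<Rightarrow> (nat \<Rightarrow> real) \<Rightarrow> 't) \<Rightarrow> nat \<Rightarrow> (nat \<Rightarrow> real) \<Rightarrow> 't" where
  "estimate T n x = T n (restrict x {..<n})"

definition b_ad ::
  "(real \<Rightarrow> real) \<Rightarrow> (nat \<Rightarrow> (nat \<Rightarrow> real) \<Rightarrow> real \<times> real) \<Rightarrow> nat \<Rightarrow> (nat \<Rightarrow> real) \<Rightarrow> real" where
  "b_ad G0 T n x =
     inv (chart G0 (estimate T n x)) ((\<Sum>i<n. chart G0 (estimate T n x) (x i)) / real n)"

definition IF_ad ::
  "(real \<Rightarrow> real) \<Rightarrow> real measure \<Rightarrow> (real \<Rightarrow> real \<times> real) \<Rightarrow> real \<times> real \<Rightarrow> real \<Rightarrow> real" where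
  "IF_ad G0 P \<psi> \<theta>0 x =
     (let b0 = chart_center G0 P \<theta>0;
          \<Delta> = gradient (chart_mean G0 P) \<theta>0 - gradient (\<lambda>\<theta>. chart G0 \<theta> b0) \<theta>0
      in (chart G0 \<theta>0 x - chart_mean G0 P \<theta>0 + \<Delta> \<bullet> \<psi> x) / deriv (chart G0 \<theta>0) b0)"


section \<open>The nonparametric bootstrap\<close>

text \<open>
  Given data \<open>x\<close>, the bootstrap sample is \<open>x (J 0), \<dots>, x (J (n - 1))\<close>, where the resampled
  indices \<open>J 0, \<dots>, J (n - 1)\<close> are i.i.d. uniform on \<open>{0, \<dots>, n - 1}\<close> and independent of the
  data. Hence, conditionally on the data, every bootstrap quantity is a function of \<open>J\<close> with the
  data held fixed, and its conditional law is its law under \<open>boot_indices n\<close>.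
\<close>

definition boot_indices :: "nat \<Rightarrow> (nat \<Rightarrow> nat) pmf" where
  "boot_indices n = Pi_pmf {..<n} 0 (\<lambda>_. pmf_of_set {..<n})"

definition resample :: "(nat \<Rightarrow> real) \<Rightarrow> (nat \<Rightarrow> nat) \<Rightarrow> nat \<Rightarrow> real" where
  "resample x J = (\<lambda>j. x (J j))"

lemma resample_iid_from_empirical:
  "map_pmf (resample x) (boot_indices n) =
     Pi_pmf {..<n} (x 0) (\<lambda>_. map_pmf x (pmf_of_set {..<n}))"
  unfolding boot_indices_def resample_def
  by (subst Pi_pmf_map) (auto intro!: map_pmf_cong)

definition boot_count :: "nat \<Rightarrow> (nat \<Rightarrow> nat) \<Rightarrow> nat \<Rightarrow> nat" where
  "boot_count n J i = card {j \<in> {..<n}. J j = i}"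

definition boot_process ::
  "nat \<Rightarrow> (nat \<Rightarrow> real) \<Rightarrow> (nat \<Rightarrow> nat) \<Rightarrow> (real \<Rightarrow> 'b::real_vector) \<Rightarrow> 'b" where
  "boot_process n x J h =
     (1 / sqrt (real n)) *\<^sub>R (\<Sum>i<n. (real (boot_count n J i) - 1) *\<^sub>R h (x i))"

definition boot_tendsto_zero ::
  "'a measure \<Rightarrow> (nat \<Rightarrow> 'a \<Rightarrow> (nat \<Rightarrow> nat) \<Rightarrow> 'b::real_normed_vector) \<Rightarrow> bool" where
  "boot_tendsto_zero M R \<longleftrightarrow>
     (\<forall>\<epsilon>>0. tendsto_zero_in_prob M
        (\<lambda>n \<omega>. measure_pmf.prob (boot_indices n) {J. \<epsilon> < norm (R n \<omega> J)}))"

definition boot_equicontinuous_at ::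
  "'a measure \<Rightarrow> (nat \<Rightarrow> 'a \<Rightarrow> real) \<Rightarrow> (real \<Rightarrow> real) \<Rightarrow> real \<times> real \<Rightarrow> bool" where
  "boot_equicontinuous_at M X G0 \<theta>0 \<longleftrightarrow>
     (\<forall>\<delta>. decseq \<delta> \<and> \<delta> \<longlonglongrightarrow> 0 \<longrightarrow>
        boot_tendsto_zero M (\<lambda>n \<omega> J.
          SUP \<theta> \<in> {\<theta> \<in> param_space. norm (\<theta> - \<theta>0) \<le> \<delta> n}.
            \<bar>boot_process n (\<lambda>i. X i \<omega>) J (\<lambda>x. chart G0 \<theta> x - chart G0 \<theta>0 x)\<bar>))"

definition bl_dist :: "real measure \<Rightarrow> real measure \<Rightarrow> real" where
  "bl_dist \<mu> \<nu> =
     (SUP f \<in> {f :: real \<Rightarrow> real. (\<forall>x. \<bar>f x\<bar> \<le> 1) \<and> 1-lipschitz_on UNIV f}.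
        \<bar>integral\<^sup>L \<mu> f - integral\<^sup>L \<nu> f\<bar>)"

definition boot_weakly_converges ::
  "'a measure \<Rightarrow> (nat \<Rightarrow> 'a \<Rightarrow> (nat \<Rightarrow> nat) \<Rightarrow> real) \<Rightarrow> real measure \<Rightarrow> bool" where
  "boot_weakly_converges M R L \<longleftrightarrow>
     tendsto_zero_in_prob M
       (\<lambda>n \<omega>. bl_dist (measure_pmf (map_pmf (R n \<omega>) (boot_indices n))) L)"

text \<open>The second argument is the variance.\<close>

definition normal_law :: "real \<Rightarrow> real \<Rightarrow> real measure" where
  "normal_law \<mu> v =
     (if v = 0 then return borel \<mu> else density lborel (normal_density \<mu> (sqrt v)))"

end

theory Submission
  imports Defs
begin

text \<open>
  Pairs (data, resampled indices) carry a filter of events whose conditional bootstrap probability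
  tends to 1 in probability. Convergence \<open>o\<^sub>P\<^sub>*(1)\<close> in probability is convergence to 0 along this
  filter, so the usual calculus of limits applies, and a delta method holds for
  \<open>O\<^sub>P\<^sub>*(1)\<close> sequences.

  The estimator is \<open>\<beta> (\<theta>, c) = \<mu> + \<sigma> G0\<inverse>(c)\<close> at the preliminary estimate and the empirical chart
  mean. Both it and its bootstrap version are expanded around \<open>(\<theta>0, m \<theta>0)\<close>, where
  \<open>\<beta>\<close> is differentiable. The two empirical chart means are controlled by bootstrap
  equicontinuity and by the equicontinuity that the Donsker property implies; the terms of the
  original sample cancel in the difference, which leaves the bootstrap process of \<open>IF_ad\<close>. The
  latter obeys a conditional central limit theorem, proved with characteristic functions.
\<close>

section \<open>Bootstrap stochastic order\<close>

text \<open>The hypotheses give differentiability at single points only: of \<open>m\<close> at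
  \<open>\<theta>0\<close> and of the chart at \<open>b0\<close>. Expanding the bootstrap estimator
  around the original one would need derivatives at a moving point, so two expansions around the
  same fixed point are subtracted. The price is root-n boundedness of both errors, which follows
  from asymptotic linearity and second moments.

  Suprema over the chart class need not be measurable, and there is no joint measure on data and
  indices. A set of triples is therefore judged in two stages: outside a measurable data event of
  small probability, its conditional probability is small.

  The Donsker property concerns the original sample but is also used at the bootstrap parameter. Its
  equicontinuity bound holds for all nearby parameters on one data event, so the parameter may
  depend on the resampled indices.

  The limit theorem for the bootstrap process is made uniform over all fixed data sets that satisfy
  three numerical conditions; random data satisfy these with high probability.\<close>

definition boot_rare :: "'a measure \<Rightarrow> nat \<Rightarrow> real \<Rightarrow> ('a \<Rightarrow> (nat \<Rightarrow> nat) \<Rightarrow> bool) \<Rightarrow> bool" where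
  "boot_rare M n \<epsilon> A \<longleftrightarrow>
     (\<exists>B\<in>sets M. measure M B \<le> \<epsilon> \<and>
        (\<forall>\<omega>\<in>space M - B. measure_pmf.prob (boot_indices n) {J. A \<omega> J} \<le> \<epsilon>))"

text \<open>Index functions outside the support of \<open>boot_indices n\<close> have conditional
  probability 0, so the inclusion is demanded on the support only. This is how
  \<open>J j < n\<close> becomes available.\<close>

lemma boot_rare_mono:
  assumes "boot_rare M n \<epsilon> A" "\<epsilon> \<le> \<epsilon>'"
    and "\<And>\<omega> J. \<omega> \<in> space M \<Longrightarrow> J \<in> set_pmf (boot_indices n) \<Longrightarrow> A' \<omega> J \<Longrightarrow> A \<omega> J"
  shows "boot_rare M n \<epsilon>' A'"
proof -
  obtain B where B: "B \<in> sets M" "measure M B \<le> \<epsilon>"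
    "\<And>\<omega>. \<omega> \<in> space M - B \<Longrightarrow> measure_pmf.prob (boot_indices n) {J. A \<omega> J} \<le> \<epsilon>"
    using assms(1) unfolding boot_rare_def by blast
  have "measure_pmf.prob (boot_indices n) {J. A' \<omega> J} \<le> \<epsilon>'" if "\<omega> \<in> space M - B" for \<omega>
  proof -
    have "measure_pmf.prob (boot_indices n) {J. A' \<omega> J} \<le> measure_pmf.prob (boot_indices n) {J. A \<omega> J}"
      using that assms(3)
      by (intro measure_pmf.finite_measure_mono_AE) (auto simp: AE_measure_pmf_iff)
    with B(3)[OF that] assms(2) show ?thesis by linarith
  qed
  moreover have "measure M B \<le> \<epsilon>'" using B(2) assms(2) by linarith
  ultimately show ?thesis using B(1) unfolding boot_rare_def by blast
qed

lemma boot_rare_disj: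
  assumes "boot_rare M n \<epsilon> A" "boot_rare M n \<epsilon>' A'"
  shows "boot_rare M n (\<epsilon> + \<epsilon>') (\<lambda>\<omega> J. A \<omega> J \<or> A' \<omega> J)"
proof -
  obtain B where B: "B \<in> sets M" "measure M B \<le> \<epsilon>"
    "\<And>\<omega>. \<omega> \<in> space M - B \<Longrightarrow> measure_pmf.prob (boot_indices n) {J. A \<omega> J} \<le> \<epsilon>"
    using assms(1) unfolding boot_rare_def by blast
  obtain B' where B': "B' \<in> sets M" "measure M B' \<le> \<epsilon>'"
    "\<And>\<omega>. \<omega> \<in> space M - B' \<Longrightarrow> measure_pmf.prob (boot_indices n) {J. A' \<omega> J} \<le> \<epsilon>'"
    using assms(2) unfolding boot_rare_def by blast
  have "measure M (B \<union> B') \<le> \<epsilon> + \<epsilon>'"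
    using measure_Un_le[OF B(1) B'(1)] B(2) B'(2) by linarith
  moreover have "measure_pmf.prob (boot_indices n) {J. A \<omega> J \<or> A' \<omega> J} \<le> \<epsilon> + \<epsilon>'"
    if "\<omega> \<in> space M - (B \<union> B')" for \<omega>
  proof -
    have "{J. A \<omega> J \<or> A' \<omega> J} = {J. A \<omega> J} \<union> {J. A' \<omega> J}" by auto
    then have "measure_pmf.prob (boot_indices n) {J. A \<omega> J \<or> A' \<omega> J} \<le>
      measure_pmf.prob (boot_indices n) {J. A \<omega> J} + measure_pmf.prob (boot_indices n) {J. A' \<omega> J}"
      by (simp add: measure_Un_le)
    with B(3)[of \<omega>] B'(3)[of \<omega>] that show ?thesis by auto
  qed
  ultimately show ?thesis
    unfolding boot_rare_def using B(1) B'(1) by (intro bexI[of _ "B \<union> B'"]) auto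
qed

text \<open>The sample size is a component of the point, so one filter carries deterministic
  sequences, functions of the data and bootstrap quantities, and the ordinary limit rules combine
  them.\<close>

definition boot_filter :: "'a measure \<Rightarrow> (nat \<times> 'a \<times> (nat \<Rightarrow> nat)) filter" where
  "boot_filter M =
     Abs_filter (\<lambda>Q. \<forall>\<epsilon>>0. \<forall>\<^sub>F n in sequentially. boot_rare M n \<epsilon> (\<lambda>\<omega> J. \<not> Q (n, \<omega>, J)))"

lemma eventually_boot_filter:
  "eventually Q (boot_filter M) \<longleftrightarrow>
     (\<forall>\<epsilon>>0. \<forall>\<^sub>F n in sequentially. boot_rare M n \<epsilon> (\<lambda>\<omega> J. \<not> Q (n, \<omega>, J)))"
  unfolding boot_filter_def
proof (rule eventually_Abs_filter, rule is_filter.intro, goal_cases)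
  case 1
  show ?case by (auto simp: boot_rare_def intro!: always_eventually bexI[of _ "{}"])
next
  case (2 Q R)
  show ?case
  proof (intro allI impI)
    fix \<epsilon> :: real assume "\<epsilon> > 0"
    then have "\<forall>\<^sub>F n in sequentially. boot_rare M n (\<epsilon>/2) (\<lambda>\<omega> J. \<not> Q (n, \<omega>, J))"
      "\<forall>\<^sub>F n in sequentially. boot_rare M n (\<epsilon>/2) (\<lambda>\<omega> J. \<not> R (n, \<omega>, J))"
      using 2 by auto
    then show "\<forall>\<^sub>F n in sequentially. boot_rare M n \<epsilon> (\<lambda>\<omega> J. \<not> (Q (n, \<omega>, J) \<and> R (n, \<omega>, J)))"
      by eventually_elim (auto dest: boot_rare_disj)
  qed
next
  case (3 Q R)
  show ?case
  proof (intro allI impI)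
    fix \<epsilon> :: real assume "\<epsilon> > 0"
    then have "\<forall>\<^sub>F n in sequentially. boot_rare M n \<epsilon> (\<lambda>\<omega> J. \<not> Q (n, \<omega>, J))"
      using 3 by auto
    then show "\<forall>\<^sub>F n in sequentially. boot_rare M n \<epsilon> (\<lambda>\<omega> J. \<not> R (n, \<omega>, J))"
      by (rule eventually_mono) (erule boot_rare_mono, use 3 in auto)
  qed
qed

lemma eventually_boot_filterI:
  assumes "\<forall>\<^sub>F n in sequentially. \<forall>\<omega>\<in>space M. \<forall>J\<in>set_pmf (boot_indices n). Q (n, \<omega>, J)"
  shows "eventually Q (boot_filter M)"
  unfolding eventually_boot_filter
proof (intro allI impI)
  fix \<epsilon> :: real assume "\<epsilon> > 0"
  show "\<forall>\<^sub>F n in sequentially. boot_rare M n \<epsilon> (\<lambda>\<omega> J. \<not> Q (n, \<omega>, J))"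
    using assms
  proof eventually_elim
    case (elim n)
    have "boot_rare M n 0 (\<lambda>\<omega> J. False)" by (auto simp: boot_rare_def intro!: bexI[of _ "{}"])
    then show ?case by (rule boot_rare_mono) (use \<open>\<epsilon> > 0\<close> elim in auto)
  qed
qed

lemma filterlim_fst_boot_filter: "filterlim fst sequentially (boot_filter M)"
  unfolding filterlim_iff
proof (intro allI impI)
  fix Q :: "nat \<Rightarrow> bool" assume "eventually Q sequentially"
  then show "\<forall>\<^sub>F z in boot_filter M. Q (fst z)"
    by (intro eventually_boot_filterI) (simp add: eventually_mono)
qed

lemma tendsto_boot_filter_seq:
  "a \<longlonglongrightarrow> l \<Longrightarrow> ((\<lambda>z. a (fst z)) \<longlongrightarrow> l) (boot_filter M)"
  by (rule filterlim_compose[OF _ filterlim_fst_boot_filter])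

text \<open>A set of small outer measure lies in a measurable set of small measure, so outer
  probability can be traded for a measurable exceptional event \<open>B\<close>. Several such events
  are then joined by the union bound.\<close>

lemma tendsto_zero_in_prob_iff:
  assumes "finite_measure M"
  shows "tendsto_zero_in_prob M R \<longleftrightarrow>
    (\<forall>\<delta>>0. \<forall>\<epsilon>>0. \<forall>\<^sub>F n in sequentially.
       \<exists>B\<in>sets M. measure M B \<le> \<epsilon> \<and> (\<forall>\<omega>\<in>space M - B. norm (R n \<omega>) \<le> \<delta>))"
proof -
  interpret finite_measure M by fact
  have outer_lt: "outer_measure_of M A < ennreal \<epsilon> \<Longrightarrow> \<exists>B\<in>sets M. A \<subseteq> B \<and> measure M B \<le> \<epsilon>" for A \<epsilon>
    unfolding outer_measure_of_def INF_less_iff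
    by (auto simp: emeasure_eq_measure ennreal_less_iff intro: less_imp_le)
  have "(\<lambda>n. outer_measure_of M (A n)) \<longlonglongrightarrow> 0 \<longleftrightarrow>
      (\<forall>\<epsilon>>0. \<forall>\<^sub>F n in sequentially. \<exists>B\<in>sets M. A n \<subseteq> B \<and> measure M B \<le> \<epsilon>)" (is "?l \<longleftrightarrow> ?r") for A
  proof
    assume l: ?l
    show ?r
    proof (intro allI impI)
      fix \<epsilon> :: real assume "\<epsilon> > 0"
      then have "\<forall>\<^sub>F n in sequentially. outer_measure_of M (A n) < ennreal \<epsilon>"
        using order_tendstoD(2)[OF l, of "ennreal \<epsilon>"] by simp
      then show "\<forall>\<^sub>F n in sequentially. \<exists>B\<in>sets M. A n \<subseteq> B \<and> measure M B \<le> \<epsilon>"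
        by eventually_elim (rule outer_lt)
    qed
  next
    assume r: ?r
    show ?l
    proof (rule order_tendstoI)
      fix a :: ennreal assume "0 < a"
      \<comment> \<open>The level \<open>a\<close> may be infinite; a finite one strictly below it
        can be turned into a real number.\<close>
      then obtain b where b: "0 < b" "b < a" using dense by blast
      have "b < top" using order.strict_trans2[OF b(2) top_greatest] .
      define e where "e = enn2real b"
      have e: "0 < e" "ennreal e < a"
        using b \<open>b < top\<close> by (auto simp: e_def enn2real_positive_iff)
      from r e(1) have "\<forall>\<^sub>F n in sequentially. \<exists>B\<in>sets M. A n \<subseteq> B \<and> measure M B \<le> e" by blast
      then show "\<forall>\<^sub>F n in sequentially. outer_measure_of M (A n) < a"
      proof eventually_elim
        case (elim n)
        then obtain B where "B \<in> sets M" "A n \<subseteq> B" "measure M B \<le> e" by blast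
        then have "outer_measure_of M (A n) \<le> ennreal e"
          unfolding outer_measure_of_def
          by (intro INF_lower2[of B]) (auto simp: emeasure_eq_measure intro: ennreal_leI)
        with e show ?case by (rule_tac le_less_trans)
      qed
    qed simp
  qed
  note * = this
  have **: "(\<exists>B\<in>sets M. {\<omega> \<in> space M. \<delta> < norm (R n \<omega>)} \<subseteq> B \<and> measure M B \<le> \<epsilon>) \<longleftrightarrow>
     (\<exists>B\<in>sets M. measure M B \<le> \<epsilon> \<and> (\<forall>\<omega>\<in>space M - B. norm (R n \<omega>) \<le> \<delta>))" for \<delta> \<epsilon> n
    by (intro bex_cong refl) (auto simp: not_less[symmetric])
  show ?thesis unfolding tendsto_zero_in_prob_def * ** ..
qed

text \<open>The definition has separate tolerances for the conditional probability and for the data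
  event. Both range over all positive reals, so the smaller of the two serves for both.\<close>

lemma boot_tendsto_zero_iff:
  assumes "finite_measure M"
  shows "boot_tendsto_zero M R \<longleftrightarrow> ((\<lambda>(n, \<omega>, J). R n \<omega> J) \<longlongrightarrow> 0) (boot_filter M)"
proof -
  have "boot_tendsto_zero M R \<longleftrightarrow>
     (\<forall>\<delta>>0. \<forall>\<eta>>0. \<forall>\<epsilon>>0. \<forall>\<^sub>F n in sequentially. \<exists>B\<in>sets M. measure M B \<le> \<epsilon> \<and>
        (\<forall>\<omega>\<in>space M - B. measure_pmf.prob (boot_indices n) {J. \<delta> < norm (R n \<omega> J)} \<le> \<eta>))"
    unfolding boot_tendsto_zero_def tendsto_zero_in_prob_iff[OF assms] by simp
  also have "\<dots> \<longleftrightarrow> (\<forall>\<delta>>0. \<forall>\<epsilon>>0. \<forall>\<^sub>F n in sequentially. boot_rare M n \<epsilon> (\<lambda>\<omega> J. \<delta> < norm (R n \<omega> J)))"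
  proof (intro iffI allI impI)
    fix \<delta> \<epsilon> :: real
    assume "\<forall>\<delta>>0. \<forall>\<eta>>0. \<forall>\<epsilon>>0. \<forall>\<^sub>F n in sequentially. \<exists>B\<in>sets M. measure M B \<le> \<epsilon> \<and>
        (\<forall>\<omega>\<in>space M - B. measure_pmf.prob (boot_indices n) {J. \<delta> < norm (R n \<omega> J)} \<le> \<eta>)"
      and "\<delta> > 0" "\<epsilon> > 0"
    then show "\<forall>\<^sub>F n in sequentially. boot_rare M n \<epsilon> (\<lambda>\<omega> J. \<delta> < norm (R n \<omega> J))"
      unfolding boot_rare_def by blast
  next
    fix \<delta> \<eta> \<epsilon> :: real
    assume *: "\<forall>\<delta>>0. \<forall>\<epsilon>>0. \<forall>\<^sub>F n in sequentially. boot_rare M n \<epsilon> (\<lambda>\<omega> J. \<delta> < norm (R n \<omega> J))"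
      and "\<delta> > 0" "\<eta> > 0" "\<epsilon> > 0"
    then have "\<forall>\<^sub>F n in sequentially. boot_rare M n (min \<eta> \<epsilon>) (\<lambda>\<omega> J. \<delta> < norm (R n \<omega> J))"
      by simp
    then show "\<forall>\<^sub>F n in sequentially. \<exists>B\<in>sets M. measure M B \<le> \<epsilon> \<and>
        (\<forall>\<omega>\<in>space M - B. measure_pmf.prob (boot_indices n) {J. \<delta> < norm (R n \<omega> J)} \<le> \<eta>)"
      unfolding boot_rare_def by eventually_elim (meson min.boundedE)
  qed
  also have "\<dots> \<longleftrightarrow> (\<forall>\<delta>>0. \<forall>\<^sub>F z in boot_filter M. norm (case z of (n, \<omega>, J) \<Rightarrow> R n \<omega> J) \<le> \<delta>)"
    unfolding eventually_boot_filter by (simp add: not_le)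
  also have "\<dots> \<longleftrightarrow> ((\<lambda>(n, \<omega>, J). R n \<omega> J) \<longlongrightarrow> 0) (boot_filter M)"
    unfolding tendsto_iff dist_norm diff_zero
  proof (intro iffI allI impI)
    fix e :: real assume *: "\<forall>\<delta>>0. \<forall>\<^sub>F z in boot_filter M. norm (case z of (n, \<omega>, J) \<Rightarrow> R n \<omega> J) \<le> \<delta>" "e > 0"
    then have "\<forall>\<^sub>F z in boot_filter M. norm (case z of (n, \<omega>, J) \<Rightarrow> R n \<omega> J) \<le> e/2"
      using half_gt_zero by blast
    then show "\<forall>\<^sub>F z in boot_filter M. norm (case z of (n, \<omega>, J) \<Rightarrow> R n \<omega> J) < e"
      by eventually_elim (use \<open>e > 0\<close> in linarith)
  next
    fix \<delta> :: real assume "\<forall>e>0. \<forall>\<^sub>F z in boot_filter M. norm (case z of (n, \<omega>, J) \<Rightarrow> R n \<omega> J) < e" "\<delta> > 0"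
    then have "\<forall>\<^sub>F z in boot_filter M. norm (case z of (n, \<omega>, J) \<Rightarrow> R n \<omega> J) < \<delta>" by blast
    then show "\<forall>\<^sub>F z in boot_filter M. norm (case z of (n, \<omega>, J) \<Rightarrow> R n \<omega> J) \<le> \<delta>"
      by (rule eventually_mono) simp
  qed
  finally show ?thesis .
qed

text \<open>For a quantity that ignores \<open>J\<close> the conditional probability is 0 or 1,
  hence exactly 0 off the data event.\<close>

lemma tendsto_zero_in_prob_imp_boot_filter:
  assumes "finite_measure M" "tendsto_zero_in_prob M R"
  shows "((\<lambda>(n, \<omega>, J). R n \<omega>) \<longlongrightarrow> 0) (boot_filter M)"
proof -
  have "boot_tendsto_zero M (\<lambda>n \<omega> J. R n \<omega>)"
    unfolding boot_tendsto_zero_def tendsto_zero_in_prob_iff[OF assms(1)]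
  proof (intro allI impI)
    fix \<delta> \<eta> \<epsilon> :: real assume "\<delta> > 0" "\<eta> > 0" "\<epsilon> > 0"
    then have "\<forall>\<^sub>F n in sequentially. \<exists>B\<in>sets M. measure M B \<le> \<epsilon> \<and> (\<forall>\<omega>\<in>space M - B. norm (R n \<omega>) \<le> \<delta>)"
      using assms(2) unfolding tendsto_zero_in_prob_iff[OF assms(1)] by blast
    then show "\<forall>\<^sub>F n in sequentially. \<exists>B\<in>sets M. measure M B \<le> \<epsilon> \<and>
        (\<forall>\<omega>\<in>space M - B. norm (measure_pmf.prob (boot_indices n) {J. \<delta> < norm (R n \<omega>)}) \<le> \<eta>)"
    proof eventually_elim
      case (elim n)
      then obtain B where B: "B \<in> sets M" "measure M B \<le> \<epsilon>" "\<forall>\<omega>\<in>space M - B. norm (R n \<omega>) \<le> \<delta>" by blast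
      have "norm (measure_pmf.prob (boot_indices n) {J. \<delta> < norm (R n \<omega>)}) \<le> \<eta>"
        if "\<omega> \<in> space M - B" for \<omega>
      proof -
        have "\<not> \<delta> < norm (R n \<omega>)" using B(3) that by (auto simp: not_less)
        then show ?thesis using \<open>\<eta> > 0\<close> by simp
      qed
      with B(1,2) show ?case by blast
    qed
  qed
  then show ?thesis unfolding boot_tendsto_zero_iff[OF assms(1)] .
qed

text \<open>\<open>O\<^sub>P\<^sub>*(1)\<close> in probability, phrased as \<open>O(1) \<cdot> o(1) = o(1)\<close> along the filter.\<close>

definition boot_bounded :: "'a measure \<Rightarrow> (nat \<times> 'a \<times> (nat \<Rightarrow> nat) \<Rightarrow> 'b::real_normed_vector) \<Rightarrow> bool" where
  "boot_bounded M R \<longleftrightarrow>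
     (\<forall>S :: _ \<Rightarrow> real. (S \<longlongrightarrow> 0) (boot_filter M) \<longrightarrow> ((\<lambda>z. norm (R z) * S z) \<longlongrightarrow> 0) (boot_filter M))"

text \<open>Uniform tightness is the criterion: off a rare set the first factor is at most
  \<open>B\<close>, and off another one \<open>S\<close> is below \<open>e / B\<close>.\<close>

lemma boot_boundedI:
  assumes "\<And>\<epsilon>. \<epsilon> > 0 \<Longrightarrow> \<exists>B. \<forall>\<^sub>F n in sequentially. boot_rare M n \<epsilon> (\<lambda>\<omega> J. B < norm (R (n, \<omega>, J)))"
  shows "boot_bounded M R"
  unfolding boot_bounded_def
proof (intro allI impI)
  fix S :: "nat \<times> 'a \<times> (nat \<Rightarrow> nat) \<Rightarrow> real" assume S: "(S \<longlongrightarrow> 0) (boot_filter M)"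
  show "((\<lambda>z. norm (R z) * S z) \<longlongrightarrow> 0) (boot_filter M)"
    unfolding tendsto_iff eventually_boot_filter dist_norm diff_zero
  proof (intro allI impI)
    fix e \<epsilon> :: real assume "e > 0" "\<epsilon> > 0"
    obtain B0 where B0: "\<forall>\<^sub>F n in sequentially. boot_rare M n (\<epsilon>/2) (\<lambda>\<omega> J. B0 < norm (R (n, \<omega>, J)))"
      using assms[of "\<epsilon>/2"] \<open>\<epsilon> > 0\<close> by auto
    define B where "B = max B0 1"
    have "B > 0" by (simp add: B_def)
    then have "\<forall>\<^sub>F z in boot_filter M. norm (S z) < e / B"
      using S \<open>e > 0\<close> unfolding tendsto_iff dist_norm diff_zero by simp
    then have "\<forall>\<^sub>F n in sequentially. boot_rare M n (\<epsilon>/2) (\<lambda>\<omega> J. \<not> norm (S (n, \<omega>, J)) < e / B)"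
      unfolding eventually_boot_filter using \<open>\<epsilon> > 0\<close> by simp
    with B0 show "\<forall>\<^sub>F n in sequentially. boot_rare M n \<epsilon> (\<lambda>\<omega> J. \<not> norm (norm (R (n, \<omega>, J)) * S (n, \<omega>, J)) < e)"
    proof eventually_elim
      case (elim n)
      show ?case
      proof (rule boot_rare_mono[OF boot_rare_disj[OF elim]])
        fix \<omega> J
        assume *: "\<not> norm (norm (R (n, \<omega>, J)) * S (n, \<omega>, J)) < e"
        show "B0 < norm (R (n, \<omega>, J)) \<or> \<not> norm (S (n, \<omega>, J)) < e / B"
        proof (rule ccontr)
          assume "\<not> ?thesis"
          then have "norm (R (n, \<omega>, J)) \<le> B" "norm (S (n, \<omega>, J)) < e / B" by (auto simp: B_def)
          then have "norm (R (n, \<omega>, J)) * norm (S (n, \<omega>, J)) < B * (e / B)"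
            using \<open>B > 0\<close> by (intro order.strict_trans1[OF mult_right_mono mult_strict_left_mono]) auto
          with * \<open>B > 0\<close> show False by (simp add: abs_mult)
        qed
      qed simp
    qed
  qed
qed

lemma boot_bounded_mult:
  "boot_bounded M R \<Longrightarrow> (S \<longlongrightarrow> (0::real)) (boot_filter M) \<Longrightarrow> ((\<lambda>z. norm (R z) * S z) \<longlongrightarrow> 0) (boot_filter M)"
  by (simp add: boot_bounded_def)

lemma boot_bounded_tendsto_zero:
  assumes "(R \<longlongrightarrow> 0) (boot_filter M)"
  shows "boot_bounded M R"
  unfolding boot_bounded_def using tendsto_mult_zero tendsto_norm_zero[OF assms] by blast

lemma boot_bounded_le:
  assumes "boot_bounded M R" "\<And>z. norm (R' z) \<le> C * norm (R z)"
  shows "boot_bounded M R'"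
  unfolding boot_bounded_def
proof (intro allI impI)
  fix S :: "nat \<times> 'a \<times> (nat \<Rightarrow> nat) \<Rightarrow> real" assume "(S \<longlongrightarrow> 0) (boot_filter M)"
  then have "((\<lambda>z. C * norm (norm (R z) * S z)) \<longlongrightarrow> 0) (boot_filter M)"
    using assms(1) by (intro tendsto_mult_right_zero tendsto_norm_zero boot_bounded_mult)
  then show "((\<lambda>z. norm (R' z) * S z) \<longlongrightarrow> 0) (boot_filter M)"
  proof (rule Lim_null_comparison[rotated], intro always_eventually allI)
    fix z
    have "norm (R' z) * \<bar>S z\<bar> \<le> C * norm (R z) * \<bar>S z\<bar>"
      using assms(2) by (intro mult_right_mono) auto
    then show "norm (norm (R' z) * S z) \<le> C * norm (norm (R z) * S z)" by (simp add: abs_mult)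
  qed
qed

lemma boot_bounded_add:
  assumes "boot_bounded M R" "boot_bounded M R'"
  shows "boot_bounded M (\<lambda>z. R z + R' z)"
  unfolding boot_bounded_def
proof (intro allI impI)
  fix S :: "nat \<times> 'a \<times> (nat \<Rightarrow> nat) \<Rightarrow> real" assume "(S \<longlongrightarrow> 0) (boot_filter M)"
  then have "((\<lambda>z. norm (norm (R z) * S z) + norm (norm (R' z) * S z)) \<longlongrightarrow> 0) (boot_filter M)"
    using assms by (intro tendsto_add_zero tendsto_norm_zero boot_bounded_mult)
  then show "((\<lambda>z. norm (R z + R' z) * S z) \<longlongrightarrow> 0) (boot_filter M)"
  proof (rule Lim_null_comparison[rotated], intro always_eventually allI)
    fix z
    have "norm (R z + R' z) * \<bar>S z\<bar> \<le> (norm (R z) + norm (R' z)) * \<bar>S z\<bar>"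
      by (intro mult_right_mono norm_triangle_ineq) auto
    then show "norm (norm (R z + R' z) * S z) \<le> norm (norm (R z) * S z) + norm (norm (R' z) * S z)"
      by (simp add: abs_mult algebra_simps)
  qed
qed

lemma boot_bounded_Pair:
  assumes "boot_bounded M R" "boot_bounded M R'"
  shows "boot_bounded M (\<lambda>z. (R z, R' z))"
proof -
  have "boot_bounded M (\<lambda>z. (R z, 0) + (0, R' z))"
    by (intro boot_bounded_add boot_bounded_le[where C = 1 and R' = "\<lambda>z. (R z, 0)", OF assms(1)]
          boot_bounded_le[where C = 1 and R' = "\<lambda>z. (0, R' z)", OF assms(2)])
       (simp_all add: norm_Pair)
  then show ?thesis by simp
qed

lemma boot_bounded_linear:
  assumes "boot_bounded M R" "bounded_linear f"
  shows "boot_bounded M (\<lambda>z. f (R z))"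
proof -
  obtain K where "\<And>x. norm (f x) \<le> norm x * K" using bounded_linear.bounded[OF assms(2)] by blast
  then show ?thesis by (intro boot_bounded_le[OF assms(1), of _ K]) (simp add: mult.commute)
qed

lemma boot_bounded_cong_tendsto:
  assumes "((\<lambda>z. R z - R' z) \<longlongrightarrow> 0) (boot_filter M)" "boot_bounded M R'"
  shows "boot_bounded M R"
  using boot_bounded_add[OF boot_bounded_tendsto_zero[OF assms(1)] assms(2)] by simp

text \<open>The null sequence fed into \<open>boot_bounded\<close> is \<open>1 / sqrt n\<close>; it
  cancels the scaling.\<close>

lemma tendsto_of_boot_bounded:
  fixes Y :: "nat \<times> 'a \<times> (nat \<Rightarrow> nat) \<Rightarrow> 'b::real_normed_vector"
  assumes "boot_bounded M (\<lambda>z. sqrt (real (fst z)) *\<^sub>R (Y z - y))"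
  shows "(Y \<longlongrightarrow> y) (boot_filter M)"
proof -
  have "(\<lambda>n. 1 / sqrt (real n)) \<longlonglongrightarrow> 0"
    using tendsto_inverse_0_at_top[OF filterlim_compose[OF sqrt_at_top filterlim_real_sequentially]] by (simp add: inverse_eq_divide)
  from boot_bounded_mult[OF assms tendsto_boot_filter_seq[OF this]]
  have *: "((\<lambda>z. norm (sqrt (real (fst z)) *\<^sub>R (Y z - y)) * (1 / sqrt (real (fst z)))) \<longlongrightarrow> 0) (boot_filter M)" .
  have "\<forall>\<^sub>F z in boot_filter M. fst z \<ge> 1"
    using filterlim_fst_boot_filter eventually_ge_at_top unfolding filterlim_iff by blast
  then have "\<forall>\<^sub>F z in boot_filter M. norm (sqrt (real (fst z)) *\<^sub>R (Y z - y)) * (1 / sqrt (real (fst z))) = norm (Y z - y)"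
    by eventually_elim auto
  with * have "((\<lambda>z. norm (Y z - y)) \<longlongrightarrow> 0) (boot_filter M)"
    by (rule Lim_transform_eventually)
  then show ?thesis
    by (rule LIM_zero_cancel[OF tendsto_norm_zero_cancel])
qed

text \<open>The scaled linearisation error is the root-n distance times the relative error
  \<open>\<rho>\<close>, thus a bounded factor times a null one. Since the centre \<open>y\<close>
  is fixed, differentiability at that one point is enough.\<close>

lemma boot_delta_method:
  fixes Y :: "nat \<times> 'a \<times> (nat \<Rightarrow> nat) \<Rightarrow> 'b::real_normed_vector" and f :: "'b \<Rightarrow> 'c::real_normed_vector"
  assumes bdd: "boot_bounded M (\<lambda>z. sqrt (real (fst z)) *\<^sub>R (Y z - y))"
    and f: "(f has_derivative f') (at y)"
  shows "((\<lambda>z. sqrt (real (fst z)) *\<^sub>R (f (Y z) - f y) - f' (sqrt (real (fst z)) *\<^sub>R (Y z - y))) \<longlongrightarrow> 0) (boot_filter M)"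
proof -
  \<comment> \<open>At \<open>y\<close> the quotient by zero evaluates to 0, exactly the value that
    makes \<open>\<rho>\<close> continuous there; \<open>Y z = y\<close> is not excluded.\<close>
  define \<rho> where "\<rho> x = norm (f x - f y - f' (x - y)) / norm (x - y)" for x
  have blin: "bounded_linear f'" using f by (rule has_derivative_bounded_linear)
  have "\<rho> \<midarrow>y\<rightarrow> 0"
    using f unfolding has_derivative_iff_norm \<rho>_def by simp
  moreover have "\<rho> y = 0" by (simp add: \<rho>_def)
  ultimately have "isCont \<rho> y" by (simp add: isCont_def)
  from isCont_tendsto_compose[OF this tendsto_of_boot_bounded[OF bdd]]
  have "((\<lambda>z. \<rho> (Y z)) \<longlongrightarrow> 0) (boot_filter M)" using \<open>\<rho> y = 0\<close> by simp
  from boot_bounded_mult[OF bdd this]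
  have "((\<lambda>z. norm (sqrt (real (fst z)) *\<^sub>R (Y z - y)) * \<rho> (Y z)) \<longlongrightarrow> 0) (boot_filter M)" .
  then show ?thesis
  proof (rule Lim_null_comparison[rotated], intro always_eventually allI)
    fix z
    have "sqrt (real (fst z)) *\<^sub>R (f (Y z) - f y) - f' (sqrt (real (fst z)) *\<^sub>R (Y z - y)) =
      sqrt (real (fst z)) *\<^sub>R (f (Y z) - f y - f' (Y z - y))"
      unfolding scaleR_diff_right[of _ "f (Y z) - f y"] linear_cmul[OF bounded_linear.linear[OF blin]] ..
    moreover have "norm (f (Y z) - f y - f' (Y z - y)) = norm (Y z - y) * \<rho> (Y z)"
      using linear_0[OF bounded_linear.linear[OF blin]] by (cases "Y z = y") (auto simp: \<rho>_def)
    ultimately show "norm (sqrt (real (fst z)) *\<^sub>R (f (Y z) - f y) - f' (sqrt (real (fst z)) *\<^sub>R (Y z - y)))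
      \<le> norm (sqrt (real (fst z)) *\<^sub>R (Y z - y)) * \<rho> (Y z)"
      by simp
  qed
qed

section \<open>Second moments\<close>

text \<open>Cross terms factor by independence and vanish because the means are 0.\<close>

lemma (in prob_space) second_moment_sum_indep:
  fixes Y :: "'i \<Rightarrow> 'a \<Rightarrow> real"
  assumes "finite I" and indep: "indep_vars (\<lambda>_. borel) Y I"
    and sq: "\<And>i. i \<in> I \<Longrightarrow> integrable M (\<lambda>\<omega>. (Y i \<omega>)\<^sup>2)"
    and mean: "\<And>i. i \<in> I \<Longrightarrow> expectation (Y i) = 0"
  shows "integrable M (\<lambda>\<omega>. (\<Sum>i\<in>I. Y i \<omega>)\<^sup>2)" (is ?int)
    and "expectation (\<lambda>\<omega>. (\<Sum>i\<in>I. Y i \<omega>)\<^sup>2) = (\<Sum>i\<in>I. expectation (\<lambda>\<omega>. (Y i \<omega>)\<^sup>2))" (is ?eq)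
proof -
  have rv: "i \<in> I \<Longrightarrow> random_variable borel (Y i)" for i
    using indep by (auto simp: indep_vars_def)
  have int: "integrable M (Y i)" if "i \<in> I" for i
    using square_integrable_imp_integrable[OF rv[OF that] sq[OF that]] .
  have prod: "integrable M (\<lambda>\<omega>. Y i \<omega> * Y j \<omega>)"
      "expectation (\<lambda>\<omega>. Y i \<omega> * Y j \<omega>) = (if i = j then expectation (\<lambda>\<omega>. (Y i \<omega>)\<^sup>2) else 0)"
    if "i \<in> I" "j \<in> I" for i j
  proof -
    have "integrable M (\<lambda>\<omega>. Y i \<omega> * Y j \<omega>) \<and>
      expectation (\<lambda>\<omega>. Y i \<omega> * Y j \<omega>) = (if i = j then expectation (\<lambda>\<omega>. (Y i \<omega>)\<^sup>2) else 0)"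
    proof (cases "i = j")
      case True
      then show ?thesis using sq[OF that(1)] by (simp add: power2_eq_square)
    next
      case False
      have "indep_vars (\<lambda>_. borel) Y {i, j}"
        using that by (intro indep_vars_subset[OF indep]) auto
      from indep_vars_integrable[OF _ this] indep_vars_lebesgue_integral[OF _ this]
      show ?thesis using False mean int that by auto
    qed
    then show "integrable M (\<lambda>\<omega>. Y i \<omega> * Y j \<omega>)"
      "expectation (\<lambda>\<omega>. Y i \<omega> * Y j \<omega>) = (if i = j then expectation (\<lambda>\<omega>. (Y i \<omega>)\<^sup>2) else 0)"
      by auto
  qed
  have eq: "(\<lambda>\<omega>. (\<Sum>i\<in>I. Y i \<omega>)\<^sup>2) = (\<lambda>\<omega>. \<Sum>i\<in>I. \<Sum>j\<in>I. Y i \<omega> * Y j \<omega>)"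
    by (simp add: power2_eq_square sum_product)
  show ?int unfolding eq by (intro Bochner_Integration.integrable_sum prod)
  have "expectation (\<lambda>\<omega>. \<Sum>i\<in>I. \<Sum>j\<in>I. Y i \<omega> * Y j \<omega>) = (\<Sum>i\<in>I. \<Sum>j\<in>I. expectation (\<lambda>\<omega>. Y i \<omega> * Y j \<omega>))"
    using prod(1) by (simp add: Bochner_Integration.integral_sum Bochner_Integration.integrable_sum)
  also have "\<dots> = (\<Sum>i\<in>I. \<Sum>j\<in>I. if i = j then expectation (\<lambda>\<omega>. (Y i \<omega>)\<^sup>2) else 0)"
    using prod(2) by (intro sum.cong refl) auto
  also have "\<dots> = (\<Sum>i\<in>I. expectation (\<lambda>\<omega>. (Y i \<omega>)\<^sup>2))"
    using \<open>finite I\<close> by (simp add: sum.delta)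
  finally show ?eq unfolding eq .
qed

lemma (in prob_space) Chebyshev_second_moment:
  fixes Z :: "'a \<Rightarrow> real"
  assumes "integrable M (\<lambda>\<omega>. (Z \<omega>)\<^sup>2)" "expectation (\<lambda>\<omega>. (Z \<omega>)\<^sup>2) \<le> v" "c > 0" "random_variable borel Z"
  shows "prob {\<omega>\<in>space M. c < \<bar>Z \<omega>\<bar>} \<le> v / c\<^sup>2"
proof -
  have "prob {\<omega>\<in>space M. c < \<bar>Z \<omega>\<bar>} \<le> prob {\<omega>\<in>space M. (Z \<omega>)\<^sup>2 \<ge> c\<^sup>2}"
    using assms(3,4) by (intro finite_measure_mono) (auto intro!: abs_le_square_iff[THEN iffD1])
  also have "\<dots> \<le> expectation (\<lambda>\<omega>. (Z \<omega>)\<^sup>2) / c\<^sup>2"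
    using assms by (intro integral_Markov_inequality_measure[where A = "{}"]) auto
  also have "\<dots> \<le> v / c\<^sup>2" using assms by (intro divide_right_mono) auto
  finally show ?thesis .
qed

lemma (in prob_space) iid_second_moment:
  fixes Y :: "nat \<Rightarrow> 'a \<Rightarrow> 'b::topological_space" and f :: "'b \<Rightarrow> real"
  assumes indep: "indep_vars (\<lambda>_. borel) Y UNIV" and ident: "\<And>i. distr M borel (Y i) = P"
    and f: "f \<in> borel_measurable borel" "integrable P (\<lambda>x. (f x)\<^sup>2)" "integral\<^sup>L P f = 0"
  shows "integrable M (\<lambda>\<omega>. (\<Sum>i<n. f (Y i \<omega>))\<^sup>2)"
    and "expectation (\<lambda>\<omega>. (\<Sum>i<n. f (Y i \<omega>))\<^sup>2) = real n * (\<integral>x. (f x)\<^sup>2 \<partial>P)"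
proof -
  have Y: "random_variable borel (Y i)" for i
    using indep by (auto simp: indep_vars_def)
  have "indep_vars (\<lambda>_. borel) (\<lambda>i \<omega>. f (Y i \<omega>)) {..<n}"
    by (rule indep_vars_compose2[OF indep_vars_subset[OF indep subset_UNIV]]) (use f(1) in simp)
  moreover have "integrable M (\<lambda>\<omega>. (f (Y i \<omega>))\<^sup>2)" for i
    using integrable_distr_eq[OF Y[of i], of "\<lambda>x. (f x)\<^sup>2"] f ident[of i] by simp
  moreover have e: "expectation (\<lambda>\<omega>. g (Y i \<omega>)) = integral\<^sup>L P g" if "g \<in> borel_measurable borel" for i and g :: "'b \<Rightarrow> real"
    using integral_distr[OF Y[of i], of g] that ident[of i] by simp
  ultimately show "integrable M (\<lambda>\<omega>. (\<Sum>i<n. f (Y i \<omega>))\<^sup>2)"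
    and "expectation (\<lambda>\<omega>. (\<Sum>i<n. f (Y i \<omega>))\<^sup>2) = real n * (\<integral>x. (f x)\<^sup>2 \<partial>P)"
    using second_moment_sum_indep[of "{..<n}" "\<lambda>i \<omega>. f (Y i \<omega>)"] f(1,3) by (auto simp: e[of "\<lambda>x. (f x)\<^sup>2"] e[of f])
qed

section \<open>Resampled indices and moments of the bootstrap process\<close>

lemma boot_indices_lt: "n > 0 \<Longrightarrow> J \<in> set_pmf (boot_indices n) \<Longrightarrow> j < n \<Longrightarrow> J j < n"
  unfolding boot_indices_def
  by (subst (asm) set_Pi_pmf) (auto simp: PiE_dflt_def lessThan_empty_iff set_pmf_of_set)

lemma boot_count_sum:
  fixes h :: "nat \<Rightarrow> 'b::real_vector"
  assumes "\<And>j. j < n \<Longrightarrow> J j < n"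
  shows "(\<Sum>i<n. real (boot_count n J i) *\<^sub>R h i) = (\<Sum>j<n. h (J j))"
proof -
  have "(\<Sum>j<n. h (J j)) = (\<Sum>i<n. \<Sum>j\<in>{j\<in>{..<n}. J j = i}. h (J j))"
    by (rule sum.group[symmetric]) (use assms in auto)
  also have "\<dots> = (\<Sum>i<n. real (boot_count n J i) *\<^sub>R h i)"
    by (intro sum.cong refl) (simp add: boot_count_def scaleR_conv_of_real sum_constant_scaleR)
  finally show ?thesis by simp
qed

text \<open>Grouping the draws by their value turns the multinomial weights into a sum over the
  draws, each centred at the sample mean. Given the data this is a normalised sum of i.i.d. terms,
  the form in which moments and characteristic functions are computed.\<close>

lemma boot_process_eq:
  fixes h :: "real \<Rightarrow> 'b::real_vector"
  assumes "\<And>j. j < n \<Longrightarrow> J j < n"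
  shows "boot_process n x J h = (1 / sqrt (real n)) *\<^sub>R (\<Sum>j<n. h (x (J j)) - (\<Sum>i<n. h (x i)) /\<^sub>R real n)"
proof -
  have "(\<Sum>i<n. (real (boot_count n J i) - 1) *\<^sub>R h (x i)) = (\<Sum>j<n. h (x (J j))) - (\<Sum>i<n. h (x i))"
    by (simp add: scaleR_diff_left sum_subtractf boot_count_sum[of n J "\<lambda>i. h (x i)", OF assms])
  then show ?thesis
    unfolding boot_process_def by (cases "n = 0") (simp_all add: sum_subtractf sum_constant_scaleR)
qed

lemma boot_process_add: "boot_process n x J (\<lambda>y. f y + g y) = boot_process n x J f + boot_process n x J g"
  by (simp add: boot_process_def scaleR_add_right sum.distrib)

lemma boot_process_diff: "boot_process n x J (\<lambda>y. f y - g y) = boot_process n x J f - boot_process n x J g"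
  by (simp add: boot_process_def scaleR_diff_right sum_subtractf)

lemma boot_process_linear: "linear f \<Longrightarrow> boot_process n x J (\<lambda>y. f (g y)) = f (boot_process n x J g)"
  by (simp add: boot_process_def linear_cmul linear_sum)

lemma boot_process_const:
  assumes "\<And>j. j < n \<Longrightarrow> J j < n"
  shows "boot_process n x J (\<lambda>_. c) = 0"
proof (cases "n = 0")
  case False
  have "boot_process n x J (\<lambda>_. c) = (1 / sqrt (real n)) *\<^sub>R (\<Sum>j<n. c - (\<Sum>i<n. c) /\<^sub>R real n)"
    using assms by (rule boot_process_eq)
  then show ?thesis using False by (simp add: sum_constant_scaleR)
qed (simp add: boot_process_def)

lemma set_pmf_boot_indices_finite: "n > 0 \<Longrightarrow> finite (set_pmf (boot_indices n))"
  unfolding boot_indices_def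
  by (subst set_Pi_pmf) (auto intro!: finite_PiE_dflt simp: lessThan_empty_iff set_pmf_of_set)

lemma indep_vars_boot_indices:
  "prob_space.indep_vars (measure_pmf (boot_indices n)) (\<lambda>_. borel) (\<lambda>j J. f (J j) :: 'b::topological_space) {..<n}"
proof -
  show ?thesis
    using prob_space.indep_vars_compose2[OF measure_pmf.prob_space_axioms indep_vars_Pi_pmf[of "{..<n}" 0 "\<lambda>_. pmf_of_set {..<n}", folded boot_indices_def], of "\<lambda>_. f" "\<lambda>_. borel"]
    by simp
qed

lemma distr_boot_index:
  assumes "j < n"
  shows "distr (measure_pmf (boot_indices n)) borel (\<lambda>J. f (J j)) = distr (measure_pmf (pmf_of_set {..<n})) borel f"
proof -
  have "distr (measure_pmf (boot_indices n)) borel (\<lambda>J. f (J j)) =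
    distr (distr (measure_pmf (boot_indices n)) (count_space UNIV) (\<lambda>J. J j)) borel f"
    by (subst distr_distr) (auto simp: comp_def)
  also have "distr (measure_pmf (boot_indices n)) (count_space UNIV) (\<lambda>J. J j) = measure_pmf (map_pmf (\<lambda>J. J j) (boot_indices n))"
    by (simp add: map_pmf_rep_eq)
  also have "map_pmf (\<lambda>J. J j) (boot_indices n) = pmf_of_set {..<n}"
    unfolding boot_indices_def using assms by (subst Pi_pmf_component) auto
  finally show ?thesis .
qed

lemma expectation_boot_index:
  fixes f :: "nat \<Rightarrow> real"
  assumes "j < n"
  shows "measure_pmf.expectation (boot_indices n) (\<lambda>J. f (J j)) = (\<Sum>i<n. f i) / real n"
proof -
  have "measure_pmf.expectation (boot_indices n) (\<lambda>J. f (J j)) =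
    measure_pmf.expectation (map_pmf (\<lambda>J. J j) (boot_indices n)) f"
    by simp
  also have "map_pmf (\<lambda>J. J j) (boot_indices n) = pmf_of_set {..<n}"
    unfolding boot_indices_def using assms by (subst Pi_pmf_component) auto
  also have "measure_pmf.expectation (pmf_of_set {..<n}) f = (\<Sum>i<n. f i) / real n"
    using assms by (subst integral_pmf_of_set) auto
  finally show ?thesis .
qed

text \<open>Chebyshev's inequality given the data: the conditional variance is the sample variance,
  which is at most the sample second moment.\<close>

lemma boot_process_tail:
  fixes h :: "real \<Rightarrow> real"
  assumes "n > 0" "c > 0"
  shows "measure_pmf.prob (boot_indices n) {J. c < \<bar>boot_process n x J h\<bar>} \<le> ((\<Sum>i<n. (h (x i))\<^sup>2) / real n) / c\<^sup>2"
proof -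
  define m where "m = (\<Sum>i<n. h (x i)) / real n"
  define Y where "Y = (\<lambda>j (J :: nat \<Rightarrow> nat). h (x (J j)) - m)"
  define Z where "Z = (\<lambda>J. (1 / sqrt (real n)) * (\<Sum>j<n. Y j J))"
  note fin = set_pmf_boot_indices_finite[OF assms(1)]
  have int: "integrable (measure_pmf (boot_indices n)) (g :: _ \<Rightarrow> real)" for g
    by (rule integrable_measure_pmf_finite[OF fin])
  have ind: "prob_space.indep_vars (measure_pmf (boot_indices n)) (\<lambda>_. borel) Y {..<n}"
    unfolding Y_def using indep_vars_boot_indices[of n "\<lambda>i. h (x i) - m"] .
  have mean: "measure_pmf.expectation (boot_indices n) (Y j) = 0" if "j < n" for j
    unfolding Y_def using expectation_boot_index[OF that, of "\<lambda>i. h (x i) - m"] assms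
    by (simp add: sum_subtractf m_def)
  have sq: "measure_pmf.expectation (boot_indices n) (\<lambda>J. (Y j J)\<^sup>2) \<le> (\<Sum>i<n. (h (x i))\<^sup>2) / real n" if "j < n" for j
  proof -
    have "measure_pmf.expectation (boot_indices n) (\<lambda>J. (Y j J)\<^sup>2) = (\<Sum>i<n. (h (x i) - m)\<^sup>2) / real n"
      unfolding Y_def using expectation_boot_index[OF that, of "\<lambda>i. (h (x i) - m)\<^sup>2"] .
    also have "(\<Sum>i<n. (h (x i) - m)\<^sup>2) = (\<Sum>i<n. (h (x i))\<^sup>2) - real n * m\<^sup>2"
    proof -
      have "(\<Sum>i<n. (h (x i) - m)\<^sup>2) = (\<Sum>i<n. (h (x i))\<^sup>2) + real n * m\<^sup>2 - 2 * m * (\<Sum>i<n. h (x i))"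
        by (simp add: power2_diff sum.distrib sum_subtractf sum_distrib_left algebra_simps)
      also have "(\<Sum>i<n. h (x i)) = real n * m" using assms by (simp add: m_def)
      finally show ?thesis by (simp add: power2_eq_square algebra_simps)
    qed
    also have "((\<Sum>i<n. (h (x i))\<^sup>2) - real n * m\<^sup>2) / real n \<le> (\<Sum>i<n. (h (x i))\<^sup>2) / real n"
      by (intro divide_right_mono) auto
    finally show ?thesis .
  qed
  have "measure_pmf.expectation (boot_indices n) (\<lambda>J. (\<Sum>j<n. Y j J)\<^sup>2) = (\<Sum>j<n. measure_pmf.expectation (boot_indices n) (\<lambda>J. (Y j J)\<^sup>2))"
    by (rule measure_pmf.second_moment_sum_indep) (use ind int mean in auto)
  also have "\<dots> \<le> (\<Sum>j<n. (\<Sum>i<n. (h (x i))\<^sup>2) / real n)" by (intro sum_mono sq) auto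
  finally have "measure_pmf.expectation (boot_indices n) (\<lambda>J. (\<Sum>j<n. Y j J)\<^sup>2) \<le> (\<Sum>i<n. (h (x i))\<^sup>2)"
    using assms by simp
  then have "measure_pmf.expectation (boot_indices n) (\<lambda>J. (Z J)\<^sup>2) \<le> (\<Sum>i<n. (h (x i))\<^sup>2) / real n"
    unfolding Z_def by (simp add: power_mult_distrib power_divide divide_right_mono)
  then have "measure_pmf.prob (boot_indices n) {J \<in> space (measure_pmf (boot_indices n)). c < \<bar>Z J\<bar>} \<le> ((\<Sum>i<n. (h (x i))\<^sup>2) / real n) / c\<^sup>2"
    by (intro measure_pmf.Chebyshev_second_moment) (use int assms in auto)
  \<comment> \<open>\<open>Z\<close> is identified with the bootstrap process on the support only,
    where all indices are below \<open>n\<close>; the events are therefore compared almost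
    surely.\<close>
  moreover have "measure_pmf.prob (boot_indices n) {J. c < \<bar>boot_process n x J h\<bar>} = measure_pmf.prob (boot_indices n) {J. c < \<bar>Z J\<bar>}"
  proof (rule measure_pmf.finite_measure_eq_AE)
    have "boot_process n x J h = Z J" if "J \<in> set_pmf (boot_indices n)" for J
      unfolding Z_def Y_def m_def
      by (subst boot_process_eq) (use boot_indices_lt[OF assms(1) that] in \<open>auto simp: field_simps\<close>)
    then show "AE J in measure_pmf (boot_indices n). (J \<in> {J. c < \<bar>boot_process n x J h\<bar>}) = (J \<in> {J. c < \<bar>Z J\<bar>})"
      by (auto simp: AE_measure_pmf_iff)
  qed auto
  ultimately show ?thesis by simp
qed

section \<open>Empirical process of an i.i.d. sample\<close>

locale iid_sample = prob_space M for M :: "'a measure" +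
  fixes X :: "nat \<Rightarrow> 'a \<Rightarrow> real" and P :: "real measure"
  assumes indep: "indep_vars (\<lambda>_. borel) X UNIV" and ident: "\<And>i. distr M borel (X i) = P"
begin

lemma X_measurable [measurable]: "X i \<in> borel_measurable M"
  using indep by (auto simp: indep_vars_def)

lemma P_prob_space: "prob_space P"
  using prob_space_distr[OF X_measurable[of 0]] ident by simp

lemma sets_P [measurable_cong, simp]: "sets P = sets borel"
  using ident[of 0] by auto

lemma space_P [simp]: "space P = UNIV"
  using ident[of 0] by auto

lemma integral_P: "g \<in> borel_measurable borel \<Longrightarrow> expectation (\<lambda>\<omega>. g (X i \<omega>)) = integral\<^sup>L P g"
  for g :: "real \<Rightarrow> real"
  using integral_distr[OF X_measurable[of i], of g] ident[of i] by simp

lemma integrable_P: "g \<in> borel_measurable borel \<Longrightarrow> integrable M (\<lambda>\<omega>. g (X i \<omega>)) \<longleftrightarrow> integrable P g"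
  for g :: "real \<Rightarrow> real"
  using integrable_distr_eq[OF X_measurable[of i], of g] ident[of i] by simp

text \<open>In contrast to \<open>empirical_process\<close> there is no index class, so this can be
  evaluated at random parameters and at differences of charts.\<close>

definition emp :: "nat \<Rightarrow> 'a \<Rightarrow> (real \<Rightarrow> real) \<Rightarrow> real" where
  "emp n \<omega> f = sqrt (real n) * ((\<Sum>i<n. f (X i \<omega>)) / real n - integral\<^sup>L P f)"

lemma emp_eq: "emp n \<omega> f = (1 / sqrt (real n)) * (\<Sum>i<n. f (X i \<omega>) - integral\<^sup>L P f)"
proof (cases "n = 0")
  case False
  have "(\<Sum>i<n. f (X i \<omega>)) / real n - integral\<^sup>L P f = (\<Sum>i<n. f (X i \<omega>) - integral\<^sup>L P f) / real n"
    using False by (simp add: sum_subtractf diff_divide_distrib)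
  then have "emp n \<omega> f = sqrt (real n) / real n * (\<Sum>i<n. f (X i \<omega>) - integral\<^sup>L P f)"
    by (simp add: emp_def)
  also have "sqrt (real n) / real n = 1 / sqrt (real n)"
    using sqrt_divide_self_eq[of "real n"] by (simp add: inverse_eq_divide)
  finally show ?thesis .
qed (simp add: emp_def)

lemma emp_second_moment:
  assumes f: "f \<in> borel_measurable borel" "integrable P (\<lambda>x. (f x)\<^sup>2)"
  shows "integrable M (\<lambda>\<omega>. (emp n \<omega> f)\<^sup>2)"
    and "expectation (\<lambda>\<omega>. (emp n \<omega> f)\<^sup>2) \<le> (\<integral>x. (f x)\<^sup>2 \<partial>P)"
proof -
  interpret P: prob_space P by (rule P_prob_space)
  have fP: "f \<in> borel_measurable P" using f(1) by simp
  have intf: "integrable P f" using P.square_integrable_imp_integrable[OF fP f(2)] .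
  define g where "g x = f x - integral\<^sup>L P f" for x
  have g: "g \<in> borel_measurable borel" "integrable P (\<lambda>x. (g x)\<^sup>2)" "integral\<^sup>L P g = 0"
    using f intf by (auto simp: g_def[abs_def] power2_diff P.prob_space[simplified])
  have e: "(\<lambda>\<omega>. (emp n \<omega> f)\<^sup>2) = (\<lambda>\<omega>. (1 / real n) * (\<Sum>i<n. g (X i \<omega>))\<^sup>2)"
    by (simp add: emp_eq g_def power_mult_distrib power_divide)
  show "integrable M (\<lambda>\<omega>. (emp n \<omega> f)\<^sup>2)"
    unfolding e using iid_second_moment(1)[OF indep ident g] by simp
  have "expectation (\<lambda>\<omega>. (emp n \<omega> f)\<^sup>2) \<le> (\<integral>x. (g x)\<^sup>2 \<partial>P)"
    unfolding e using iid_second_moment(2)[OF indep ident g, of n] by simp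
  also have "\<dots> \<le> (\<integral>x. (f x)\<^sup>2 \<partial>P)"
    unfolding g_def using P.variance_eq[OF intf f(2)] by simp
  finally show "expectation (\<lambda>\<omega>. (emp n \<omega> f)\<^sup>2) \<le> (\<integral>x. (f x)\<^sup>2 \<partial>P)" .
qed

lemma boot_bounded_emp:
  assumes f: "f \<in> borel_measurable borel" "integrable P (\<lambda>x. (f x)\<^sup>2)"
  shows "boot_bounded M (\<lambda>(n, \<omega>, J). emp n \<omega> f)"
proof (rule boot_boundedI)
  fix \<epsilon> :: real assume "\<epsilon> > 0"
  \<comment> \<open>The summand 1 keeps \<open>v\<close>, and with it the threshold
    \<open>c\<close>, positive even if \<open>f\<close> vanishes almost everywhere.\<close>
  define v where "v = (\<integral>x. (f x)\<^sup>2 \<partial>P) + 1"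
  have "v > 0" unfolding v_def by (intro add_nonneg_pos integral_nonneg) auto
  define c where "c = sqrt (v / \<epsilon>)"
  have c: "c > 0" "c\<^sup>2 = v / \<epsilon>" using \<open>v > 0\<close> \<open>\<epsilon> > 0\<close> by (auto simp: c_def)
  have "boot_rare M n \<epsilon> (\<lambda>\<omega> J. c < norm (emp n \<omega> f))" for n
    unfolding boot_rare_def
  proof (intro bexI[of _ "{\<omega>\<in>space M. c < \<bar>emp n \<omega> f\<bar>}"] conjI ballI)
    note f(1)[measurable]
    have meas[measurable]: "(\<lambda>\<omega>. emp n \<omega> f) \<in> borel_measurable M"
      unfolding emp_def by measurable
    show "{\<omega>\<in>space M. c < \<bar>emp n \<omega> f\<bar>} \<in> events" by measurable
    have "prob {\<omega>\<in>space M. c < \<bar>emp n \<omega> f\<bar>} \<le> v / c\<^sup>2"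
      using emp_second_moment[OF f, of n] c by (intro Chebyshev_second_moment meas) (auto simp: v_def)
    then show "prob {\<omega>\<in>space M. c < \<bar>emp n \<omega> f\<bar>} \<le> \<epsilon>"
      using c \<open>\<epsilon> > 0\<close> \<open>v > 0\<close> by simp
  next
    fix \<omega> assume "\<omega> \<in> space M - {\<omega>\<in>space M. c < \<bar>emp n \<omega> f\<bar>}"
    then show "measure_pmf.prob (boot_indices n) {J. c < norm (emp n \<omega> f)} \<le> \<epsilon>"
      using \<open>\<epsilon> > 0\<close> by auto
  qed
  then show "\<exists>B. \<forall>\<^sub>F n in sequentially. boot_rare M n \<epsilon> (\<lambda>\<omega> J. B < norm (case (n, \<omega>, J) of (n, \<omega>, J) \<Rightarrow> emp n \<omega> f))"
    by (intro exI[of _ c] always_eventually allI) simp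
qed

lemma Markov_mean:
  fixes f :: "real \<Rightarrow> real"
  assumes f: "f \<in> borel_measurable borel" "integrable P f" "\<And>x. f x \<ge> 0" and "c > 0" "integral\<^sup>L P f \<le> v"
  shows "{\<omega>\<in>space M. c \<le> (\<Sum>i<n. f (X i \<omega>)) / real n} \<in> events"
    and "prob {\<omega>\<in>space M. c \<le> (\<Sum>i<n. f (X i \<omega>)) / real n} \<le> v / c"
proof -
  note f(1)[measurable]
  show "{\<omega>\<in>space M. c \<le> (\<Sum>i<n. f (X i \<omega>)) / real n} \<in> events" by measurable
  have int: "integrable M (\<lambda>\<omega>. f (X i \<omega>))" for i using integrable_P[OF f(1)] f(2) by simp
  have "0 \<le> integral\<^sup>L P f" using f(3) by simp
  have "prob {\<omega>\<in>space M. c \<le> (\<Sum>i<n. f (X i \<omega>)) / real n} \<le> expectation (\<lambda>\<omega>. (\<Sum>i<n. f (X i \<omega>)) / real n) / c"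
    using int f(3) \<open>c > 0\<close> by (intro integral_Markov_inequality_measure[where A = "{}"]) (auto intro!: sum_nonneg divide_nonneg_nonneg)
  also have "expectation (\<lambda>\<omega>. (\<Sum>i<n. f (X i \<omega>)) / real n) = real n * integral\<^sup>L P f / real n"
    using int by (simp add: integral_P[OF f(1)])
  also have "\<dots> / c \<le> v / c"
    using \<open>c > 0\<close> assms(5) \<open>0 \<le> integral\<^sup>L P f\<close> by (intro divide_right_mono) auto
  finally show "prob {\<omega>\<in>space M. c \<le> (\<Sum>i<n. f (X i \<omega>)) / real n} \<le> v / c" .
qed

text \<open>Two tail bounds are chained: Markov's inequality keeps the sample second moment below
  \<open>v / \<epsilon>\<close> up to data probability \<open>\<epsilon>\<close>, and there the
  conditional Chebyshev bound applies.\<close>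

lemma boot_bounded_boot_process:
  fixes h :: "real \<Rightarrow> real"
  assumes h: "h \<in> borel_measurable borel" "integrable P (\<lambda>x. (h x)\<^sup>2)"
  shows "boot_bounded M (\<lambda>(n, \<omega>, J). boot_process n (\<lambda>i. X i \<omega>) J h)"
proof (rule boot_boundedI)
  fix \<epsilon> :: real assume "\<epsilon> > 0"
  define v where "v = (\<integral>x. (h x)\<^sup>2 \<partial>P) + 1"
  have "v > 0" unfolding v_def by (intro add_nonneg_pos integral_nonneg) auto
  \<comment> \<open>Chosen so that \<open>(v / \<epsilon>) / c\<^sup>2 = \<epsilon>\<close>.\<close>
  define c where "c = sqrt v / \<epsilon>"
  have c: "c > 0" "c\<^sup>2 = v / \<epsilon>\<^sup>2" using \<open>v > 0\<close> \<open>\<epsilon> > 0\<close> by (auto simp: c_def power_divide)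
  have "boot_rare M n \<epsilon> (\<lambda>\<omega> J. c < norm (boot_process n (\<lambda>i. X i \<omega>) J h))" if "n > 0" for n
    unfolding boot_rare_def
  proof (intro bexI[of _ "{\<omega>\<in>space M. v / \<epsilon> \<le> (\<Sum>i<n. (h (X i \<omega>))\<^sup>2) / real n}"] conjI ballI)
    have "v / \<epsilon> > 0" using \<open>v > 0\<close> \<open>\<epsilon> > 0\<close> by simp
    have "(\<lambda>x. (h x)\<^sup>2) \<in> borel_measurable borel" using h by simp
    moreover have "(\<integral>x. (h x)\<^sup>2 \<partial>P) \<le> v" by (simp add: v_def)
    ultimately have M: "{\<omega>\<in>space M. v / \<epsilon> \<le> (\<Sum>i<n. (h (X i \<omega>))\<^sup>2) / real n} \<in> events"
      "prob {\<omega>\<in>space M. v / \<epsilon> \<le> (\<Sum>i<n. (h (X i \<omega>))\<^sup>2) / real n} \<le> v / (v / \<epsilon>)"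
      using Markov_mean[of "\<lambda>x. (h x)\<^sup>2" "v / \<epsilon>" v n] h(2) \<open>v / \<epsilon> > 0\<close> zero_le_power2 by blast+
    show "{\<omega>\<in>space M. v / \<epsilon> \<le> (\<Sum>i<n. (h (X i \<omega>))\<^sup>2) / real n} \<in> events"
      by (fact M(1))
    from M(2) show "prob {\<omega>\<in>space M. v / \<epsilon> \<le> (\<Sum>i<n. (h (X i \<omega>))\<^sup>2) / real n} \<le> \<epsilon>"
      using \<open>v > 0\<close> by simp
  next
    fix \<omega> assume "\<omega> \<in> space M - {\<omega>\<in>space M. v / \<epsilon> \<le> (\<Sum>i<n. (h (X i \<omega>))\<^sup>2) / real n}"
    then have "(\<Sum>i<n. (h (X i \<omega>))\<^sup>2) / real n \<le> v / \<epsilon>" by auto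
    then have "(\<Sum>i<n. (h (X i \<omega>))\<^sup>2) / real n / c\<^sup>2 \<le> v / \<epsilon> / c\<^sup>2" by (intro divide_right_mono) auto
    also have "\<dots> = \<epsilon>" using \<open>v > 0\<close> \<open>\<epsilon> > 0\<close> unfolding c(2) by (simp add: power2_eq_square)
    finally show "measure_pmf.prob (boot_indices n) {J. c < norm (boot_process n (\<lambda>i. X i \<omega>) J h)} \<le> \<epsilon>"
      using boot_process_tail[OF that c(1), of "\<lambda>i. X i \<omega>" h] by simp
  qed
  then have "\<forall>\<^sub>F n in sequentially. boot_rare M n \<epsilon> (\<lambda>\<omega> J. c < norm (boot_process n (\<lambda>i. X i \<omega>) J h))"
    using eventually_gt_at_top[of 0] by (rule eventually_mono[rotated])
  then show "\<exists>B. \<forall>\<^sub>F n in sequentially. boot_rare M n \<epsilon>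
      (\<lambda>\<omega> J. B < norm (case (n, \<omega>, J) of (n, \<omega>, J) \<Rightarrow> boot_process n (\<lambda>i. X i \<omega>) J h))"
    by (intro exI[of _ c]) simp
qed

end

section \<open>Asymptotic equicontinuity of Donsker classes\<close>

lemma abs_le_mdist_ell_infty:
  assumes "z \<in> mspace (ell_infty F)" "w \<in> mspace (ell_infty F)" "f \<in> F"
  shows "\<bar>z f - w f\<bar> \<le> mdist (ell_infty F) z w"
  using funspace_mdist_le[OF assms(1,2), of "mdist (ell_infty F) z w"] assms(3) by (auto simp: dist_real_def)

lemma mspace_ell_infty_iff: "z \<in> mspace (ell_infty F) \<longleftrightarrow> z \<in> extensional F \<and> bounded (z ` F)"
proof -
  have "Met_TC.mbounded (z ` F) \<longleftrightarrow> bounded (z ` F)"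
    unfolding Met_TC.mbounded_def bounded_def by (auto simp: subset_eq dist_commute)
  then show ?thesis by (simp add: Met_TC.fspace_def)
qed

lemma borel_measurable_continuous_map_sigma:
  assumes "continuous_map T euclideanreal h" "space L = topspace T"
    and "sets L = sigma_sets (topspace T) {U. openin T U}"
  shows "h \<in> borel_measurable L"
proof (rule borel_measurableI)
  fix S :: "real set" assume "open S"
  then have "openin T {x \<in> topspace T. h x \<in> S}"
    using assms(1) openin_continuous_map_preimage by fastforce
  moreover have "h -` S \<inter> space L = {x \<in> topspace T. h x \<in> S}" using assms(2) by auto
  ultimately show "h -` S \<inter> space L \<in> sets L" using assms(3) by auto
qed

text \<open>Coordinates and suprema of increments are Lipschitz for the supremum distance; this is
  how the test functions for weak convergence are seen to be continuous.\<close>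

lemma continuous_map_ell_infty_Lipschitz:
  assumes "\<And>z w. z \<in> mspace (ell_infty F) \<Longrightarrow> w \<in> mspace (ell_infty F) \<Longrightarrow> \<bar>h z - h w\<bar> \<le> C * mdist (ell_infty F) z w"
  shows "continuous_map (mtopology_of (ell_infty F)) euclideanreal h"
proof -
  have "Lipschitz_continuous_map (ell_infty F) euclidean_metric h"
    unfolding Lipschitz_continuous_map_def using assms by (auto simp: dist_real_def)
  then show ?thesis using Lipschitz_continuous_imp_continuous_map by fastforce
qed

text \<open>A nonnegative \<open>h\<close> bounds the integrals of its majorants below by 0, and
  only a set bounded below has a meaningful real infimum.\<close>

lemma outer_expectation_le:
  assumes "\<And>\<omega>. \<omega> \<in> space Q \<Longrightarrow> 0 \<le> h \<omega>" "integrable Q U" "\<And>\<omega>. \<omega> \<in> space Q \<Longrightarrow> h \<omega> \<le> U \<omega>"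
  shows "outer_expectation Q h \<le> integral\<^sup>L Q U"
  unfolding outer_expectation_def
proof (rule cINF_lower)
  show "bdd_below (integral\<^sup>L Q ` {U. integrable Q U \<and> (\<forall>\<omega>\<in>space Q. h \<omega> \<le> U \<omega>)})"
    using assms(1) by (intro bdd_belowI2[of _ 0] integral_nonneg_AE AE_I2) (auto intro: order_trans)
qed (use assms in auto)

text \<open>The constant 1 is an integrable majorant, so the infimum is taken over a nonempty set
  and some \<open>U\<close> comes close to it.\<close>

lemma outer_expectation_lessD:
  assumes "outer_expectation Q h < c" "finite_measure Q" "\<And>\<omega>. \<omega> \<in> space Q \<Longrightarrow> h \<omega> \<le> 1"
  shows "\<exists>U. integrable Q U \<and> (\<forall>\<omega>\<in>space Q. h \<omega> \<le> U \<omega>) \<and> integral\<^sup>L Q U < c"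
proof -
  interpret finite_measure Q by fact
  have "(\<lambda>_. 1) \<in> {U. integrable Q U \<and> (\<forall>\<omega>\<in>space Q. h \<omega> \<le> U \<omega>)}" using assms(3) by auto
  then have "\<exists>y \<in> integral\<^sup>L Q ` {U. integrable Q U \<and> (\<forall>\<omega>\<in>space Q. h \<omega> \<le> U \<omega>)}. y < c"
    using assms(1) unfolding outer_expectation_def by (intro cInf_lessD) auto
  then show ?thesis by auto
qed

text \<open>Balls centred in a compact set of mass at least \<open>1 - \<eta>\<close> cover it, and
  finitely many of them suffice.\<close>

lemma tight_borel_prob_finite_cover:
  assumes L: "tight_borel_prob m L" and "\<eta> > 0" "r > 0"
  shows "\<exists>C. finite C \<and> C \<subseteq> mspace m \<and> (\<forall>c\<in>C. mball_of m c r \<in> sets L) \<and>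
    measure L (mspace m - (\<Union>c\<in>C. mball_of m c r)) \<le> \<eta>"
proof -
  interpret m: Metric_space "mspace m" "mdist m" by (rule Metric_space_mspace_mdist)
  interpret L: prob_space L using L by (simp add: tight_borel_prob_def)
  have sp: "space L = mspace m" using L by (simp add: tight_borel_prob_def)
  have op: "openin (mtopology_of m) U \<Longrightarrow> U \<in> sets L" for U
    using L by (auto simp: tight_borel_prob_def)
  have ball: "openin (mtopology_of m) (mball_of m c r)" for c
    by (simp add: mtopology_of_def mball_of_def)
  obtain K where K: "compactin (mtopology_of m) K" "measure L K \<ge> 1 - \<eta>"
    using L \<open>\<eta> > 0\<close> unfolding tight_borel_prob_def by blast
  have KM: "K \<subseteq> mspace m" using compactin_subset_topspace[OF K(1)] by simp
  have "K \<subseteq> \<Union> ((\<lambda>c. mball_of m c r) ` K)"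
  proof
    fix z assume "z \<in> K"
    then have "z \<in> mball_of m z r" using KM \<open>r > 0\<close> unfolding mball_of_def m.in_mball by auto
    then show "z \<in> \<Union> ((\<lambda>c. mball_of m c r) ` K)" using \<open>z \<in> K\<close> by blast
  qed
  then obtain \<F> where F: "finite \<F>" "\<F> \<subseteq> (\<lambda>c. mball_of m c r) ` K" "K \<subseteq> \<Union>\<F>"
    using compactinD[OF K(1), of "(\<lambda>c. mball_of m c r) ` K"] ball by blast
  then obtain C where C: "finite C" "C \<subseteq> K" "\<F> = (\<lambda>c. mball_of m c r) ` C"
    using finite_subset_image by metis
  have "measure L (mspace m - (\<Union>c\<in>C. mball_of m c r)) \<le> \<eta>"
  proof -
    have U: "(\<Union>c\<in>C. mball_of m c r) \<in> sets L" using C(1) op ball by auto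
    have "measure L K \<le> measure L (\<Union>c\<in>C. mball_of m c r)"
      using F(3) C(3) U by (intro L.finite_measure_mono) auto
    then show ?thesis using L.prob_compl[OF U] K(2) sp by simp
  qed
  then show ?thesis using C KM op ball by (intro exI[of _ C]) auto
qed

context iid_sample
begin

text \<open>\<open>donsker\<close> lives on the coordinate space while the observations live on
  \<open>M\<close>. This identity transports events and integrals between the two.\<close>

lemma distr_sequence: "distr M (PiM UNIV (\<lambda>_::nat. P)) (\<lambda>\<omega> i. X i \<omega>) = PiM UNIV (\<lambda>_. P)"
proof -
  have "distr M (PiM UNIV (\<lambda>_. borel)) (\<lambda>\<omega>. \<lambda>i\<in>UNIV. X i \<omega>) = PiM UNIV (\<lambda>i. distr M borel (X i))"
    using indep by (subst (asm) indep_vars_iff_distr_eq_PiM) auto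
  moreover have "sets (PiM UNIV (\<lambda>_::nat. P)) = sets (PiM UNIV (\<lambda>_. borel))"
    by (intro sets_PiM_cong) auto
  ultimately show ?thesis
    by (simp add: ident restrict_UNIV cong: distr_cong)
qed

lemma sequence_measurable [measurable]: "(\<lambda>\<omega> i. X i \<omega>) \<in> measurable M (PiM UNIV (\<lambda>_::nat. P))"
  by (rule measurable_PiM_single') (auto simp: measurable_cong_sets[OF refl sets_P])

lemma integral_sequence:
  assumes "U \<in> borel_measurable (PiM UNIV (\<lambda>_::nat. P))"
  shows "integrable (PiM UNIV (\<lambda>_::nat. P)) U \<longleftrightarrow> integrable M (\<lambda>\<omega>. U (\<lambda>i. X i \<omega>))"
    and "integral\<^sup>L (PiM UNIV (\<lambda>_::nat. P)) U = expectation (\<lambda>\<omega>. U (\<lambda>i. X i \<omega>) :: real)"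
  using assms by (subst distr_sequence[symmetric], subst integrable_distr_eq, auto)
    (subst distr_sequence[symmetric], subst integral_distr, auto)

lemma prob_sequence:
  assumes "B \<in> sets (PiM UNIV (\<lambda>_::nat. P))"
  shows "measure (PiM UNIV (\<lambda>_::nat. P)) B = prob ((\<lambda>\<omega> i. X i \<omega>) -` B \<inter> space M)"
  using assms by (subst distr_sequence[symmetric], subst measure_distr) auto

lemma emp_diff:
  assumes "integrable P f" "integrable P g"
  shows "emp n \<omega> (\<lambda>x. f x - g x) = emp n \<omega> f - emp n \<omega> g"
  using assms by (simp add: emp_def sum_subtractf diff_divide_distrib algebra_simps)

lemma empirical_process_eq_emp:
  "f \<in> F \<Longrightarrow> empirical_process P F n (\<lambda>i. X i \<omega>) f = emp n \<omega> f"
  by (simp add: empirical_process_def emp_def)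

text \<open>For every \<open>n\<close> the increment of the empirical process has second moment at
  most the squared \<open>L\<^sup>2\<close> distance of \<open>f\<close> and \<open>g\<close>. Weak
  convergence carries the bound to the limit law, where it acts as Chebyshev's inequality.\<close>

lemma donsker_limit_marginal:
  assumes F: "donsker P F" "\<And>f. f \<in> F \<Longrightarrow> f \<in> borel_measurable borel" "\<And>f. f \<in> F \<Longrightarrow> integrable P (\<lambda>x. (f x)\<^sup>2)"
    and L: "tight_borel_prob (ell_infty F) L"
      "weakly_converges_outer (PiM UNIV (\<lambda>_::nat. P)) (empirical_process P F) (ell_infty F) L"
    and fg: "f \<in> F" "g \<in> F" and "a > 0"
  shows "{z \<in> mspace (ell_infty F). a \<le> \<bar>z f - z g\<bar>} \<in> sets L"
    and "measure L {z \<in> mspace (ell_infty F). a \<le> \<bar>z f - z g\<bar>} \<le> (\<integral>x. (f x - g x)\<^sup>2 \<partial>P) / a\<^sup>2"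
proof -
  interpret L: prob_space L using L(1) by (simp add: tight_borel_prob_def)
  interpret P: prob_space P by (rule P_prob_space)
  let ?Q = "PiM UNIV (\<lambda>_::nat. P)"
  have sp: "space L = mspace (ell_infty F)" using L(1) by (simp add: tight_borel_prob_def)
  define \<phi> where "\<phi> z = z f - z g" for z :: "(real \<Rightarrow> real) \<Rightarrow> real"
  \<comment> \<open>Truncating the scaled square at 1 gives a bounded continuous test function that
    still dominates the indicator of \<open>a \<le> \<bar>\<phi> z\<bar>\<close>.\<close>
  define h where "h z = min 1 ((\<phi> z / a)\<^sup>2)" for z
  have c\<phi>: "continuous_map (mtopology_of (ell_infty F)) euclideanreal \<phi>"
  proof (rule continuous_map_ell_infty_Lipschitz[where C = 2])
    fix z w assume "z \<in> mspace (ell_infty F)" "w \<in> mspace (ell_infty F)"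
    from abs_le_mdist_ell_infty[OF this fg(1)] abs_le_mdist_ell_infty[OF this fg(2)]
    show "\<bar>\<phi> z - \<phi> w\<bar> \<le> 2 * mdist (ell_infty F) z w" unfolding \<phi>_def by linarith
  qed
  have ch: "continuous_map (mtopology_of (ell_infty F)) euclideanreal h"
  proof -
    have "continuous_map euclideanreal euclideanreal (\<lambda>t. min 1 ((t / a)\<^sup>2))"
      using \<open>a > 0\<close> by (auto intro!: continuous_intros)
    from continuous_map_compose[OF c\<phi> this] show ?thesis by (simp add: comp_def h_def[abs_def])
  qed
  have sets: "sets L = sigma_sets (topspace (mtopology_of (ell_infty F))) {U. openin (mtopology_of (ell_infty F)) U}"
    using L(1) by (simp add: tight_borel_prob_def)
  have m\<phi>: "\<phi> \<in> borel_measurable L" and mh: "h \<in> borel_measurable L"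
    using borel_measurable_continuous_map_sigma[OF c\<phi> _ sets] borel_measurable_continuous_map_sigma[OF ch _ sets] sp by auto
  show S: "{z \<in> mspace (ell_infty F). a \<le> \<bar>z f - z g\<bar>} \<in> sets L"
    using m\<phi> unfolding \<phi>_def sp[symmetric] by measurable
  have hb: "0 \<le> h z" "h z \<le> 1" for z by (auto simp: h_def)
  have "(\<lambda>n. outer_expectation ?Q (\<lambda>\<omega>. h (empirical_process P F n \<omega>))) \<longlonglongrightarrow> integral\<^sup>L L h"
  proof -
    have "bounded (h ` mspace (ell_infty F))"
      unfolding bounded_iff using hb by (intro exI[of _ 1]) (simp add: abs_of_nonneg)
    then show ?thesis using L(2) ch unfolding weakly_converges_outer_def by blast
  qed
  moreover have "outer_expectation ?Q (\<lambda>\<omega>. h (empirical_process P F n \<omega>)) \<le> (\<integral>x. (f x - g x)\<^sup>2 \<partial>P) / a\<^sup>2" for n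
  proof -
    note F(2)[OF fg(1), measurable] F(2)[OF fg(2), measurable]
    define U where "U = (\<lambda>x. (\<phi> (empirical_process P F n x) / a)\<^sup>2)"
    have Um: "U \<in> borel_measurable ?Q"
      unfolding U_def \<phi>_def empirical_process_def using fg by simp measurable
    have fi: "integrable P f" "integrable P g"
      using F(2,3)[OF fg(1)] F(2,3)[OF fg(2)] by (auto intro!: P.square_integrable_imp_integrable)
    have Ue: "U (\<lambda>i. X i \<omega>) = (emp n \<omega> (\<lambda>x. f x - g x))\<^sup>2 / a\<^sup>2" for \<omega>
      by (simp add: U_def \<phi>_def empirical_process_eq_emp fg emp_diff[OF fi] power_divide)
    have d: "(\<lambda>x. f x - g x) \<in> borel_measurable borel" by measurable
    have sq: "integrable P (\<lambda>x. (f x - g x)\<^sup>2)"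
    proof (rule Bochner_Integration.integrable_bound[where f = "\<lambda>x. 2 * (f x)\<^sup>2 + 2 * (g x)\<^sup>2"])
      show "integrable P (\<lambda>x. 2 * (f x)\<^sup>2 + 2 * (g x)\<^sup>2)" using F(3) fg by auto
      have "(f x - g x)\<^sup>2 \<le> 2 * (f x)\<^sup>2 + 2 * (g x)\<^sup>2" for x
        using sum_squares_bound[of "f x" "- g x"] by (simp add: power2_diff)
      then show "AE x in P. norm ((f x - g x)\<^sup>2) \<le> norm (2 * (f x)\<^sup>2 + 2 * (g x)\<^sup>2)" by simp
    qed measurable
    have "outer_expectation ?Q (\<lambda>\<omega>. h (empirical_process P F n \<omega>)) \<le> integral\<^sup>L ?Q U"
    proof (rule outer_expectation_le)
      show "integrable ?Q U"
        unfolding integral_sequence(1)[OF Um] Ue using emp_second_moment(1)[OF d sq] by simp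
    qed (auto simp: hb, auto simp: h_def U_def)
    also have "\<dots> = expectation (\<lambda>\<omega>. (emp n \<omega> (\<lambda>x. f x - g x))\<^sup>2) / a\<^sup>2"
      unfolding integral_sequence(2)[OF Um] Ue by simp
    also have "\<dots> \<le> (\<integral>x. (f x - g x)\<^sup>2 \<partial>P) / a\<^sup>2"
      using emp_second_moment(2)[OF d sq] by (intro divide_right_mono) auto
    finally show ?thesis .
  qed
  ultimately have "integral\<^sup>L L h \<le> (\<integral>x. (f x - g x)\<^sup>2 \<partial>P) / a\<^sup>2"
    by (intro LIMSEQ_le_const2) auto
  moreover have "measure L {z \<in> mspace (ell_infty F). a \<le> \<bar>z f - z g\<bar>} \<le> integral\<^sup>L L h"
  proof -
    have "measure L {z \<in> mspace (ell_infty F). a \<le> \<bar>z f - z g\<bar>} = (\<integral>z. indicator {z \<in> mspace (ell_infty F). a \<le> \<bar>z f - z g\<bar>} z \<partial>L)"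
      using S by simp
    also have "\<dots> \<le> integral\<^sup>L L h"
    proof (rule integral_mono)
      show "integrable L h" by (rule L.integrable_const_bound[where B = 1]) (use hb mh in auto)
      show "integrable L (indicator {z \<in> mspace (ell_infty F). a \<le> \<bar>z f - z g\<bar>} :: _ \<Rightarrow> real)"
        by (rule integrable_real_indicator[OF S]) (simp only: L.emeasure_eq_measure ennreal_less_top infinity_ennreal_def)
      fix z
      have "1 \<le> (\<phi> z / a)\<^sup>2" if "a \<le> \<bar>\<phi> z\<bar>"
        using that \<open>a > 0\<close> abs_le_square_iff[of a "\<phi> z"] by (simp add: power_divide)
      then show "indicator {z \<in> mspace (ell_infty F). a \<le> \<bar>z f - z g\<bar>} z \<le> h z"
        by (auto simp: indicator_def h_def \<phi>_def)
    qed
    finally show ?thesis .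
  qed
  ultimately show "measure L {z \<in> mspace (ell_infty F). a \<le> \<bar>z f - z g\<bar>} \<le> (\<integral>x. (f x - g x)\<^sup>2 \<partial>P) / a\<^sup>2"
    by linarith
qed

text \<open>For fixed data each of the finitely many summands is bounded over \<open>F\<close>, by
  the boundedness clause of \<open>donsker\<close>.\<close>

lemma empirical_process_in_ell_infty:
  assumes "donsker P F"
  shows "empirical_process P F n x \<in> mspace (ell_infty F)"
proof -
  have "\<exists>b. \<forall>f\<in>F. \<bar>f (x i) - integral\<^sup>L P f\<bar> \<le> b" for i
    using assms unfolding donsker_def bounded_iff by force
  then obtain b where b: "\<And>i f. f \<in> F \<Longrightarrow> \<bar>f (x i) - integral\<^sup>L P f\<bar> \<le> b i" by metis
  have "\<bar>empirical_process P F n x f\<bar> \<le> (1 / sqrt (real n)) * (\<Sum>i<n. b i)" if "f \<in> F" for f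
  proof -
    have "empirical_process P F n x f = (1 / sqrt (real n)) * (\<Sum>i<n. f (x i) - integral\<^sup>L P f)"
    proof (cases "n = 0")
      case False
      then have "empirical_process P F n x f = sqrt (real n) / real n * (\<Sum>i<n. f (x i) - integral\<^sup>L P f)"
        using that by (simp add: empirical_process_def sum_subtractf field_simps)
      also have "sqrt (real n) / real n = 1 / sqrt (real n)"
        using sqrt_divide_self_eq[of "real n"] by (simp add: inverse_eq_divide)
      finally show ?thesis .
    qed (use that in \<open>simp add: empirical_process_def\<close>)
    also have "\<bar>\<dots>\<bar> = (1 / sqrt (real n)) * \<bar>\<Sum>i<n. f (x i) - integral\<^sup>L P f\<bar>" by (simp add: abs_mult)
    also have "\<dots> \<le> (1 / sqrt (real n)) * (\<Sum>i<n. b i)"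
      using b[OF that] by (intro mult_left_mono order_trans[OF sum_abs] sum_mono) auto
    finally show ?thesis .
  qed
  then have "bounded (empirical_process P F n x ` F)" unfolding bounded_iff by auto
  moreover have "empirical_process P F n x \<in> extensional F" by (simp add: empirical_process_def)
  ultimately show ?thesis unfolding mspace_ell_infty_iff by blast
qed

text \<open>
  By tightness finitely many small balls carry almost all of the limit law. A ball of positive
  mass contains, by the second moment bound, a path with a small increment between \<open>f0\<close> and any
  \<open>f\<close> that is \<open>L\<^sup>2\<close>-close to \<open>f0\<close>, hence all its paths have one.
\<close>

theorem donsker_asymptotic_equicontinuity:
  assumes F: "donsker P F" "\<And>f. f \<in> F \<Longrightarrow> f \<in> borel_measurable borel" "\<And>f. f \<in> F \<Longrightarrow> integrable P (\<lambda>x. (f x)\<^sup>2)"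
    and f0: "f0 \<in> F" and "\<epsilon> > 0" "\<eta> > 0"
  shows "\<exists>\<delta>>0. \<forall>\<^sub>F n in sequentially. \<exists>B\<in>events. prob B \<le> \<eta> \<and>
    (\<forall>\<omega>\<in>space M - B. \<forall>f\<in>F. (\<integral>x. (f x - f0 x)\<^sup>2 \<partial>P) < \<delta> \<longrightarrow> \<bar>emp n \<omega> f - emp n \<omega> f0\<bar> \<le> 2 * \<epsilon>)"
proof -
  let ?m = "ell_infty F" and ?Q = "PiM UNIV (\<lambda>_::nat. P)"
  obtain L where L: "tight_borel_prob ?m L" "weakly_converges_outer ?Q (empirical_process P F) ?m L"
    using F(1) unfolding donsker_def by blast
  interpret L: prob_space L using L(1) by (simp add: tight_borel_prob_def)
  interpret m: Metric_space "mspace ?m" "mdist ?m" by (rule Metric_space_mspace_mdist)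
  have sp: "space L = mspace ?m" using L(1) by (simp add: tight_borel_prob_def)
  have setsL: "sets L = sigma_sets (topspace (mtopology_of ?m)) {U. openin (mtopology_of ?m) U}"
    using L(1) by (simp add: tight_borel_prob_def)
  \<comment> \<open>Two paths in a ball differ by less than \<open>2 * r = \<epsilon>/4\<close> at
    \<open>f\<close> and at \<open>f0\<close>; with an increment below \<open>\<epsilon>/2\<close>
    for one path this gives at most \<open>\<epsilon>\<close> for the other.\<close>
  define r where "r = \<epsilon> / 8"
  have "r > 0" using \<open>\<epsilon> > 0\<close> by (simp add: r_def)
  obtain C where C: "finite C" "C \<subseteq> mspace ?m" "\<And>c. c \<in> C \<Longrightarrow> mball_of ?m c r \<in> sets L"
    "measure L (mspace ?m - (\<Union>c\<in>C. mball_of ?m c r)) \<le> \<eta> / 2"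
    using tight_borel_prob_finite_cover[OF L(1), of "\<eta>/2" r] \<open>\<eta> > 0\<close> \<open>r > 0\<close> by auto
  \<comment> \<open>A null ball may contain no path with a small increment; such balls go into the
    exceptional set \<open>?N\<close>.\<close>
  define C' where "C' = {c\<in>C. measure L (mball_of ?m c r) > 0}"
  \<comment> \<open>The Chebyshev bound \<open>\<delta> / (\<epsilon>/2)\<^sup>2\<close> must not
    exceed the mass of any retained ball. The inserted 1 covers the case of an empty
    \<open>C'\<close>.\<close>
  define \<delta> where "\<delta> = Min (insert 1 ((\<lambda>c. measure L (mball_of ?m c r) * (\<epsilon>/2)\<^sup>2) ` C'))"
  have "finite C'" using C(1) by (simp add: C'_def)
  then have "\<delta> > 0" using \<open>\<epsilon> > 0\<close> by (auto simp: \<delta>_def C'_def)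
  have \<delta>_le: "\<delta> \<le> measure L (mball_of ?m c r) * (\<epsilon>/2)\<^sup>2" if "c \<in> C'" for c
    unfolding \<delta>_def using that \<open>finite C'\<close> by (intro Min_le) auto
  define V where "V = {f\<in>F. (\<integral>x. (f x - f0 x)\<^sup>2 \<partial>P) < \<delta>}"
  have f0V: "f0 \<in> V" using f0 \<open>\<delta> > 0\<close> by (simp add: V_def)
  have ball: "\<bar>z f - z f0\<bar> \<le> \<epsilon>" if c: "c \<in> C'" and z: "z \<in> mball_of ?m c r" and f: "f \<in> V" for c z f
  proof -
    have "f \<in> F" using f by (simp add: V_def)
    have zM: "z \<in> mspace ?m" using z unfolding mball_of_def m.in_mball by blast
    let ?A = "{z \<in> mspace ?m. \<epsilon>/2 \<le> \<bar>z f - z f0\<bar>}"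
    have A: "?A \<in> sets L" "measure L ?A \<le> (\<integral>x. (f x - f0 x)\<^sup>2 \<partial>P) / (\<epsilon>/2)\<^sup>2"
      using donsker_limit_marginal[OF F L \<open>f \<in> F\<close> f0, of "\<epsilon>/2"] \<open>\<epsilon> > 0\<close> by auto
    note A(2)
    also have "\<dots> < \<delta> / (\<epsilon>/2)\<^sup>2" using f \<open>\<epsilon> > 0\<close> by (intro divide_strict_right_mono) (auto simp: V_def)
    also have "\<dots> \<le> measure L (mball_of ?m c r)"
      using \<delta>_le[OF c] \<open>\<epsilon> > 0\<close> by (subst pos_divide_le_eq) auto
    finally have "\<not> mball_of ?m c r \<subseteq> ?A"
      using L.finite_measure_mono[OF _ A(1), of "mball_of ?m c r"] by linarith
    then obtain w where w: "w \<in> mball_of ?m c r" "w \<notin> ?A" by blast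
    then have wM: "w \<in> mspace ?m" unfolding mball_of_def m.in_mball by blast
    have "mdist ?m z w \<le> mdist ?m z c + mdist ?m c w"
      using zM wM c C(2) by (intro m.triangle) (auto simp: C'_def)
    also have "\<dots> \<le> r + r"
      using z w(1) unfolding mball_of_def m.in_mball by (subst m.commute[of z c]) linarith
    finally have "mdist ?m z w \<le> \<epsilon>/4" by (simp add: r_def)
    then have "\<bar>z f - w f\<bar> \<le> \<epsilon>/4" "\<bar>z f0 - w f0\<bar> \<le> \<epsilon>/4"
      using abs_le_mdist_ell_infty[OF zM wM \<open>f \<in> F\<close>] abs_le_mdist_ell_infty[OF zM wM f0] by linarith+
    moreover have "\<bar>w f - w f0\<bar> < \<epsilon>/2" using w(2) wM by auto
    ultimately show ?thesis by linarith
  qed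
  \<comment> \<open>The supremum may run over an uncountable set, but it is Lipschitz in the path,
    so measurability for \<open>L\<close> comes from continuity.\<close>
  define S where "S z = (SUP f\<in>V. \<bar>z f - z f0\<bar>)" for z :: "(real \<Rightarrow> real) \<Rightarrow> real"
  have bdd: "bdd_above ((\<lambda>f. \<bar>z f - z f0\<bar>) ` V)" if zm: "z \<in> mspace ?m" for z
  proof -
    have "bounded (z ` F)" using zm unfolding mspace_ell_infty_iff ..
    then obtain b where "\<forall>y\<in>z ` F. norm y \<le> b" unfolding bounded_iff ..
    then have b: "\<bar>z f\<bar> \<le> b" if "f \<in> F" for f using that by simp
    show ?thesis
    proof (rule bdd_aboveI2[where M = "b + b"])
      fix f assume "f \<in> V"
      then show "\<bar>z f - z f0\<bar> \<le> b + b" using b[of f] b[OF f0] by (auto simp: V_def)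
    qed
  qed
  have S_ge: "\<bar>z f - z f0\<bar> \<le> S z" if "z \<in> mspace ?m" "f \<in> V" for z f
    unfolding S_def using bdd[OF that(1)] that(2) by (rule cSUP_upper[rotated])
  have cS: "continuous_map (mtopology_of ?m) euclideanreal S"
  proof (rule continuous_map_ell_infty_Lipschitz[where C = 2])
    have *: "S z \<le> S w + 2 * mdist ?m z w" if zw: "z \<in> mspace ?m" "w \<in> mspace ?m" for z w
      unfolding S_def[of z]
    proof (rule cSUP_least)
      fix f assume f: "f \<in> V"
      then have "f \<in> F" by (simp add: V_def)
      from abs_le_mdist_ell_infty[OF zw this] abs_le_mdist_ell_infty[OF zw f0] S_ge[OF zw(2) f]
      show "\<bar>z f - z f0\<bar> \<le> S w + 2 * mdist ?m z w" by linarith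
    qed (use f0V in auto)
    fix z w assume "z \<in> mspace ?m" "w \<in> mspace ?m"
    then show "\<bar>S z - S w\<bar> \<le> 2 * mdist ?m z w"
      using *[of z w] *[of w z] m.commute[of z w] by linarith
  qed
  \<comment> \<open>A continuous ramp from 0 at \<open>S z = \<epsilon>\<close> to 1 at
    \<open>S z = 2 * \<epsilon>\<close>; its upper end is the origin of
    \<open>2 * \<epsilon>\<close> in the claim.\<close>
  define h where "h z = min 1 (max 0 ((S z - \<epsilon>) / \<epsilon>))" for z
  have ch: "continuous_map (mtopology_of ?m) euclideanreal h"
  proof -
    have "continuous_map euclideanreal euclideanreal (\<lambda>t. min 1 (max 0 ((t - \<epsilon>) / \<epsilon>)))"
      using \<open>\<epsilon> > 0\<close> by (auto intro!: continuous_intros)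
    from continuous_map_compose[OF cS this] show ?thesis by (simp add: comp_def h_def[abs_def])
  qed
  have mh: "h \<in> borel_measurable L"
    using borel_measurable_continuous_map_sigma[OF ch _ setsL] sp by simp
  have hb: "0 \<le> h z" "h z \<le> 1" for z by (auto simp: h_def)
  have lim: "(\<lambda>n. outer_expectation ?Q (\<lambda>\<omega>. h (empirical_process P F n \<omega>))) \<longlonglongrightarrow> integral\<^sup>L L h"
  proof -
    have "bounded (h ` mspace (?m))"
      unfolding bounded_iff using hb by (intro exI[of _ 1]) (simp add: abs_of_nonneg)
    then show ?thesis using L(2) ch unfolding weakly_converges_outer_def by blast
  qed
  \<comment> \<open>Off this set a path lies in a ball of positive mass, hence
    \<open>S z \<le> \<epsilon>\<close> and \<open>h z = 0\<close>.\<close>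
  let ?N = "(mspace ?m - (\<Union>c\<in>C. mball_of ?m c r)) \<union> (\<Union>c\<in>C - C'. mball_of ?m c r)"
  have "(\<Union>c\<in>C. mball_of ?m c r) \<in> sets L" using C(1,3) by (intro sets.finite_UN)
  then have N1: "mspace ?m - (\<Union>c\<in>C. mball_of ?m c r) \<in> sets L"
    unfolding sp[symmetric] by (rule sets.compl_sets)
  have N2: "(\<Union>c\<in>C - C'. mball_of ?m c r) \<in> sets L" using C(1,3) by (intro sets.finite_UN) blast+
  from N1 N2 have Nsets: "?N \<in> sets L" by (rule sets.Un)
  have "measure L ?N \<le> \<eta>/2"
  proof -
    have "measure L (\<Union>c\<in>C - C'. mball_of ?m c r) \<le> (\<Sum>c\<in>C - C'. measure L (mball_of ?m c r))"
      using C by (intro L.finite_measure_subadditive_finite) auto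
    also have "\<dots> = 0" by (intro sum.neutral) (auto simp: C'_def not_less intro: antisym)
    finally have "measure L (\<Union>c\<in>C - C'. mball_of ?m c r) \<le> 0" .
    moreover have "measure L ?N \<le> measure L (mspace ?m - (\<Union>c\<in>C. mball_of ?m c r)) + measure L (\<Union>c\<in>C - C'. mball_of ?m c r)" using N1 N2 by (rule measure_Un_le)
    ultimately show ?thesis using C(4) by linarith
  qed
  moreover have "integral\<^sup>L L h \<le> measure L ?N"
  proof -
    have "integral\<^sup>L L h \<le> (\<integral>z. indicator ?N z \<partial>L)"
    proof (rule integral_mono)
      show "integrable L h" by (rule L.integrable_const_bound[where B = 1]) (use hb mh in auto)
      show "integrable L (indicator ?N :: _ \<Rightarrow> real)"
        by (rule integrable_real_indicator[OF Nsets]) (simp only: L.emeasure_eq_measure ennreal_less_top infinity_ennreal_def)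
      fix z assume "z \<in> space L"
      then have z: "z \<in> mspace ?m" using sp by simp
      show "h z \<le> indicator ?N z"
      proof (cases "z \<in> ?N")
        case False
        then obtain c where "c \<in> C'" "z \<in> mball_of ?m c r" using z by auto
        then have "S z \<le> \<epsilon>" unfolding S_def using f0V ball by (intro cSUP_least) auto
        then show ?thesis using False \<open>\<epsilon> > 0\<close> by (simp add: h_def max_def divide_le_0_iff)
      qed (use hb in simp)
    qed
    also have "\<dots> = measure L ?N" using Nsets by simp
    finally show ?thesis .
  qed
  ultimately have "integral\<^sup>L L h < \<eta>" using \<open>\<eta> > 0\<close> by linarith
  from order_tendstoD(2)[OF lim this]
  have "\<forall>\<^sub>F n in sequentially. \<exists>B\<in>events. prob B \<le> \<eta> \<and>
    (\<forall>\<omega>\<in>space M - B. \<forall>f\<in>F. (\<integral>x. (f x - f0 x)\<^sup>2 \<partial>P) < \<delta> \<longrightarrow> \<bar>emp n \<omega> f - emp n \<omega> f0\<bar> \<le> 2 * \<epsilon>)"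
  proof eventually_elim
    case (elim n)
    interpret Q: prob_space ?Q using P_prob_space by (intro prob_space_PiM)
    obtain U where U: "integrable ?Q U" "\<forall>x\<in>space ?Q. h (empirical_process P F n x) \<le> U x" "integral\<^sup>L ?Q U < \<eta>"
      using outer_expectation_lessD[OF elim Q.finite_measure_axioms] hb by auto
    \<comment> \<open>A measurable superset of the event \<open>h \<ge> 1\<close>: Markov's
      inequality for the majorant \<open>U\<close> bounds its probability, and off it
      \<open>h < 1\<close> forces \<open>S < 2 * \<epsilon>\<close>.\<close>
    define B where "B = {x\<in>space ?Q. 1 \<le> U x}"
    have B: "B \<in> sets ?Q" unfolding B_def using borel_measurable_integrable[OF U(1)] by measurable
    have "0 \<le> U x" if "x \<in> space ?Q" for x using order_trans[OF hb(1) U(2)[rule_format, OF that]] .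
    then have "measure ?Q B \<le> integral\<^sup>L ?Q U / 1"
      unfolding B_def using U(1) by (intro integral_Markov_inequality_measure[where A = "{}"]) auto
    then have "measure ?Q B \<le> \<eta>" using U(3) by simp
    show ?case
    proof (intro bexI[of _ "(\<lambda>\<omega> i. X i \<omega>) -` B \<inter> space M"] conjI ballI impI)
      show "(\<lambda>\<omega> i. X i \<omega>) -` B \<inter> space M \<in> events" using B by measurable
      show "prob ((\<lambda>\<omega> i. X i \<omega>) -` B \<inter> space M) \<le> \<eta>"
        using \<open>measure ?Q B \<le> \<eta>\<close> prob_sequence[OF B] by simp
    next
      fix \<omega> f assume \<omega>: "\<omega> \<in> space M - ((\<lambda>\<omega> i. X i \<omega>) -` B \<inter> space M)" and f: "f \<in> F" "(\<integral>x. (f x - f0 x)\<^sup>2 \<partial>P) < \<delta>"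
      let ?z = "empirical_process P F n (\<lambda>i. X i \<omega>)"
      have z: "?z \<in> mspace ?m" using empirical_process_in_ell_infty[OF F(1)] .
      have sQ: "(\<lambda>i. X i \<omega>) \<in> space ?Q" by (simp add: space_PiM)
      then have "U (\<lambda>i. X i \<omega>) < 1" using \<omega> by (auto simp: B_def not_le)
      then have "h ?z < 1" using U(2) sQ by fastforce
      then have "(S ?z - \<epsilon>) / \<epsilon> < 1" by (auto simp: h_def split: if_splits)
      then have "S ?z < 2 * \<epsilon>" using \<open>\<epsilon> > 0\<close> by (simp add: field_simps)
      moreover have "\<bar>?z f - ?z f0\<bar> \<le> S ?z" using S_ge[OF z] f by (simp add: V_def)
      ultimately show "\<bar>emp n \<omega> f - emp n \<omega> f0\<bar> \<le> 2 * \<epsilon>"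
        using f(1) f0 by (simp add: empirical_process_eq_emp)
    qed
  qed
  with \<open>\<delta> > 0\<close> show ?thesis by blast
qed

end

section \<open>Conditional central limit theorem\<close>

lemma exp_minus_linear_bound:
  fixes x :: real
  assumes "0 \<le> x"
  shows "\<bar>exp (- x) - (1 - x)\<bar> \<le> x\<^sup>2"
proof -
  have "exp (- x) = 1 / exp x" by (simp add: exp_minus inverse_eq_divide)
  also have "\<dots> \<le> 1 / (1 + x)" using assms exp_ge_add_one_self[of x] by (intro divide_left_mono) auto
  also have "\<dots> \<le> 1 - x + x\<^sup>2"
  proof -
    have "(1 - x + x\<^sup>2) * (1 + x) = 1 + x ^ 3" by (simp add: power2_eq_square power3_eq_cube algebra_simps)
    then show ?thesis using assms by (simp add: pos_divide_le_eq)
  qed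
  finally show ?thesis using exp_ge_add_one_self[of "- x"] by linarith
qed

lemma char_boot_sum:
  fixes f :: "nat \<Rightarrow> real"
  assumes "n > 0"
  shows "char (distr (measure_pmf (boot_indices n)) borel (\<lambda>J. \<Sum>j<n. f (J j))) t = ((\<Sum>i<n. iexp (t * f i)) / of_nat n) ^ n"
proof -
  have "char (distr (measure_pmf (boot_indices n)) borel (\<lambda>J. \<Sum>j<n. f (J j))) t =
      (\<Prod>j<n. char (distr (measure_pmf (boot_indices n)) borel (\<lambda>J. f (J j))) t)"
    by (rule prob_space.char_distr_sum[OF measure_pmf.prob_space_axioms indep_vars_boot_indices])
  also have "\<dots> = (\<Prod>j<n. char (distr (measure_pmf (pmf_of_set {..<n})) borel f) t)"
    by (intro prod.cong refl) (simp add: distr_boot_index)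
  also have "char (distr (measure_pmf (pmf_of_set {..<n})) borel f) t = (\<Sum>i<n. iexp (t * f i)) / of_nat n"
  proof -
    have "char (distr (measure_pmf (pmf_of_set {..<n})) borel f) t = (CLINT i|measure_pmf (pmf_of_set {..<n}). iexp (t * f i))"
      unfolding char_def by (subst integral_distr) auto
    also have "\<dots> = (\<Sum>i\<in>{..<n}. pmf (pmf_of_set {..<n}) i *\<^sub>R iexp (t * f i))"
      using assms by (intro integral_measure_pmf) (auto simp: set_pmf_of_set lessThan_empty_iff)
    also have "\<dots> = (\<Sum>i<n. iexp (t * f i) / of_nat n)"
      using assms by (intro sum.cong refl)
        (subst pmf_of_set, auto simp: lessThan_empty_iff scaleR_conv_of_real field_simps)
    finally show ?thesis by (simp add: sum_divide_distrib)
  qed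
  finally show ?thesis by simp
qed

text \<open>Both bases lie in the unit disc, so their \<open>n\<close>-th powers differ by at most
  \<open>n\<close> times the difference of the bases. Each base is compared with
  \<open>1 - a\<close>: the first by Taylor expansion, whose cubic error is at most
  \<open>\<kappa>\<close> times a square up to constants, the second by
  \<open>exp_minus_linear_bound\<close>. Only \<open>\<kappa>\<close>, \<open>v\<close> and
  \<open>n\<close> enter the bound, hence it is uniform over the data.\<close>

lemma norm_iexp_mean_diff:
  fixes f :: "nat \<Rightarrow> real"
  assumes n: "n > 0" and mean: "(\<Sum>i<n. f i) = 0" and small: "\<And>i. i < n \<Longrightarrow> \<bar>f i\<bar> \<le> \<kappa>"
  defines "v \<equiv> \<Sum>i<n. (f i)\<^sup>2"
  shows "norm (((\<Sum>i<n. iexp (t * f i)) / of_nat n) ^ n - exp (- (t\<^sup>2 * v / 2)))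
    \<le> \<bar>t\<bar> ^ 3 * \<kappa> * v / 6 + (t\<^sup>2 * v / 2)\<^sup>2 / n"
proof -
  define a where "a = t\<^sup>2 * v / 2 / n"
  have "v \<ge> 0" unfolding v_def by (intro sum_nonneg) auto
  then have "a \<ge> 0" by (simp add: a_def)
  define z where "z = (\<Sum>i<n. iexp (t * f i)) / of_nat n"
  define w where "w = complex_of_real (exp (- a))"
  have wn: "w ^ n = exp (- (t\<^sup>2 * v / 2))"
  proof -
    have "exp (- a) ^ n = exp (- (t\<^sup>2 * v / 2))" using n by (simp add: exp_of_nat_mult[symmetric] a_def)
    then show ?thesis unfolding w_def by (metis of_real_power exp_of_real)
  qed
  have "norm z \<le> (\<Sum>i<n. 1) / n"
    unfolding z_def norm_divide norm_of_nat by (intro divide_right_mono order_trans[OF norm_sum] sum_mono) auto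
  then have z1: "norm z \<le> 1" using n by simp
  have w1: "norm w \<le> 1" using \<open>a \<ge> 0\<close> by (simp add: w_def norm_of_real)
  \<comment> \<open>The quadratic Taylor polynomials are averaged: the linear terms cancel by
    \<open>mean\<close> and the squares sum to \<open>v\<close>, which leaves
    \<open>1 - a\<close>.\<close>
  have z2: "z - of_real (1 - a) = (\<Sum>i<n. iexp (t * f i) - (1 + \<i> * of_real (t * f i) - of_real ((t * f i)\<^sup>2 / 2))) / of_nat n"
  proof -
    have "(\<Sum>i<n. 1 + \<i> * of_real (t * f i) - of_real ((t * f i)\<^sup>2 / 2)) = of_nat n + \<i> * of_real (t * (\<Sum>i<n. f i)) - of_real (t\<^sup>2 * v / 2)"
      by (simp add: sum.distrib sum_subtractf sum_distrib_left v_def power_mult_distrib sum_divide_distrib)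
    then have "(\<Sum>i<n. 1 + \<i> * of_real (t * f i) - of_real ((t * f i)\<^sup>2 / 2)) / of_nat n = complex_of_real (1 - a)"
      using n mean by (simp add: diff_divide_distrib a_def)
    then show ?thesis by (simp add: z_def sum_subtractf diff_divide_distrib)
  qed
  have taylor: "norm (iexp (t * f i) - (1 + \<i> * of_real (t * f i) - of_real ((t * f i)\<^sup>2 / 2))) \<le> \<bar>t\<bar> ^ 3 * \<kappa> * (f i)\<^sup>2 / 6"
    if "i < n" for i
  proof -
    let ?x = "t * f i"
    have "(\<Sum>k\<le>2. (\<i> * of_real ?x) ^ k / fact k) = 1 + \<i> * of_real ?x - of_real (?x\<^sup>2 / 2)"
      by (simp add: numeral_2_eq_2 power2_eq_square algebra_simps)
    then have "norm (iexp ?x - (1 + \<i> * of_real ?x - of_real (?x\<^sup>2 / 2))) \<le> \<bar>?x\<bar> ^ 3 / 6"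
      using iexp_approx1[of ?x 2] by (simp add: numeral_3_eq_3 fact_numeral)
    also have "\<bar>?x\<bar> ^ 3 = \<bar>t\<bar> ^ 3 * \<bar>f i\<bar> * (f i)\<^sup>2"
    proof -
      have "\<bar>f i\<bar> ^ 3 = \<bar>f i\<bar> * \<bar>f i\<bar>\<^sup>2" by (simp add: power3_eq_cube power2_eq_square)
      then show ?thesis by (simp add: abs_mult power_mult_distrib)
    qed
    also have "\<dots> / 6 \<le> \<bar>t\<bar> ^ 3 * \<kappa> * (f i)\<^sup>2 / 6"
      using small[OF that] by (intro divide_right_mono mult_right_mono mult_left_mono) auto
    finally show ?thesis .
  qed
  have "norm (z - of_real (1 - a)) \<le> (\<Sum>i<n. \<bar>t\<bar> ^ 3 * \<kappa> * (f i)\<^sup>2 / 6) / n"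
    unfolding z2 norm_divide norm_of_nat using taylor
    by (intro divide_right_mono order_trans[OF norm_sum] sum_mono) auto
  also have "(\<Sum>i<n. \<bar>t\<bar> ^ 3 * \<kappa> * (f i)\<^sup>2 / 6) = \<bar>t\<bar> ^ 3 * \<kappa> * v / 6"
    by (simp add: v_def sum_distrib_left sum_divide_distrib)
  finally have A: "norm (z - of_real (1 - a)) \<le> \<bar>t\<bar> ^ 3 * \<kappa> * v / 6 / n" .
  have "norm (of_real (1 - a) - w) = \<bar>exp (- a) - (1 - a)\<bar>"
    unfolding w_def of_real_diff[symmetric] norm_of_real by simp
  then have "norm (of_real (1 - a) - w) \<le> a\<^sup>2" using exp_minus_linear_bound[OF \<open>a \<ge> 0\<close>] by simp
  with A have "norm (z - w) \<le> \<bar>t\<bar> ^ 3 * \<kappa> * v / 6 / n + a\<^sup>2"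
    using norm_triangle_ineq[of "z - of_real (1 - a)" "of_real (1 - a) - w"] by simp
  then have "real n * norm (z - w) \<le> real n * (\<bar>t\<bar> ^ 3 * \<kappa> * v / 6 / n + a\<^sup>2)"
    by (intro mult_left_mono) auto
  also have "\<dots> = \<bar>t\<bar> ^ 3 * \<kappa> * v / 6 + (t\<^sup>2 * v / 2)\<^sup>2 / n"
    using n by (simp add: a_def distrib_left power2_eq_square)
  finally show ?thesis
    using norm_power_diff[OF z1 w1, of n] unfolding wn unfolding z_def by linarith
qed

text \<open>Scaling a standard normal variable by 0 yields the point mass, so this form treats
  degenerate and positive variance together.\<close>

lemma normal_law_eq_distr:
  assumes "s \<ge> 0"
  shows "normal_law 0 s = distr std_normal_distribution borel (\<lambda>x. sqrt s * x)"
proof (cases "s = 0")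
  case True
  interpret prob_space std_normal_distribution
    using real_dist_normal_dist by (simp add: real_distribution_def)
  show ?thesis using True distr_const[of "0::real" borel] by (simp add: normal_law_def)
next
  case False
  then have s: "s > 0" using assms by simp
  interpret prob_space std_normal_distribution
    using real_dist_normal_dist by (simp add: real_distribution_def)
  have "distributed std_normal_distribution lborel (\<lambda>x. x) (normal_density 0 1)"
    unfolding distributed_def by (auto simp: distr_id2)
  from normal_density_affine[OF this, of "sqrt s" 0] s
  have "distributed std_normal_distribution lborel (\<lambda>x. sqrt s * x) (normal_density 0 (sqrt s))" by simp
  then have "distr std_normal_distribution lborel (\<lambda>x. sqrt s * x) = density lborel (normal_density 0 (sqrt s))"
    by (simp add: distributed_def)
  moreover have "distr std_normal_distribution borel (\<lambda>x. sqrt s * x) = distr std_normal_distribution lborel (\<lambda>x. sqrt s * x)"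
    by (intro distr_cong) auto
  ultimately show ?thesis using s by (simp add: normal_law_def)
qed

lemma real_distribution_normal_law: "s \<ge> 0 \<Longrightarrow> real_distribution (normal_law 0 s)"
proof -
  assume "s \<ge> 0"
  interpret prob_space std_normal_distribution
    using real_dist_normal_dist by (simp add: real_distribution_def)
  show ?thesis unfolding normal_law_eq_distr[OF \<open>s \<ge> 0\<close>] by (rule real_distribution_distr) simp
qed

lemma char_normal_law:
  assumes "s \<ge> 0"
  shows "char (normal_law 0 s) t = exp (- (t\<^sup>2 * s / 2))"
proof -
  have "char (normal_law 0 s) t = char std_normal_distribution (t * sqrt s)"
    unfolding normal_law_eq_distr[OF assms] char_def by (subst integral_distr) (auto simp: mult.assoc)
  then show ?thesis using assms by (simp add: char_std_normal_distribution power_mult_distrib exp_of_real)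
qed

section \<open>Bounded-Lipschitz distance and the triangular-array limit theorem\<close>

lemma bl_dist_upper:
  fixes f :: "real \<Rightarrow> real"
  assumes "prob_space \<mu>" "prob_space \<nu>" "\<And>x. \<bar>f x\<bar> \<le> 1" "1-lipschitz_on UNIV f"
  shows "\<bar>integral\<^sup>L \<mu> f - integral\<^sup>L \<nu> f\<bar> \<le> bl_dist \<mu> \<nu>"
proof -
  have *: "\<bar>integral\<^sup>L \<mu> f\<bar> \<le> 1" if "prob_space \<mu>" "\<And>x. \<bar>f x\<bar> \<le> 1" for \<mu> :: "real measure" and f :: "real \<Rightarrow> real"
  proof -
    interpret prob_space \<mu> by fact
    show ?thesis
    proof (cases "integrable \<mu> f")
      case True
      have "\<bar>integral\<^sup>L \<mu> f\<bar> \<le> (\<integral>x. \<bar>f x\<bar> \<partial>\<mu>)" by (rule integral_abs_bound)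
      also have "\<dots> \<le> (\<integral>x. 1 \<partial>\<mu>)" using True that by (intro integral_mono) auto
      finally show ?thesis by (simp add: prob_space)
    qed (simp add: not_integrable_integral_eq)
  qed
  show ?thesis unfolding bl_dist_def
  proof (rule cSUP_upper)
    show "f \<in> {f :: real \<Rightarrow> real. (\<forall>x. \<bar>f x\<bar> \<le> 1) \<and> 1-lipschitz_on UNIV f}" using assms(3,4) by simp
    show "bdd_above ((\<lambda>f. \<bar>integral\<^sup>L \<mu> f - integral\<^sup>L \<nu> f\<bar>) ` {f :: real \<Rightarrow> real. (\<forall>x. \<bar>f x\<bar> \<le> 1) \<and> 1-lipschitz_on UNIV f})"
    proof (rule bdd_aboveI2[where M = 2])
      fix f :: "real \<Rightarrow> real" assume "f \<in> {f :: real \<Rightarrow> real. (\<forall>x. \<bar>f x\<bar> \<le> 1) \<and> 1-lipschitz_on UNIV f}"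
      then show "\<bar>integral\<^sup>L \<mu> f - integral\<^sup>L \<nu> f\<bar> \<le> 2"
        using *[OF assms(1), of f] *[OF assms(2), of f] by auto
    qed
  qed
qed

lemma lipschitz_on_zero: "1-lipschitz_on UNIV (\<lambda>_::real. 0::real)"
  by (rule lipschitz_onI) auto

lemma bl_dist_nonneg: "prob_space \<mu> \<Longrightarrow> prob_space \<nu> \<Longrightarrow> 0 \<le> bl_dist \<mu> \<nu>"
  using bl_dist_upper[of \<mu> \<nu> "\<lambda>_. 0"] lipschitz_on_zero by simp

lemma bl_dist_least:
  assumes "\<And>f :: real \<Rightarrow> real. (\<And>x. \<bar>f x\<bar> \<le> 1) \<Longrightarrow> 1-lipschitz_on UNIV f \<Longrightarrow> \<bar>integral\<^sup>L \<mu> f - integral\<^sup>L \<nu> f\<bar> \<le> b"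
  shows "bl_dist \<mu> \<nu> \<le> b"
  unfolding bl_dist_def
proof (rule cSUP_least)
  show "{f :: real \<Rightarrow> real. (\<forall>x. \<bar>f x\<bar> \<le> 1) \<and> 1-lipschitz_on UNIV f} \<noteq> {}"
    using lipschitz_on_zero by (intro ex_in_conv[THEN iffD1] exI[of _ "\<lambda>_. 0"]) auto
qed (use assms in auto)

text \<open>Skorohod coupling makes the convergence of the integrals uniform over the test functions.\<close>

lemma bl_dist_tendsto_zero:
  assumes \<mu>: "\<And>n. real_distribution (\<mu> n)" and M: "real_distribution M" and conv: "weak_conv_m \<mu> M"
  shows "(\<lambda>n. bl_dist (\<mu> n) M) \<longlonglongrightarrow> 0"
proof -
  obtain \<Omega> :: "real measure" and Y_seq :: "nat \<Rightarrow> real \<Rightarrow> real" and Y where Om: "prob_space \<Omega>"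
    and Yn: "\<And>n. Y_seq n \<in> measurable \<Omega> borel" "\<And>n. distr \<Omega> borel (Y_seq n) = \<mu> n"
    and Y: "Y \<in> measurable \<Omega> lborel" "distr \<Omega> borel Y = M"
    and lim: "\<And>x. x \<in> space \<Omega> \<Longrightarrow> (\<lambda>n. Y_seq n x) \<longlonglongrightarrow> Y x"
    using Skorohod[OF \<mu> M conv] by blast
  interpret \<Omega>: prob_space \<Omega> by fact
  have Y': "Y \<in> borel_measurable \<Omega>" using Y(1) by simp
  \<comment> \<open>Two values of a test function differ by at most 2 and by at most the distance of
    the arguments. So \<open>b n\<close> bounds all test functions at once, and the constant 2
    dominates the integrands.\<close>
  define b where "b n = (\<integral>x. min 2 \<bar>Y_seq n x - Y x\<bar> \<partial>\<Omega>)" for n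
  have "b \<longlonglongrightarrow> (\<integral>x. 0 \<partial>\<Omega>)"
    unfolding b_def
  proof (rule integral_dominated_convergence[where w = "\<lambda>_. 2"])
    show "AE x in \<Omega>. (\<lambda>n. min 2 \<bar>Y_seq n x - Y x\<bar>) \<longlonglongrightarrow> 0"
    proof (rule AE_I2)
      fix x assume "x \<in> space \<Omega>"
      from lim[OF this] have "(\<lambda>n. min 2 \<bar>Y_seq n x - Y x\<bar>) \<longlonglongrightarrow> min 2 \<bar>Y x - Y x\<bar>"
        by (intro tendsto_intros)
      then show "(\<lambda>n. min 2 \<bar>Y_seq n x - Y x\<bar>) \<longlonglongrightarrow> 0" by simp
    qed
  qed (use Yn(1) Y' in auto)
  then have b: "b \<longlonglongrightarrow> 0" by simp
  have le: "bl_dist (\<mu> n) M \<le> b n" for n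
  proof (rule bl_dist_least)
    fix f :: "real \<Rightarrow> real" assume f: "\<And>x. \<bar>f x\<bar> \<le> 1" "1-lipschitz_on UNIV f"
    have fm: "f \<in> borel_measurable borel"
      using lipschitz_on_continuous_on[OF f(2)] by (rule borel_measurable_continuous_onI)
    have i: "integrable \<Omega> (\<lambda>x. f (Y_seq n x))" "integrable \<Omega> (\<lambda>x. f (Y x))"
      using f(1) fm Yn(1) Y' by (auto intro!: \<Omega>.integrable_const_bound[where B = 1] measurable_compose[OF _ fm])
    have "integral\<^sup>L (\<mu> n) f - integral\<^sup>L M f = (\<integral>x. f (Y_seq n x) - f (Y x) \<partial>\<Omega>)"
      unfolding Yn(2)[symmetric] Y(2)[symmetric] using i Yn(1) Y' fm by (simp add: integral_distr)
    also have "\<bar>\<dots>\<bar> \<le> (\<integral>x. \<bar>f (Y_seq n x) - f (Y x)\<bar> \<partial>\<Omega>)" by (rule integral_abs_bound)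
    also have "\<dots> \<le> b n"
      unfolding b_def
    proof (rule integral_mono)
      show "integrable \<Omega> (\<lambda>x. \<bar>f (Y_seq n x) - f (Y x)\<bar>)" using i by auto
      show "integrable \<Omega> (\<lambda>x. min 2 \<bar>Y_seq n x - Y x\<bar>)"
        using Yn(1) Y' by (intro \<Omega>.integrable_const_bound[where B = 2]) auto
      fix x
      show "\<bar>f (Y_seq n x) - f (Y x)\<bar> \<le> min 2 \<bar>Y_seq n x - Y x\<bar>"
        using f(1)[of "Y_seq n x"] f(1)[of "Y x"] lipschitz_onD[OF f(2), of "Y_seq n x" "Y x"]
        by (auto simp: dist_real_def)
    qed
    finally show "\<bar>integral\<^sup>L (\<mu> n) f - integral\<^sup>L M f\<bar> \<le> b n" .
  qed
  show ?thesis
  proof (rule real_tendsto_sandwich[OF _ _ tendsto_const b])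
    show "\<forall>\<^sub>F n in sequentially. 0 \<le> bl_dist (\<mu> n) M"
      using \<mu> M by (auto simp: real_distribution_def intro!: always_eventually bl_dist_nonneg)
  qed (use le in auto)
qed

text \<open>Uniform smallness of the terms plays the part of the Lindeberg condition: it makes the
  error in \<open>norm_iexp_mean_diff\<close> vanish, and Levy continuity gives the normal limit.
  The sample sizes \<open>N k\<close> are arbitrary because the lemma is applied along a sequence of
  counterexamples.\<close>

lemma boot_sum_bl_dist_tendsto_zero:
  fixes N :: "nat \<Rightarrow> nat" and f :: "nat \<Rightarrow> nat \<Rightarrow> real"
  assumes N: "filterlim N at_top sequentially" "\<And>k. N k > 0"
    and mean: "\<And>k. (\<Sum>i<N k. f k i) = 0"
    and var: "(\<lambda>k. \<Sum>i<N k. (f k i)\<^sup>2) \<longlonglongrightarrow> s"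
    and small: "\<And>k i. i < N k \<Longrightarrow> \<bar>f k i\<bar> \<le> \<kappa> k" "\<kappa> \<longlonglongrightarrow> 0"
  shows "(\<lambda>k. bl_dist (distr (measure_pmf (boot_indices (N k))) borel (\<lambda>J. \<Sum>j<N k. f k (J j))) (normal_law 0 s)) \<longlonglongrightarrow> 0"
proof -
  define v where "v k = (\<Sum>i<N k. (f k i)\<^sup>2)" for k
  have v: "v \<longlonglongrightarrow> s" using var by (simp add: v_def[abs_def])
  have "s \<ge> 0" by (rule LIMSEQ_le_const[OF v]) (auto simp: v_def intro!: sum_nonneg)
  show ?thesis
  proof (rule bl_dist_tendsto_zero)
    show "real_distribution (normal_law 0 s)" using real_distribution_normal_law[OF \<open>s \<ge> 0\<close>] .
    show rd: "real_distribution (distr (measure_pmf (boot_indices (N k))) borel (\<lambda>J. \<Sum>j<N k. f k (J j)))" for k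
      by (rule prob_space.real_distribution_distr[OF measure_pmf.prob_space_axioms]) simp
    show "weak_conv_m (\<lambda>k. distr (measure_pmf (boot_indices (N k))) borel (\<lambda>J. \<Sum>j<N k. f k (J j))) (normal_law 0 s)"
    proof (rule levy_continuity)
      fix t
      let ?c = "\<lambda>k. char (distr (measure_pmf (boot_indices (N k))) borel (\<lambda>J. \<Sum>j<N k. f k (J j))) t"
      have "(\<lambda>k. \<bar>t\<bar> ^ 3 * \<kappa> k * v k / 6 + (t\<^sup>2 * v k / 2)\<^sup>2 / real (N k)) \<longlonglongrightarrow> \<bar>t\<bar> ^ 3 * 0 * s / 6 + 0"
        by (intro tendsto_intros v small(2) real_tendsto_divide_at_top[where c = "(t\<^sup>2 * s / 2)\<^sup>2"]
            filterlim_compose[OF filterlim_real_sequentially N(1)]) auto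
      then have "(\<lambda>k. \<bar>t\<bar> ^ 3 * \<kappa> k * v k / 6 + (t\<^sup>2 * v k / 2)\<^sup>2 / real (N k)) \<longlonglongrightarrow> 0" by simp
      then have "(\<lambda>k. ?c k - exp (- (t\<^sup>2 * v k / 2))) \<longlonglongrightarrow> 0"
      proof (rule Lim_null_comparison[rotated], intro always_eventually allI)
        fix k
        show "norm (?c k - exp (- (t\<^sup>2 * v k / 2))) \<le> \<bar>t\<bar> ^ 3 * \<kappa> k * v k / 6 + (t\<^sup>2 * v k / 2)\<^sup>2 / real (N k)"
          unfolding char_boot_sum[OF N(2)] v_def
          by (rule norm_iexp_mean_diff[OF N(2) mean small(1)])
      qed
      moreover have "(\<lambda>k. complex_of_real (exp (- (t\<^sup>2 * v k / 2)))) \<longlonglongrightarrow> complex_of_real (exp (- (t\<^sup>2 * s / 2)))"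
        by (intro tendsto_intros v) auto
      ultimately have "(\<lambda>k. (?c k - exp (- (t\<^sup>2 * v k / 2))) + complex_of_real (exp (- (t\<^sup>2 * v k / 2))))
          \<longlonglongrightarrow> 0 + complex_of_real (exp (- (t\<^sup>2 * s / 2)))"
        by (intro tendsto_add) (simp_all add: exp_of_real)
      then show "?c \<longlonglongrightarrow> char (normal_law 0 s) t"
        unfolding char_normal_law[OF \<open>s \<ge> 0\<close>] by (simp add: exp_of_real)
    qed (use rd real_distribution_normal_law[OF \<open>s \<ge> 0\<close>] in auto)
  qed
qed

text \<open>A pmf carries the discrete sigma-algebra, whereas Levy continuity and Skorohod coupling
  work with Borel laws. Lipschitz test functions are measurable for both.\<close>

lemma bl_dist_map_pmf:
  "bl_dist (measure_pmf (map_pmf R p)) L = bl_dist (distr (measure_pmf p) borel R) L"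
proof -
  have "integral\<^sup>L (measure_pmf (map_pmf R p)) f = integral\<^sup>L (distr (measure_pmf p) borel R) f"
    if "1-lipschitz_on UNIV f" for f :: "real \<Rightarrow> real"
  proof -
    have "f \<in> borel_measurable borel"
      using lipschitz_on_continuous_on[OF that] by (rule borel_measurable_continuous_onI)
    then show ?thesis by (simp add: integral_distr)
  qed
  then show ?thesis unfolding bl_dist_def by (intro arg_cong[where f = Sup] image_cong) auto
qed

lemma boot_process_bl_dist_small:
  assumes "\<epsilon> > 0"
  shows "\<exists>\<delta>>0. \<exists>n0. \<forall>n\<ge>n0. \<forall>x h. \<bar>(\<Sum>i<n. h (x i)) / real n\<bar> \<le> \<delta> \<longrightarrow> \<bar>(\<Sum>i<n. (h (x i))\<^sup>2) / real n - s\<bar> \<le> \<delta> \<longrightarrow>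
    (\<forall>i<n. \<bar>h (x i)\<bar> \<le> \<delta> * sqrt (real n)) \<longrightarrow>
    bl_dist (measure_pmf (map_pmf (\<lambda>J. boot_process n x J h) (boot_indices n))) (normal_law 0 s) \<le> \<epsilon>"
proof (rule ccontr)
  let ?D = "\<lambda>n x h. bl_dist (measure_pmf (map_pmf (\<lambda>J. boot_process n x J h) (boot_indices n))) (normal_law 0 s)"
  let ?C = "\<lambda>\<delta> n x h. \<bar>(\<Sum>i<n. h (x i)) / real n\<bar> \<le> \<delta> \<and> \<bar>(\<Sum>i<n. (h (x i))\<^sup>2) / real n - s\<bar> \<le> \<delta> \<and>
      (\<forall>i<n. \<bar>h (x i)\<bar> \<le> \<delta> * sqrt (real n))"
  assume neg: "\<not> ?thesis"
  define bad where "bad k n x h \<longleftrightarrow> n \<ge> Suc k \<and> ?C (1 / Suc k) n x h \<and> \<epsilon> < ?D n x h" for k n x h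
  have "\<exists>n x h. bad k n x h" for k
  proof (rule ccontr)
    assume a: "\<nexists>n x h. bad k n x h"
    have *: "\<forall>n\<ge>Suc k. \<forall>x h. \<bar>(\<Sum>i<n. h (x i)) / real n\<bar> \<le> 1 / Suc k \<longrightarrow>
      \<bar>(\<Sum>i<n. (h (x i))\<^sup>2) / real n - s\<bar> \<le> 1 / Suc k \<longrightarrow>
      (\<forall>i<n. \<bar>h (x i)\<bar> \<le> 1 / Suc k * sqrt (real n)) \<longrightarrow> ?D n x h \<le> \<epsilon>"
    proof (intro allI impI)
      fix n and x :: "nat \<Rightarrow> real" and h :: "real \<Rightarrow> real"
      assume *: "n \<ge> Suc k" "\<bar>(\<Sum>i<n. h (x i)) / real n\<bar> \<le> 1 / Suc k"
        "\<bar>(\<Sum>i<n. (h (x i))\<^sup>2) / real n - s\<bar> \<le> 1 / Suc k" "\<forall>i<n. \<bar>h (x i)\<bar> \<le> 1 / Suc k * sqrt (real n)"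
      show "?D n x h \<le> \<epsilon>"
      proof (rule ccontr)
        assume "\<not> ?D n x h \<le> \<epsilon>"
        then have "bad k n x h" unfolding bad_def by (intro conjI *) (simp only: not_le)
        then show False using a by blast
      qed
    qed
    have "0 < 1 / real (Suc k)" by simp
    show False
      by (rule notE[OF neg], rule exI[of _ "1 / real (Suc k)"], rule conjI, fact, rule exI[of _ "Suc k"], fact *)
  qed
  then obtain N x h where bad: "\<And>k. bad k (N k) (x k) (h k)" by metis
  then have N: "\<And>k. N k \<ge> Suc k" and C: "\<And>k. ?C (1 / Suc k) (N k) (x k) (h k)"
    and D: "\<And>k. \<epsilon> < ?D (N k) (x k) (h k)"
    unfolding bad_def by blast+
  define y where "y k i = h k (x k i)" for k i
  define m where "m k = (\<Sum>i<N k. y k i) / real (N k)" for k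
  \<comment> \<open>Centring makes each row sum to 0 and leaves the bootstrap process unchanged,
    which is itself centred at the sample mean.\<close>
  define f where "f k i = (y k i - m k) / sqrt (real (N k))" for k i
  have Npos: "N k > 0" for k using N[of k] by simp
  have delta: "(\<lambda>k. 1 / real (Suc k)) \<longlonglongrightarrow> 0"
    using LIMSEQ_inverse_real_of_nat by (simp add: inverse_eq_divide)
  have m: "\<bar>m k\<bar> \<le> 1 / Suc k" for k using C[of k] by (simp add: m_def y_def)
  have "m \<longlonglongrightarrow> 0" by (rule Lim_null_comparison[OF _ delta]) (use m in auto)
  have "(\<lambda>k. (\<Sum>i<N k. (y k i)\<^sup>2) / real (N k) - s) \<longlonglongrightarrow> 0"
    by (rule Lim_null_comparison[OF _ delta]) (use C in \<open>auto simp: y_def\<close>)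
  then have sq: "(\<lambda>k. (\<Sum>i<N k. (y k i)\<^sup>2) / real (N k)) \<longlonglongrightarrow> s" by (rule LIM_zero_cancel)
  have msum: "(\<Sum>i<N k. y k i) = real (N k) * m k" for k using Npos by (simp add: m_def)
  have "(\<lambda>k. bl_dist (distr (measure_pmf (boot_indices (N k))) borel (\<lambda>J. \<Sum>j<N k. f k (J j))) (normal_law 0 s)) \<longlonglongrightarrow> 0"
  proof (rule boot_sum_bl_dist_tendsto_zero[where \<kappa> = "\<lambda>k. 2 * (1 / real (Suc k))"])
    show "filterlim N at_top sequentially"
      by (rule filterlim_at_top_mono[OF filterlim_ident]) (rule always_eventually, rule allI, rule Suc_leD[OF N])
    show "N k > 0" for k by (rule Npos)
    show "(\<Sum>i<N k. f k i) = 0" for k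
      by (simp add: f_def sum_divide_distrib[symmetric] sum_subtractf msum)
    have "(\<Sum>i<N k. (f k i)\<^sup>2) = (\<Sum>i<N k. (y k i)\<^sup>2) / real (N k) - (m k)\<^sup>2" for k
    proof -
      have "(\<Sum>i<N k. (f k i)\<^sup>2) = (\<Sum>i<N k. (y k i - m k)\<^sup>2) / real (N k)"
        by (simp add: f_def power_divide sum_divide_distrib)
      also have "(\<Sum>i<N k. (y k i - m k)\<^sup>2) = (\<Sum>i<N k. (y k i)\<^sup>2) + real (N k) * (m k)\<^sup>2 - 2 * m k * (\<Sum>i<N k. y k i)"
        by (simp add: power2_diff sum.distrib sum_subtractf sum_distrib_left algebra_simps)
      also have "\<dots> = (\<Sum>i<N k. (y k i)\<^sup>2) - real (N k) * (m k)\<^sup>2"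
        unfolding msum by (simp add: power2_eq_square)
      finally show ?thesis using Npos[of k] by (simp add: diff_divide_distrib)
    qed
    moreover have "(\<lambda>k. (\<Sum>i<N k. (y k i)\<^sup>2) / real (N k) - (m k)\<^sup>2) \<longlonglongrightarrow> s - 0\<^sup>2"
      by (intro tendsto_intros sq \<open>m \<longlonglongrightarrow> 0\<close>)
    ultimately show "(\<lambda>k. \<Sum>i<N k. (f k i)\<^sup>2) \<longlonglongrightarrow> s" by simp
    \<comment> \<open>One \<open>1 / Suc k\<close> comes from \<open>y k i\<close>, the other from
      the sample mean, since \<open>sqrt (N k) \<ge> 1\<close>.\<close>
    show "\<bar>f k i\<bar> \<le> 2 * (1 / real (Suc k))" if "i < N k" for k i
    proof -
      have s1: "1 \<le> sqrt (real (N k))" using Npos[of k] by simp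
      have "\<bar>y k i - m k\<bar> \<le> \<bar>y k i\<bar> + \<bar>m k\<bar>" by simp
      also have "\<dots> \<le> 1 / Suc k * sqrt (real (N k)) + 1 / Suc k * sqrt (real (N k))"
      proof (rule add_mono)
        show "\<bar>y k i\<bar> \<le> 1 / Suc k * sqrt (real (N k))" using C[of k] that by (simp add: y_def)
        have "1 / real (Suc k) * 1 \<le> 1 / Suc k * sqrt (real (N k))" using s1 by (intro mult_left_mono) auto
        then show "\<bar>m k\<bar> \<le> 1 / Suc k * sqrt (real (N k))" using m[of k] by linarith
      qed
      also have "\<dots> = 2 * (1 / Suc k) * sqrt (real (N k))" by simp
      finally show ?thesis unfolding f_def using Npos[of k] by (simp add: abs_divide pos_divide_le_eq)
    qed
    show "(\<lambda>k. 2 * (1 / real (Suc k))) \<longlonglongrightarrow> 0" using tendsto_mult_right_zero[OF delta] .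
  qed
  moreover have "?D (N k) (x k) (h k) = bl_dist (distr (measure_pmf (boot_indices (N k))) borel (\<lambda>J. \<Sum>j<N k. f k (J j))) (normal_law 0 s)" for k
  proof -
    have "boot_process (N k) (x k) J (h k) = (\<Sum>j<N k. f k (J j))" if "J \<in> set_pmf (boot_indices (N k))" for J
      by (subst boot_process_eq) (use boot_indices_lt[OF Npos that] in
        \<open>auto simp: f_def y_def m_def divide_inverse_commute sum_distrib_left\<close>)
    then have "map_pmf (\<lambda>J. boot_process (N k) (x k) J (h k)) (boot_indices (N k)) = map_pmf (\<lambda>J. \<Sum>j<N k. f k (J j)) (boot_indices (N k))"
      by (intro map_pmf_cong) auto
    then show ?thesis by (simp only: bl_dist_map_pmf)
  qed
  ultimately have "(\<lambda>k. ?D (N k) (x k) (h k)) \<longlonglongrightarrow> 0" by simp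
  then have "\<epsilon> \<le> 0" by (rule LIMSEQ_le_const) (use D less_imp_le in blast)
  with \<open>\<epsilon> > 0\<close> show False by simp
qed

section \<open>Laws of large numbers and the conditional limit theorem\<close>

context iid_sample
begin

lemma weak_law_square_integrable:
  assumes f: "f \<in> borel_measurable borel" "integrable P (\<lambda>x. (f x)\<^sup>2)" and "\<delta> > 0" "\<eta> > 0"
  shows "\<forall>\<^sub>F n in sequentially. \<exists>B\<in>events. prob B \<le> \<eta> \<and>
    (\<forall>\<omega>\<in>space M - B. \<bar>(\<Sum>i<n. f (X i \<omega>)) / real n - integral\<^sup>L P f\<bar> \<le> \<delta>)"
proof -
  define v where "v = (\<integral>x. (f x)\<^sup>2 \<partial>P)"
  have "\<forall>\<^sub>F n in sequentially. v / (\<delta>\<^sup>2 * \<eta>) < real n"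
    using filterlim_real_sequentially unfolding filterlim_at_top_dense by blast
  moreover have "\<forall>\<^sub>F n in sequentially. (0::nat) < n" by (rule eventually_gt_at_top)
  ultimately show ?thesis
  proof eventually_elim
    case (elim n)
    let ?B = "{\<omega>\<in>space M. \<delta> * sqrt (real n) < \<bar>emp n \<omega> f\<bar>}"
    note f(1)[measurable]
    have m[measurable]: "(\<lambda>\<omega>. emp n \<omega> f) \<in> borel_measurable M" unfolding emp_def by measurable
    have "prob ?B \<le> v / (\<delta> * sqrt (real n))\<^sup>2"
      using emp_second_moment[OF f] \<open>\<delta> > 0\<close> elim by (intro Chebyshev_second_moment m) (auto simp: v_def)
    also have "\<dots> \<le> \<eta>"
      using elim \<open>\<delta> > 0\<close> \<open>\<eta> > 0\<close> by (simp add: power_mult_distrib field_simps)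
    finally have "prob ?B \<le> \<eta>" .
    moreover have "\<bar>(\<Sum>i<n. f (X i \<omega>)) / real n - integral\<^sup>L P f\<bar> \<le> \<delta>" if "\<omega> \<in> space M - ?B" for \<omega>
    proof -
      have "sqrt (real n) * \<bar>(\<Sum>i<n. f (X i \<omega>)) / real n - integral\<^sup>L P f\<bar> \<le> sqrt (real n) * \<delta>"
        using that by (auto simp: emp_def abs_mult mult.commute)
      then show ?thesis using elim by simp
    qed
    moreover have "?B \<in> events" by measurable
    ultimately show ?case by blast
  qed
qed

lemma integral_truncation_tendsto:
  fixes f :: "real \<Rightarrow> real"
  assumes "f \<in> borel_measurable borel" "integrable P f" "\<And>x. f x \<ge> 0"
  shows "(\<lambda>k. \<integral>x. f x * indicator {x. real k < f x} x \<partial>P) \<longlonglongrightarrow> 0"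
proof -
  note assms(1)[measurable]
  have "(\<lambda>k. \<integral>x. f x * indicator {x. real k < f x} x \<partial>P) \<longlonglongrightarrow> (\<integral>x. 0 \<partial>P)"
  proof (rule integral_dominated_convergence[where w = f])
    show "AE x in P. (\<lambda>k. f x * indicator {x. real k < f x} x) \<longlonglongrightarrow> 0"
    proof (rule AE_I2)
      fix x
      have "\<forall>\<^sub>F k in sequentially. f x < real k"
        using filterlim_real_sequentially unfolding filterlim_at_top_dense by blast
      then have "\<forall>\<^sub>F k in sequentially. f x * indicator {x. real k < f x} x = 0"
        by (rule eventually_mono) auto
      then show "(\<lambda>k. f x * indicator {x. real k < f x} x) \<longlonglongrightarrow> 0" by (rule tendsto_eventually)
    qed
    show "AE x in P. norm (f x * indicator {x. real k < f x} x) \<le> f x" for k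
      using assms(3) by (auto simp: indicator_def)
  qed (use assms in \<open>auto simp: measurable_cong_sets[OF sets_P refl]\<close>)
  then show ?thesis by simp
qed

text \<open>Meant for \<open>(h x)\<^sup>2\<close>, which is merely integrable. The bounded part
  \<open>w\<close> obeys the square-integrable law; the tail \<open>u\<close> has small mean, so its
  average is small by Markov's inequality.\<close>

lemma weak_law_nonneg:
  assumes f: "f \<in> borel_measurable borel" "integrable P f" "\<And>x. f x \<ge> 0" and "\<delta> > 0" "\<eta> > 0"
  shows "\<forall>\<^sub>F n in sequentially. \<exists>B\<in>events. prob B \<le> \<eta> \<and>
    (\<forall>\<omega>\<in>space M - B. \<bar>(\<Sum>i<n. f (X i \<omega>)) / real n - integral\<^sup>L P f\<bar> \<le> \<delta>)"
proof -
  interpret P: prob_space P by (rule P_prob_space)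
  note f(1)[measurable]
  have fP[measurable]: "f \<in> borel_measurable P" by simp
  \<comment> \<open>The first entry keeps the bias, the mean of \<open>u\<close>, at most
    \<open>\<delta>/3\<close>; the second makes the Markov bound \<open>t / (\<delta>/3)\<close> at
    most \<open>\<eta>/2\<close>.\<close>
  define t where "t = min (\<delta>/3) (\<delta>/3 * (\<eta>/2))"
  have "t > 0" using \<open>\<delta> > 0\<close> \<open>\<eta> > 0\<close> by (simp add: t_def)
  obtain k :: nat where k: "(\<integral>x. f x * indicator {x. real k < f x} x \<partial>P) < t"
    using order_tendstoD(2)[OF integral_truncation_tendsto[OF f] \<open>t > 0\<close>] eventually_happens'[OF sequentially_bot] by blast
  define u where "u x = f x * indicator {x. real k < f x} x" for x
  define w where "w x = f x - u x" for x
  have u[measurable]: "u \<in> borel_measurable borel" unfolding u_def by measurable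
  have w[measurable]: "w \<in> borel_measurable borel" unfolding w_def by measurable
  have u0: "0 \<le> u x" for x using f(3) by (auto simp: u_def indicator_def)
  have wb: "\<bar>w x\<bar> \<le> real k" for x using f(3)[of x] by (auto simp: w_def u_def indicator_def)
  have ui: "integrable P u"
    by (rule Bochner_Integration.integrable_bound[OF f(2)]) (use f(3) in \<open>auto simp: u_def indicator_def\<close>)
  have wi: "integrable P w" unfolding w_def using f(2) ui by auto
  have "(w x)\<^sup>2 \<le> (real k)\<^sup>2" for x using wb[of x] abs_le_square_iff[of "w x" "real k"] by simp
  then have wi2: "integrable P (\<lambda>x. (w x)\<^sup>2)"
    by (intro P.integrable_const_bound[where B = "(real k)\<^sup>2"]) auto
  have Pf: "integral\<^sup>L P f = integral\<^sup>L P w + integral\<^sup>L P u" using Bochner_Integration.integral_diff[OF f(2) ui] unfolding w_def[abs_def] by simp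
  have Pu: "0 \<le> integral\<^sup>L P u" using u0 by simp
  have Put: "integral\<^sup>L P u \<le> t" using k unfolding u_def[abs_def] by (rule less_imp_le)
  have "\<forall>\<^sub>F n in sequentially. \<exists>B\<in>events. prob B \<le> \<eta>/2 \<and>
    (\<forall>\<omega>\<in>space M - B. \<bar>(\<Sum>i<n. w (X i \<omega>)) / real n - integral\<^sup>L P w\<bar> \<le> \<delta>/3)"
    using \<open>\<delta> > 0\<close> \<open>\<eta> > 0\<close> by (intro weak_law_square_integrable w wi2) auto
  then show ?thesis
  proof eventually_elim
    case (elim n)
    then obtain B where B: "B \<in> events" "prob B \<le> \<eta>/2"
      "\<And>\<omega>. \<omega> \<in> space M - B \<Longrightarrow> \<bar>(\<Sum>i<n. w (X i \<omega>)) / real n - integral\<^sup>L P w\<bar> \<le> \<delta>/3" by blast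
    let ?A = "{\<omega>\<in>space M. \<delta>/3 \<le> (\<Sum>i<n. u (X i \<omega>)) / real n}"
    have "\<delta>/3 > 0" using \<open>\<delta> > 0\<close> by simp
    note A = Markov_mean[OF u ui u0 this Put, of n]
    have "t / (\<delta>/3) \<le> \<eta>/2" using \<open>\<delta> > 0\<close> unfolding t_def by (subst pos_divide_le_eq) (auto simp: mult.commute)
    then have "prob (B \<union> ?A) \<le> \<eta>" using measure_Un_le[OF B(1) A(1)] A(2) B(2) by linarith
    moreover have "\<bar>(\<Sum>i<n. f (X i \<omega>)) / real n - integral\<^sup>L P f\<bar> \<le> \<delta>" if \<omega>: "\<omega> \<in> space M - (B \<union> ?A)" for \<omega>
    proof -
      have "(\<Sum>i<n. f (X i \<omega>)) / real n = (\<Sum>i<n. w (X i \<omega>)) / real n + (\<Sum>i<n. u (X i \<omega>)) / real n"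
        by (simp add: w_def sum_subtractf diff_divide_distrib)
      moreover have "\<bar>(\<Sum>i<n. w (X i \<omega>)) / real n - integral\<^sup>L P w\<bar> \<le> \<delta>/3" using B(3)[of \<omega>] \<omega> by blast
      moreover have "(\<Sum>i<n. u (X i \<omega>)) / real n < \<delta>/3" using \<omega> by (auto simp: not_le)
      moreover have "0 \<le> (\<Sum>i<n. u (X i \<omega>)) / real n" using u0 by (intro divide_nonneg_nonneg sum_nonneg) auto
      moreover have "t \<le> \<delta>/3" by (simp add: t_def)
      ultimately show ?thesis using Pf Pu Put by linarith
    qed
    moreover have "B \<union> ?A \<in> events" using B(1) A(1) by blast
    ultimately show ?case by blast
  qed
qed

text \<open>Once \<open>\<delta>\<^sup>2 * n\<close> passes the truncation level, a single
  exceedance puts more than \<open>\<delta>\<^sup>2 * n\<close> into the sum of the tail squares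
  \<open>u\<close>. By Markov's inequality their average reaches \<open>\<delta>\<^sup>2\<close>
  only with small probability.\<close>

lemma sample_max_small:
  assumes h: "h \<in> borel_measurable borel" "integrable P (\<lambda>x. (h x)\<^sup>2)" and "\<delta> > 0" "\<eta> > 0"
  shows "\<forall>\<^sub>F n in sequentially. \<exists>B\<in>events. prob B \<le> \<eta> \<and>
    (\<forall>\<omega>\<in>space M - B. \<forall>i<n. \<bar>h (X i \<omega>)\<bar> \<le> \<delta> * sqrt (real n))"
proof -
  note h(1)[measurable]
  have m2: "(\<lambda>x. (h x)\<^sup>2) \<in> borel_measurable borel" by measurable
  have "\<eta> * \<delta>\<^sup>2 > 0" using \<open>\<delta> > 0\<close> \<open>\<eta> > 0\<close> by simp
  from order_tendstoD(2)[OF integral_truncation_tendsto[OF m2 h(2) zero_le_power2] this]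
  have "\<exists>k. (\<integral>x. (h x)\<^sup>2 * indicator {x. real k < (h x)\<^sup>2} x \<partial>P) < \<eta> * \<delta>\<^sup>2"
    by (rule eventually_happens'[OF sequentially_bot])
  then obtain k :: nat where k: "(\<integral>x. (h x)\<^sup>2 * indicator {x. real k < (h x)\<^sup>2} x \<partial>P) < \<eta> * \<delta>\<^sup>2" ..
  define u where "u x = (h x)\<^sup>2 * indicator {x. real k < (h x)\<^sup>2} x" for x
  have u[measurable]: "u \<in> borel_measurable borel" unfolding u_def by measurable
  have u0: "0 \<le> u x" for x by (auto simp: u_def indicator_def)
  have ui: "integrable P u"
    by (rule Bochner_Integration.integrable_bound[OF h(2)]) (auto simp: u_def indicator_def)
  have "\<forall>\<^sub>F n in sequentially. real k / \<delta>\<^sup>2 < real n"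
    using filterlim_real_sequentially unfolding filterlim_at_top_dense by blast
  moreover have "\<forall>\<^sub>F n in sequentially. (0::nat) < n" by (rule eventually_gt_at_top)
  ultimately show ?thesis
  proof eventually_elim
    case (elim n)
    have kn: "real k \<le> \<delta>\<^sup>2 * real n" using elim \<open>\<delta> > 0\<close> by (simp add: field_simps)
    let ?B = "{\<omega>\<in>space M. \<delta>\<^sup>2 \<le> (\<Sum>i<n. u (X i \<omega>)) / real n}"
    have "\<delta>\<^sup>2 > 0" using \<open>\<delta> > 0\<close> by simp
    have "integral\<^sup>L P u \<le> \<eta> * \<delta>\<^sup>2" using k unfolding u_def[abs_def] by (rule less_imp_le)
    note B = Markov_mean[OF u ui u0 \<open>\<delta>\<^sup>2 > 0\<close> this, of n]
    have "prob ?B \<le> \<eta>" using B(2) \<open>\<delta> > 0\<close> by simp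
    moreover have "\<bar>h (X i \<omega>)\<bar> \<le> \<delta> * sqrt (real n)" if \<omega>: "\<omega> \<in> space M - ?B" and i: "i < n" for \<omega> i
    proof (rule ccontr)
      assume "\<not> ?thesis"
      then have "\<delta> * sqrt (real n) < \<bar>h (X i \<omega>)\<bar>" by simp
      then have "(\<delta> * sqrt (real n))\<^sup>2 < \<bar>h (X i \<omega>)\<bar>\<^sup>2"
        using \<open>\<delta> > 0\<close> by (intro power_strict_mono) auto
      then have gt: "\<delta>\<^sup>2 * real n < (h (X i \<omega>))\<^sup>2" by (simp add: power_mult_distrib)
      then have "\<delta>\<^sup>2 * real n < u (X i \<omega>)" using kn by (simp add: u_def)
      also have "\<dots> \<le> (\<Sum>i<n. u (X i \<omega>))" using i u0 by (intro member_le_sum) auto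
      finally have "\<delta>\<^sup>2 \<le> (\<Sum>i<n. u (X i \<omega>)) / real n" using elim by (simp add: field_simps)
      with \<omega> show False by auto
    qed
    ultimately show ?case using B(1) by blast
  qed
qed

text \<open>The sample mean, the sample second moment and the largest term meet the conditions of
  \<open>boot_process_bl_dist_small\<close> outside three events of probability at most
  \<open>\<eta>/3\<close> each.\<close>

theorem bootstrap_CLT:
  assumes h: "h \<in> borel_measurable borel" "integrable P (\<lambda>x. (h x)\<^sup>2)" "integral\<^sup>L P h = 0"
  shows "boot_weakly_converges M (\<lambda>n \<omega> J. boot_process n (\<lambda>i. X i \<omega>) J h) (normal_law 0 (\<integral>x. (h x)\<^sup>2 \<partial>P))"
  unfolding boot_weakly_converges_def tendsto_zero_in_prob_iff[OF finite_measure_axioms]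
proof (intro allI impI)
  fix \<epsilon> \<eta> :: real assume "\<epsilon> > 0" "\<eta> > 0"
  note h(1)[measurable]
  let ?s = "\<integral>x. (h x)\<^sup>2 \<partial>P"
  interpret N: real_distribution "normal_law 0 ?s" by (rule real_distribution_normal_law) simp
  let ?D = "\<lambda>n \<omega>. bl_dist (measure_pmf (map_pmf (\<lambda>J. boot_process n (\<lambda>i. X i \<omega>) J h) (boot_indices n))) (normal_law 0 ?s)"
  from boot_process_bl_dist_small[OF \<open>\<epsilon> > 0\<close>, of ?s]
  obtain \<delta> n0 where "\<delta> > 0" and D: "\<forall>n\<ge>n0. \<forall>x h. \<bar>(\<Sum>i<n. h (x i)) / real n\<bar> \<le> \<delta> \<longrightarrow> \<bar>(\<Sum>i<n. (h (x i))\<^sup>2) / real n - ?s\<bar> \<le> \<delta> \<longrightarrow>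
    (\<forall>i<n. \<bar>h (x i)\<bar> \<le> \<delta> * sqrt (real n)) \<longrightarrow>
    bl_dist (measure_pmf (map_pmf (\<lambda>J. boot_process n x J h) (boot_indices n))) (normal_law 0 ?s) \<le> \<epsilon>"
    by (elim exE conjE) (rule that)
  have "\<eta>/3 > 0" using \<open>\<eta> > 0\<close> by simp
  have m2: "(\<lambda>x. (h x)\<^sup>2) \<in> borel_measurable borel" by measurable
  from weak_law_square_integrable[OF h(1,2) \<open>\<delta> > 0\<close> \<open>\<eta>/3 > 0\<close>]
    weak_law_nonneg[OF m2 h(2) zero_le_power2 \<open>\<delta> > 0\<close> \<open>\<eta>/3 > 0\<close>]
    sample_max_small[OF h(1,2) \<open>\<delta> > 0\<close> \<open>\<eta>/3 > 0\<close>] eventually_ge_at_top[of n0]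
  show "\<forall>\<^sub>F n in sequentially. \<exists>B\<in>events. prob B \<le> \<eta> \<and> (\<forall>\<omega>\<in>space M - B. norm (?D n \<omega>) \<le> \<epsilon>)"
  proof eventually_elim
    case (elim n)
    obtain B1 where B1: "B1 \<in> events" "prob B1 \<le> \<eta>/3"
      "\<forall>\<omega>\<in>space M - B1. \<bar>(\<Sum>i<n. h (X i \<omega>)) / real n - integral\<^sup>L P h\<bar> \<le> \<delta>" using elim(1) by blast
    obtain B2 where B2: "B2 \<in> events" "prob B2 \<le> \<eta>/3"
      "\<forall>\<omega>\<in>space M - B2. \<bar>(\<Sum>i<n. (h (X i \<omega>))\<^sup>2) / real n - ?s\<bar> \<le> \<delta>" using elim(2) by blast
    obtain B3 where B3: "B3 \<in> events" "prob B3 \<le> \<eta>/3"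
      "\<forall>\<omega>\<in>space M - B3. \<forall>i<n. \<bar>h (X i \<omega>)\<bar> \<le> \<delta> * sqrt (real n)" using elim(3) by blast
    have "prob (B1 \<union> B2 \<union> B3) \<le> \<eta>"
      using measure_Un_le[OF sets.Un[OF B1(1) B2(1)] B3(1)] measure_Un_le[OF B1(1) B2(1)] B1(2) B2(2) B3(2) by linarith
    moreover have "norm (?D n \<omega>) \<le> \<epsilon>" if \<omega>: "\<omega> \<in> space M - (B1 \<union> B2 \<union> B3)" for \<omega>
    proof -
      have "\<bar>(\<Sum>i<n. h (X i \<omega>)) / real n\<bar> \<le> \<delta>" using B1(3) \<omega> h(3) by auto
      moreover have "\<bar>(\<Sum>i<n. (h (X i \<omega>))\<^sup>2) / real n - ?s\<bar> \<le> \<delta>" using B2(3) \<omega> by auto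
      moreover have "\<forall>i<n. \<bar>h (X i \<omega>)\<bar> \<le> \<delta> * sqrt (real n)" using B3(3) \<omega> by auto
      ultimately have "?D n \<omega> \<le> \<epsilon>"
        by (intro D[rule_format, OF elim(4)]) auto
      moreover have "0 \<le> ?D n \<omega>" by (rule bl_dist_nonneg[OF measure_pmf.prob_space_axioms N.prob_space_axioms])
      ultimately show ?thesis by simp
    qed
    moreover have "B1 \<union> B2 \<union> B3 \<in> events" using B1(1) B2(1) B3(1) by blast
    ultimately show ?case by blast
  qed
qed

end

text \<open>Where the two variables are \<open>\<epsilon>\<close>-close a test function changes by
  at most \<open>\<epsilon>\<close>, elsewhere by at most 2.\<close>

lemma bl_dist_map_pmf_le:
  fixes R S :: "'j \<Rightarrow> real"
  assumes L: "prob_space L" and \<epsilon>: "\<epsilon> > 0"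
  shows "bl_dist (measure_pmf (map_pmf R p)) L \<le> bl_dist (measure_pmf (map_pmf S p)) L + \<epsilon> +
    2 * measure_pmf.prob p {J. \<epsilon> < \<bar>R J - S J\<bar>}"
proof (rule bl_dist_least)
  fix f :: "real \<Rightarrow> real" assume f: "\<And>x. \<bar>f x\<bar> \<le> 1" "1-lipschitz_on UNIV f"
  have i: "integrable (measure_pmf p) (\<lambda>J. f (Q J))" for Q :: "'j \<Rightarrow> real"
    by (rule measure_pmf.integrable_const_bound[where B = 1]) (use f(1) in auto)
  have "\<bar>(\<integral>J. f (R J) \<partial>measure_pmf p) - (\<integral>J. f (S J) \<partial>measure_pmf p)\<bar> = \<bar>\<integral>J. f (R J) - f (S J) \<partial>measure_pmf p\<bar>"
    using i by simp
  also have "\<dots> \<le> (\<integral>J. \<bar>f (R J) - f (S J)\<bar> \<partial>measure_pmf p)" by (rule integral_abs_bound)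
  also have "\<dots> \<le> (\<integral>J. \<epsilon> + 2 * indicator {J. \<epsilon> < \<bar>R J - S J\<bar>} J \<partial>measure_pmf p)"
  proof (rule integral_mono)
    fix J
    show "\<bar>f (R J) - f (S J)\<bar> \<le> \<epsilon> + 2 * indicator {J. \<epsilon> < \<bar>R J - S J\<bar>} J"
      using f(1)[of "R J"] f(1)[of "S J"] lipschitz_onD[OF f(2), of "R J" "S J"] \<epsilon>
      by (auto simp: dist_real_def indicator_def)
  qed (use i in \<open>auto simp: measure_pmf.emeasure_eq_measure\<close>)
  also have "\<dots> = \<epsilon> + 2 * measure_pmf.prob p {J. \<epsilon> < \<bar>R J - S J\<bar>}"
    by (subst Bochner_Integration.integral_add) (auto simp: measure_pmf.emeasure_eq_measure)
  finally show "\<bar>integral\<^sup>L (measure_pmf (map_pmf R p)) f - integral\<^sup>L L f\<bar> \<le> bl_dist (measure_pmf (map_pmf S p)) L + \<epsilon> +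
    2 * measure_pmf.prob p {J. \<epsilon> < \<bar>R J - S J\<bar>}"
    using bl_dist_upper[OF measure_pmf.prob_space_axioms L f, of "map_pmf S p"] by simp
qed

lemma boot_Slutsky:
  assumes M: "finite_measure M" and L: "prob_space L"
    and S: "boot_weakly_converges M S L" and RS: "boot_tendsto_zero M (\<lambda>n \<omega> J. R n \<omega> J - S n \<omega> J)"
  shows "boot_weakly_converges M R L"
  unfolding boot_weakly_converges_def tendsto_zero_in_prob_iff[OF M]
proof (intro allI impI)
  fix \<epsilon> \<eta> :: real assume "\<epsilon> > 0" "\<eta> > 0"
  \<comment> \<open>The terms of \<open>bl_dist_map_pmf_le\<close> add up to \<open>\<epsilon>/4 +
    \<epsilon>/4 + 2 * (\<epsilon>/4) = \<epsilon>\<close>.\<close>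
  then have pos: "\<epsilon>/4 > 0" "\<eta>/2 > 0" by auto
  from S pos have "\<forall>\<^sub>F n in sequentially. \<exists>B\<in>sets M. measure M B \<le> \<eta>/2 \<and>
      (\<forall>\<omega>\<in>space M - B. norm (bl_dist (measure_pmf (map_pmf (S n \<omega>) (boot_indices n))) L) \<le> \<epsilon>/4)"
    unfolding boot_weakly_converges_def tendsto_zero_in_prob_iff[OF M] by blast
  moreover from RS pos have "\<forall>\<^sub>F n in sequentially. \<exists>B\<in>sets M. measure M B \<le> \<eta>/2 \<and>
      (\<forall>\<omega>\<in>space M - B. norm (measure_pmf.prob (boot_indices n) {J. \<epsilon>/4 < norm (R n \<omega> J - S n \<omega> J)}) \<le> \<epsilon>/4)"
    unfolding boot_tendsto_zero_def tendsto_zero_in_prob_iff[OF M] by blast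
  ultimately show "\<forall>\<^sub>F n in sequentially. \<exists>B\<in>sets M. measure M B \<le> \<eta> \<and>
      (\<forall>\<omega>\<in>space M - B. norm (bl_dist (measure_pmf (map_pmf (R n \<omega>) (boot_indices n))) L) \<le> \<epsilon>)"
  proof eventually_elim
    case (elim n)
    obtain B1 where B1: "B1 \<in> sets M" "measure M B1 \<le> \<eta>/2"
      "\<forall>\<omega>\<in>space M - B1. norm (bl_dist (measure_pmf (map_pmf (S n \<omega>) (boot_indices n))) L) \<le> \<epsilon>/4"
      using elim(1) by blast
    obtain B2 where B2: "B2 \<in> sets M" "measure M B2 \<le> \<eta>/2"
      "\<forall>\<omega>\<in>space M - B2. norm (measure_pmf.prob (boot_indices n) {J. \<epsilon>/4 < norm (R n \<omega> J - S n \<omega> J)}) \<le> \<epsilon>/4"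
      using elim(2) by blast
    have "measure M (B1 \<union> B2) \<le> \<eta>" using measure_Un_le[OF B1(1) B2(1)] B1(2) B2(2) by linarith
    moreover have "norm (bl_dist (measure_pmf (map_pmf (R n \<omega>) (boot_indices n))) L) \<le> \<epsilon>"
      if "\<omega> \<in> space M - (B1 \<union> B2)" for \<omega>
    proof -
      have "\<omega> \<in> space M - B1" "\<omega> \<in> space M - B2" using that by auto
      with B1(3) B2(3) have "norm (bl_dist (measure_pmf (map_pmf (S n \<omega>) (boot_indices n))) L) \<le> \<epsilon>/4"
        "norm (measure_pmf.prob (boot_indices n) {J. \<epsilon>/4 < norm (R n \<omega> J - S n \<omega> J)}) \<le> \<epsilon>/4" by blast+
      moreover note bl_dist_map_pmf_le[OF L pos(1), of "R n \<omega>" "boot_indices n" "S n \<omega>"]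
        bl_dist_nonneg[OF measure_pmf.prob_space_axioms L, of "map_pmf (R n \<omega>) (boot_indices n)"]
      ultimately show ?thesis by simp
    qed
    moreover have "B1 \<union> B2 \<in> sets M" using B1(1) B2(1) by blast
    ultimately show ?case by blast
  qed
qed

section \<open>The location-scale chart\<close>

text \<open>\<open>gradient\<close> is a definite description, so existence and uniqueness of the
  Riesz representative are both due: the values of \<open>f'\<close> on the basis supply it, and
  inner products determine it.\<close>

lemma gradient_inner:
  fixes f :: "'t::euclidean_space \<Rightarrow> real"
  assumes "(f has_derivative f') (at \<theta>)"
  shows "gradient f \<theta> \<bullet> h = f' h"
proof -
  have lin: "linear f'" using assms has_derivative_linear by blast
  define D where "D = (\<Sum>b\<in>Basis. f' b *\<^sub>R b)"
  have D: "h \<bullet> D = f' h" for h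
  proof -
    have "f' h = f' (\<Sum>b\<in>Basis. (h \<bullet> b) *\<^sub>R b)" by (simp add: euclidean_representation)
    also have "\<dots> = (\<Sum>b\<in>Basis. (h \<bullet> b) * f' b)" by (simp add: linear_sum[OF lin] linear_cmul[OF lin])
    finally show ?thesis by (simp add: D_def inner_sum_right mult.commute)
  qed
  have "GDERIV f \<theta> :> D" using assms D by (simp add: gderiv_def)
  moreover have "E = D" if "GDERIV f \<theta> :> E" for E
  proof -
    have "(\<lambda>h. h \<bullet> E) = f'" using has_derivative_unique assms that unfolding gderiv_def by blast
    then have "h \<bullet> E = h \<bullet> D" for h using D by metis
    then show ?thesis by (metis inner_commute vector_eq_ldot)
  qed
  ultimately have "gradient f \<theta> = D" unfolding gradient_def by (rule the_equality)
  then show ?thesis by (metis D inner_commute)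
qed

locale chart_generator =
  fixes G0 :: "real \<Rightarrow> real"
  assumes G0_cont: "continuous_on UNIV G0"
    and G0_strict_mono: "strict_mono G0"
    and G0_bij: "bij_betw G0 UNIV {0<..<1}"
begin

lemma G0_range: "0 < G0 z" "G0 z < 1"
  using G0_bij by (auto simp: bij_betw_def)

lemma G0_inv: "0 < c \<Longrightarrow> c < 1 \<Longrightarrow> G0 (inv G0 c) = c"
  using G0_bij by (intro f_inv_into_f) (auto simp: bij_betw_def)

lemma inv_G0: "inv G0 (G0 z) = z"
  using strict_mono_imp_inj_on[OF G0_strict_mono] by (rule inv_f_f)

lemma isCont_G0: "isCont G0 z"
  using G0_cont by (simp add: continuous_on_eq_continuous_at)

lemma chart_bounds: "0 < chart G0 \<theta> x" "chart G0 \<theta> x < 1"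
  by (simp_all add: chart_def G0_range)

lemma chart_measurable [measurable]: "chart G0 \<theta> \<in> borel_measurable borel"
proof -
  have "G0 \<in> borel_measurable borel" using G0_cont by (rule borel_measurable_continuous_onI)
  then show ?thesis unfolding chart_def[abs_def] by measurable
qed

text \<open>In a location-scale family the parameter leaves the inverse and only the fixed function
  \<open>inv G0\<close> remains. This is the origin of the closed form \<open>\<beta>\<close> of the
  estimator.\<close>

lemma inv_chart:
  assumes "\<theta> \<in> param_space" "0 < c" "c < 1"
  shows "inv (chart G0 \<theta>) c = fst \<theta> + snd \<theta> * inv G0 c"
proof (rule inv_f_eq)
  have "snd \<theta> > 0" using assms(1) by (simp add: param_space_def)
  then show "inj (chart G0 \<theta>)"
    using strict_mono_eq[OF G0_strict_mono] by (auto simp: inj_on_def chart_def)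
  show "chart G0 \<theta> (fst \<theta> + snd \<theta> * inv G0 c) = c"
    using \<open>snd \<theta> > 0\<close> assms(2,3) by (simp add: chart_def G0_inv)
qed

lemma inv_G0_DERIV:
  assumes "(G0 has_real_derivative D) (at z)" "D \<noteq> 0"
  shows "(inv G0 has_real_derivative inverse D) (at (G0 z))"
proof (rule DERIV_inverse_function[where f = G0 and a = 0 and b = 1])
  show "(G0 has_real_derivative D) (at (inv G0 (G0 z)))" using assms(1) by (simp add: inv_G0)
  show "isCont (inv G0) (G0 z)"
    by (rule isCont_inverse_function[where d = 1]) (auto simp: inv_G0 isCont_G0)
qed (use assms(2) G0_range G0_inv in auto)

text \<open>Strict bounds keep the empirical mean inside the range of the chart, outside of which
  the inverse is unspecified; with \<open>n = 0\<close> the mean would be 0.\<close>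

lemma mean_chart_bounds:
  assumes "n > 0"
  shows "0 < (\<Sum>i<n. chart G0 \<theta> (y i)) / real n" "(\<Sum>i<n. chart G0 \<theta> (y i)) / real n < 1"
proof -
  have "(\<Sum>i<n. chart G0 \<theta> (y i)) > 0"
    using assms chart_bounds by (intro sum_pos) (auto simp: lessThan_empty_iff)
  then show "0 < (\<Sum>i<n. chart G0 \<theta> (y i)) / real n" using assms by simp
  have "(\<Sum>i<n. chart G0 \<theta> (y i)) < (\<Sum>i<n. 1)"
    using assms chart_bounds by (intro sum_strict_mono) (auto simp: lessThan_empty_iff)
  then show "(\<Sum>i<n. chart G0 \<theta> (y i)) / real n < 1" using assms by simp
qed

text \<open>
  The estimator is \<open>\<mu> + \<sigma> G0\<inverse>(c)\<close> evaluated at the preliminary estimate and the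
  empirical chart mean, so it suffices to differentiate this map at the single point
  \<open>(\<theta>0, m \<theta>0)\<close>; the derivative of \<open>G0\<close> at one point gives that of its inverse.
\<close>

lemma center_map_has_derivative:
  assumes \<theta>0: "\<theta>0 \<in> param_space" and c: "0 < c" "c < 1"
    and d: "(chart G0 \<theta>0 has_real_derivative d) (at (fst \<theta>0 + snd \<theta>0 * inv G0 c))" "d > 0"
  shows "((\<lambda>p. fst (fst p) + snd (fst p) * inv G0 (snd p)) has_derivative
      (\<lambda>p. fst (fst p) + snd (fst p) * inv G0 c + snd p / d)) (at (\<theta>0, c))"
    and "((\<lambda>\<theta>. chart G0 \<theta> (fst \<theta>0 + snd \<theta>0 * inv G0 c)) has_derivative
      (\<lambda>h. - d * (fst h + snd h * inv G0 c))) (at \<theta>0)"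
proof -
  let ?z = "inv G0 c"
  have s: "snd \<theta>0 > 0" using \<theta>0 by (simp add: param_space_def)
  \<comment> \<open>Along this affine map the chart is \<open>G0\<close> itself, so the derivative
    of \<open>G0\<close> is \<open>d\<close> times the scale.\<close>
  have "((\<lambda>z. chart G0 \<theta>0 (fst \<theta>0 + snd \<theta>0 * z)) has_real_derivative d * snd \<theta>0) (at ?z)"
    by (rule DERIV_chain2[where f = "chart G0 \<theta>0" and g = "\<lambda>z. fst \<theta>0 + snd \<theta>0 * z", OF d(1)])
      (auto intro!: derivative_eq_intros)
  then have G0d: "(G0 has_real_derivative d * snd \<theta>0) (at ?z)"
    using s by (simp add: chart_def)
  have "(inv G0 has_real_derivative inverse (d * snd \<theta>0)) (at c)"
    using inv_G0_DERIV[OF G0d] s d(2) c by (simp add: G0_inv)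
  then have "(inv G0 has_derivative (\<lambda>h. inverse (d * snd \<theta>0) * h)) (at (snd (\<theta>0, c)))"
    by (simp add: has_field_derivative_def)
  from has_derivative_compose[OF has_derivative_snd[OF has_derivative_ident] this]
  have Q: "((\<lambda>p. inv G0 (snd p)) has_derivative (\<lambda>p. inverse (d * snd \<theta>0) * snd p)) (at (\<theta>0, c))" by simp
  show "((\<lambda>p. fst (fst p) + snd (fst p) * inv G0 (snd p)) has_derivative
      (\<lambda>p. fst (fst p) + snd (fst p) * inv G0 c + snd p / d)) (at (\<theta>0, c))"
    by (rule has_derivative_eq_rhs)
      (rule derivative_intros Q refl has_derivative_fst has_derivative_snd | use s in \<open>force simp: field_simps\<close>)+
  have "((\<lambda>\<theta>. (fst \<theta>0 + snd \<theta>0 * ?z - fst \<theta>) / snd \<theta>) has_derivative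
      (\<lambda>h. - (fst h + snd h * ?z) / snd \<theta>0)) (at \<theta>0)"
    using s by (auto intro!: derivative_eq_intros simp: field_simps)
  moreover have "(G0 has_derivative (\<lambda>h. d * snd \<theta>0 * h)) (at ((fst \<theta>0 + snd \<theta>0 * ?z - fst \<theta>0) / snd \<theta>0))"
    using G0d s by (simp add: has_field_derivative_def)
  ultimately have "((\<lambda>\<theta>. G0 ((fst \<theta>0 + snd \<theta>0 * ?z - fst \<theta>) / snd \<theta>)) has_derivative
      (\<lambda>h. d * snd \<theta>0 * (- (fst h + snd h * ?z) / snd \<theta>0))) (at \<theta>0)"
    by (rule has_derivative_compose)
  moreover have "(\<lambda>h. d * snd \<theta>0 * (- (fst h + snd h * ?z) / snd \<theta>0)) = (\<lambda>h. - d * (fst h + snd h * ?z))"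
    using s by (auto simp: fun_eq_iff field_simps)
  ultimately show "((\<lambda>\<theta>. chart G0 \<theta> (fst \<theta>0 + snd \<theta>0 * inv G0 c)) has_derivative
      (\<lambda>h. - d * (fst h + snd h * inv G0 c))) (at \<theta>0)"
    unfolding chart_def by simp
qed

end

section \<open>Processes indexed by the chart at random parameters\<close>

locale chart_sample = iid_sample M X P + chart_generator G0
  for M :: "'a measure" and X :: "nat \<Rightarrow> 'a \<Rightarrow> real" and P :: "real measure" and G0 :: "real \<Rightarrow> real"
begin

lemma chart_integrable: "integrable P (chart G0 \<theta>)" "integrable P (\<lambda>x. (chart G0 \<theta> x)\<^sup>2)"
proof -
  interpret P: prob_space P by (rule P_prob_space)
  have b: "\<bar>chart G0 \<theta> x\<bar> \<le> 1" for x using chart_bounds[of \<theta> x] by simp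
  then show "integrable P (chart G0 \<theta>)" by (intro P.integrable_const_bound[where B = 1]) auto
  have "(chart G0 \<theta> x)\<^sup>2 \<le> 1" for x using b[of x] by (simp add: abs_square_le_1)
  then show "integrable P (\<lambda>x. (chart G0 \<theta> x)\<^sup>2)" by (intro P.integrable_const_bound[where B = 1]) auto
qed

lemma chart_mean_bounds: "0 < chart_mean G0 P \<theta>" "chart_mean G0 P \<theta> < 1"
proof -
  interpret P: prob_space P by (rule P_prob_space)
  have "(\<integral>x. 0 \<partial>P) < chart_mean G0 P \<theta>" unfolding chart_mean_def
    by (rule P.integral_less_AE_space) (auto simp: chart_bounds chart_integrable P.emeasure_space_1[simplified])
  then show "0 < chart_mean G0 P \<theta>" by simp
  have "chart_mean G0 P \<theta> < (\<integral>x. 1 \<partial>P)" unfolding chart_mean_def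
    by (rule P.integral_less_AE_space) (auto simp: chart_bounds chart_integrable P.emeasure_space_1[simplified])
  then show "chart_mean G0 P \<theta> < 1" by (simp add: P.prob_space[simplified])
qed

text \<open>Dominated convergence applies, by continuity of \<open>G0\<close> and the bound 1. The
  lemma converts closeness of parameters into the \<open>L\<^sup>2\<close> closeness that the
  Donsker equicontinuity asks for.\<close>

lemma isCont_chart_L2:
  assumes "\<theta>0 \<in> param_space"
  shows "isCont (\<lambda>\<theta>. \<integral>x. (chart G0 \<theta> x - chart G0 \<theta>0 x)\<^sup>2 \<partial>P) \<theta>0"
proof (rule continuous_at_sequentiallyI)
  interpret P: prob_space P by (rule P_prob_space)
  fix u :: "nat \<Rightarrow> real \<times> real" assume u: "u \<longlonglongrightarrow> \<theta>0"
  show "(\<lambda>n. \<integral>x. (chart G0 (u n) x - chart G0 \<theta>0 x)\<^sup>2 \<partial>P) \<longlonglongrightarrow> (\<integral>x. (chart G0 \<theta>0 x - chart G0 \<theta>0 x)\<^sup>2 \<partial>P)"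
  proof (rule integral_dominated_convergence[where w = "\<lambda>_. 1"])
    show "AE x in P. (\<lambda>n. (chart G0 (u n) x - chart G0 \<theta>0 x)\<^sup>2) \<longlonglongrightarrow> (chart G0 \<theta>0 x - chart G0 \<theta>0 x)\<^sup>2"
    proof (rule AE_I2)
      fix x
      have "(\<lambda>n. (x - fst (u n)) / snd (u n)) \<longlonglongrightarrow> (x - fst \<theta>0) / snd \<theta>0"
        using assms by (intro tendsto_intros u) (auto simp: param_space_def)
      then have "(\<lambda>n. chart G0 (u n) x) \<longlonglongrightarrow> chart G0 \<theta>0 x"
        unfolding chart_def by (rule isCont_tendsto_compose[OF isCont_G0])
      then show "(\<lambda>n. (chart G0 (u n) x - chart G0 \<theta>0 x)\<^sup>2) \<longlonglongrightarrow> (chart G0 \<theta>0 x - chart G0 \<theta>0 x)\<^sup>2"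
        by (intro tendsto_intros)
    qed
    have "\<bar>chart G0 \<theta> x - chart G0 \<theta>' x\<bar> \<le> 1" for \<theta> \<theta>' x
      using chart_bounds[of \<theta> x] chart_bounds[of \<theta>' x] by linarith
    then show "AE x in P. norm ((chart G0 (u n) x - chart G0 \<theta>0 x)\<^sup>2) \<le> 1" for n
      by (simp add: abs_square_le_1)
  qed auto
qed

text \<open>The equicontinuity event depends on the data alone and serves the whole class at once.
  So \<open>Y\<close> may depend on \<open>J\<close>, and the lemma covers both the original and the
  bootstrap estimate.\<close>

lemma emp_chart_equicontinuous:
  assumes \<theta>0: "\<theta>0 \<in> param_space" and nbhd: "\<theta>0 \<in> interior \<Theta>0" and donsker: "donsker P (chart G0 ` \<Theta>0)"
    and Y: "(Y \<longlongrightarrow> \<theta>0) (boot_filter M)"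
  shows "((\<lambda>(n, \<omega>, J). emp n \<omega> (chart G0 (Y (n, \<omega>, J))) - emp n \<omega> (chart G0 \<theta>0)) \<longlongrightarrow> 0) (boot_filter M)"
  unfolding tendsto_iff dist_norm diff_zero
proof (intro allI impI)
  fix e :: real assume "e > 0"
  let ?D = "\<lambda>\<theta>. \<integral>x. (chart G0 \<theta> x - chart G0 \<theta>0 x)\<^sup>2 \<partial>P"
  show "\<forall>\<^sub>F z in boot_filter M. norm (case z of (n, \<omega>, J) \<Rightarrow> emp n \<omega> (chart G0 (Y (n, \<omega>, J))) - emp n \<omega> (chart G0 \<theta>0)) < e"
    unfolding eventually_boot_filter
  proof (intro allI impI)
    fix \<eta> :: real assume "\<eta> > 0"
    have \<theta>0': "\<theta>0 \<in> \<Theta>0" using nbhd interior_subset by blast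
    obtain \<delta> where "\<delta> > 0" and \<delta>: "\<forall>\<^sub>F n in sequentially. \<exists>B\<in>events. prob B \<le> \<eta>/2 \<and>
      (\<forall>\<omega>\<in>space M - B. \<forall>f\<in>chart G0 ` \<Theta>0. (\<integral>x. (f x - chart G0 \<theta>0 x)\<^sup>2 \<partial>P) < \<delta> \<longrightarrow> \<bar>emp n \<omega> f - emp n \<omega> (chart G0 \<theta>0)\<bar> \<le> 2 * (e/3))"
    proof -
      have "f \<in> borel_measurable borel" "integrable P (\<lambda>x. (f x)\<^sup>2)" if "f \<in> chart G0 ` \<Theta>0" for f
        using that chart_integrable(2) by auto
      moreover have "e/3 > 0" "\<eta>/2 > 0" using \<open>e > 0\<close> \<open>\<eta> > 0\<close> by auto
      ultimately show thesis
        using donsker_asymptotic_equicontinuity[OF donsker _ _ imageI[OF \<theta>0'], of "e/3" "\<eta>/2"] that by blast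
    qed
    have "((\<lambda>z. ?D (Y z)) \<longlongrightarrow> ?D \<theta>0) (boot_filter M)"
      by (rule isCont_tendsto_compose[OF isCont_chart_L2[OF \<theta>0] Y])
    then have "\<forall>\<^sub>F z in boot_filter M. ?D (Y z) < \<delta>"
      using \<open>\<delta> > 0\<close> by (intro order_tendstoD(2)[of _ "?D \<theta>0"]) auto
    moreover have "\<forall>\<^sub>F z in boot_filter M. Y z \<in> interior \<Theta>0"
      using topological_tendstoD[OF Y open_interior nbhd] .
    ultimately have "\<forall>\<^sub>F z in boot_filter M. Y z \<in> \<Theta>0 \<and> ?D (Y z) < \<delta>"
      by eventually_elim (use interior_subset in blast)
    then have "\<forall>\<^sub>F n in sequentially. boot_rare M n (\<eta>/2) (\<lambda>\<omega> J. \<not> (Y (n, \<omega>, J) \<in> \<Theta>0 \<and> ?D (Y (n, \<omega>, J)) < \<delta>))"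
      unfolding eventually_boot_filter using \<open>\<eta> > 0\<close> by simp
    with \<delta> show "\<forall>\<^sub>F n in sequentially. boot_rare M n \<eta>
        (\<lambda>\<omega> J. \<not> norm (case (n, \<omega>, J) of (n, \<omega>, J) \<Rightarrow> emp n \<omega> (chart G0 (Y (n, \<omega>, J))) - emp n \<omega> (chart G0 \<theta>0)) < e)"
    proof eventually_elim
      case (elim n)
      let ?bad = "\<lambda>\<omega>. \<not> (\<forall>f\<in>chart G0 ` \<Theta>0. (\<integral>x. (f x - chart G0 \<theta>0 x)\<^sup>2 \<partial>P) < \<delta> \<longrightarrow> \<bar>emp n \<omega> f - emp n \<omega> (chart G0 \<theta>0)\<bar> \<le> 2 * (e/3))"
      obtain B where B: "B \<in> events" "prob B \<le> \<eta>/2" "\<forall>\<omega>\<in>space M - B. \<not> ?bad \<omega>" using elim(1) by blast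
      have "boot_rare M n (\<eta>/2) (\<lambda>\<omega> J. ?bad \<omega>)"
        unfolding boot_rare_def
      proof (intro bexI[OF _ B(1)] conjI B(2) ballI)
        fix \<omega> assume "\<omega> \<in> space M - B"
        then have "{J :: nat \<Rightarrow> nat. ?bad \<omega>} = {}" using B(3) by blast
        then show "measure_pmf.prob (boot_indices n) {J. ?bad \<omega>} \<le> \<eta>/2" using \<open>\<eta> > 0\<close> by (simp only: measure_empty)
      qed
      from boot_rare_disj[OF this elim(2)] show ?case
      proof (rule boot_rare_mono)
        fix \<omega> J
        assume *: "\<not> norm (case (n, \<omega>, J) of (n, \<omega>, J) \<Rightarrow> emp n \<omega> (chart G0 (Y (n, \<omega>, J))) - emp n \<omega> (chart G0 \<theta>0)) < e"
        show "?bad \<omega> \<or> \<not> (Y (n, \<omega>, J) \<in> \<Theta>0 \<and> ?D (Y (n, \<omega>, J)) < \<delta>)"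
        proof (rule ccontr)
          assume "\<not> ?thesis"
          then have "\<bar>emp n \<omega> (chart G0 (Y (n, \<omega>, J))) - emp n \<omega> (chart G0 \<theta>0)\<bar> \<le> 2 * (e/3)" by blast
          with * \<open>e > 0\<close> show False by simp
        qed
      qed simp
    qed
  qed
qed

text \<open>The hypothesis concerns balls of deterministic radius. A radius shrinking more slowly
  than root-n contains the random parameter along the filter, by
  \<open>boot_bounded\<close>.\<close>

lemma boot_process_chart_equicontinuous:
  assumes \<theta>0: "\<theta>0 \<in> param_space" and equi: "boot_equicontinuous_at M X G0 \<theta>0"
    and Y: "boot_bounded M (\<lambda>z. sqrt (real (fst z)) *\<^sub>R (Y z - \<theta>0))"
  shows "((\<lambda>(n, \<omega>, J). boot_process n (\<lambda>i. X i \<omega>) J (\<lambda>x. chart G0 (Y (n, \<omega>, J)) x - chart G0 \<theta>0 x)) \<longlongrightarrow> 0) (boot_filter M)"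
proof -
  \<comment> \<open>The radius is \<open>n\<close> to the power -1/4. The maximum with 1 keeps the
    sequence decreasing at \<open>n = 0\<close>, where the quotient would be 0.\<close>
  define \<delta> where "\<delta> n = 1 / sqrt (sqrt (max 1 (real n)))" for n
  have \<delta>_lim: "\<delta> \<longlonglongrightarrow> 0"
  proof -
    have "filterlim (\<lambda>n. max 1 (real n)) at_top sequentially"
      by (rule filterlim_at_top_mono[OF filterlim_real_sequentially]) auto
    then have "filterlim (\<lambda>n. sqrt (sqrt (max 1 (real n)))) at_top sequentially"
      by (intro filterlim_compose[OF sqrt_at_top])
    then show ?thesis
      unfolding \<delta>_def using tendsto_inverse_0_at_top by (simp add: inverse_eq_divide[symmetric])
  qed
  have "decseq \<delta>"
    unfolding decseq_def \<delta>_def by (auto intro!: divide_left_mono simp: max_def)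
  let ?SUP = "\<lambda>(n, \<omega>, J). SUP \<theta> \<in> {\<theta> \<in> param_space. norm (\<theta> - \<theta>0) \<le> \<delta> n}.
            \<bar>boot_process n (\<lambda>i. X i \<omega>) J (\<lambda>x. chart G0 \<theta> x - chart G0 \<theta>0 x)\<bar>"
  have "(?SUP \<longlongrightarrow> 0) (boot_filter M)"
    using equi \<open>decseq \<delta>\<close> \<delta>_lim unfolding boot_equicontinuous_at_def boot_tendsto_zero_iff[OF finite_measure_axioms] by blast
  moreover have "\<forall>\<^sub>F z in boot_filter M. norm ((\<lambda>(n, \<omega>, J). boot_process n (\<lambda>i. X i \<omega>) J (\<lambda>x. chart G0 (Y (n, \<omega>, J)) x - chart G0 \<theta>0 x)) z) \<le> ?SUP z"
  proof -
    from boot_bounded_mult[OF Y tendsto_boot_filter_seq[OF \<delta>_lim]]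
    have "\<forall>\<^sub>F z in boot_filter M. norm (sqrt (real (fst z)) *\<^sub>R (Y z - \<theta>0)) * \<delta> (fst z) < 1"
      by (rule order_tendstoD) simp
    moreover have "\<forall>\<^sub>F z in boot_filter M. fst z \<ge> 1"
      using filterlim_fst_boot_filter eventually_ge_at_top unfolding filterlim_iff by blast
    moreover have "\<forall>\<^sub>F z in boot_filter M. Y z \<in> param_space"
    proof -
      have "open param_space" unfolding param_space_def by (intro open_Collect_less continuous_intros)
      from topological_tendstoD[OF tendsto_of_boot_bounded[OF Y] this \<theta>0] show ?thesis .
    qed
    ultimately show ?thesis
    proof eventually_elim
      case (elim z)
      obtain n \<omega> J where z: "z = (n, \<omega>, J)" by (cases z) auto
      have n: "n \<ge> 1" using elim(2) z by simp
      have "sqrt (real n) * \<delta> n = sqrt (sqrt (real n))"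
      proof -
        have "sqrt (real n) / sqrt (sqrt (real n)) = sqrt (sqrt (real n))" by (rule real_div_sqrt) simp
        then show ?thesis using n by (simp add: \<delta>_def max_def)
      qed
      then have "norm (Y z - \<theta>0) * sqrt (sqrt (real n)) < 1"
        using elim(1) z by (metis (no_types, lifting) abs_of_nonneg fst_conv mult.assoc mult.commute norm_scaleR of_nat_0_le_iff real_sqrt_ge_zero)
      then have le: "norm (Y z - \<theta>0) \<le> \<delta> n" using n by (simp add: \<delta>_def max_def pos_le_divide_eq less_imp_le)
      let ?S = "{\<theta> \<in> param_space. norm (\<theta> - \<theta>0) \<le> \<delta> n}"
      let ?f = "\<lambda>\<theta>. \<bar>boot_process n (\<lambda>i. X i \<omega>) J (\<lambda>x. chart G0 \<theta> x - chart G0 \<theta>0 x)\<bar>"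
      have "?f (Y z) \<le> (SUP \<theta>\<in>?S. ?f \<theta>)"
      proof (rule cSUP_upper)
        show "Y z \<in> ?S" using elim(3) le by simp
        \<comment> \<open>A real supremum dominates its members only over a bounded set; a crude
          bound depending on \<open>n\<close> and \<open>J\<close> suffices, because charts differ
          by at most 1.\<close>
        show "bdd_above (?f ` ?S)"
        proof (rule bdd_aboveI2)
          fix \<theta>
          have d: "\<bar>chart G0 \<theta> x - chart G0 \<theta>0 x\<bar> \<le> 1" for x
            using chart_bounds[of \<theta> x] chart_bounds[of \<theta>0 x] by linarith
          have "?f \<theta> = (1 / sqrt (real n)) * \<bar>\<Sum>i<n. (real (boot_count n J i) - 1) * (chart G0 \<theta> (X i \<omega>) - chart G0 \<theta>0 (X i \<omega>))\<bar>"
            by (simp add: boot_process_def abs_mult)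
          also have "\<dots> \<le> (1 / sqrt (real n)) * (\<Sum>i<n. \<bar>real (boot_count n J i) - 1\<bar> * 1)"
            using d by (intro mult_left_mono order_trans[OF sum_abs] sum_mono) (simp_all only: abs_mult, intro mult_left_mono d abs_ge_zero, simp)
          finally show "?f \<theta> \<le> (1 / sqrt (real n)) * (\<Sum>i<n. \<bar>real (boot_count n J i) - 1\<bar> * 1)" .
        qed
      qed
      then show ?case using z by simp
    qed
  qed
  ultimately show ?thesis by (rule Lim_null_comparison[rotated])
qed

end


section \<open>The bootstrap limit\<close>

theorem theorem5p11:
  fixes M :: "'a measure" and X :: "nat \<Rightarrow> 'a \<Rightarrow> real" and P :: "real measure"
    and G0 g0 :: "real \<Rightarrow> real"
    and T :: "nat \<Rightarrow> (nat \<Rightarrow> real) \<Rightarrow> real \<times> real"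
    and \<psi> :: "real \<Rightarrow> real \<times> real"
    and \<theta>0 :: "real \<times> real" and \<Theta>0 :: "(real \<times> real) set"
  assumes G0_cont: "continuous_on UNIV G0"
    and G0_strict_mono: "strict_mono G0"
    and G0_bij: "bij_betw G0 UNIV {0<..<1}"
    and g0_density: "g0 \<in> borel_measurable borel" "\<And>x. 0 \<le> g0 x"
      "\<And>x. G0 x = (LINT t:{..x}|lborel. g0 t)"
      "AE x in lborel. (G0 has_real_derivative g0 x) (at x)"
    and prob: "prob_space M"
    and indep: "prob_space.indep_vars M (\<lambda>_. borel) X UNIV"
    and ident: "\<And>i. distr M borel (X i) = P"
    and estimator: "\<And>n. T n \<in> borel_measurable (PiM {..<n} (\<lambda>_. borel))"
    and \<theta>0: "\<theta>0 \<in> param_space"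
    and consistent: "tendsto_zero_in_prob M (\<lambda>n \<omega>. estimate T n (\<lambda>i. X i \<omega>) - \<theta>0)"
    and asymp_linear: "tendsto_zero_in_prob M (\<lambda>n \<omega>.
          sqrt (real n) *\<^sub>R (estimate T n (\<lambda>i. X i \<omega>) - \<theta>0)
            - (1 / sqrt (real n)) *\<^sub>R (\<Sum>i<n. \<psi> (X i \<omega>)))"
    and \<psi>: "\<psi> \<in> borel_measurable borel" "integrable P (\<lambda>x. (norm (\<psi> x))\<^sup>2)"
      "(\<integral>x. \<psi> x \<partial>P) = 0"
    and nbhd: "\<theta>0 \<in> interior \<Theta>0" "\<Theta>0 \<subseteq> param_space"
    and donsker: "donsker P (chart G0 ` \<Theta>0)"
    and L2_diff: "L2_differentiable_at P (chart G0) \<theta>0"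
    and m_diff: "chart_mean G0 P differentiable (at \<theta>0)"
    and G_diff: "chart G0 \<theta>0 differentiable (at (chart_center G0 P \<theta>0))"
    and G_deriv_pos: "deriv (chart G0 \<theta>0) (chart_center G0 P \<theta>0) > 0"
    and boot_equicont: "boot_equicontinuous_at M X G0 \<theta>0"
    and boot_linear: "boot_tendsto_zero M (\<lambda>n \<omega> J.
          sqrt (real n) *\<^sub>R (estimate T n (resample (\<lambda>i. X i \<omega>) J) - estimate T n (\<lambda>i. X i \<omega>))
            - boot_process n (\<lambda>i. X i \<omega>) J \<psi>)"
  shows "boot_weakly_converges M
           (\<lambda>n \<omega> J. sqrt (real n) * (b_ad G0 T n (resample (\<lambda>i. X i \<omega>) J) - b_ad G0 T n (\<lambda>i. X i \<omega>)))
           (normal_law 0 (\<integral>x. (IF_ad G0 P \<psi> \<theta>0 x)\<^sup>2 \<partial>P))"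
proof -
  interpret chart_sample M X P G0
    by (intro chart_sample.intro iid_sample.intro iid_sample_axioms.intro chart_generator.intro)
      (fact prob, fact indep, fact ident, fact G0_cont, fact G0_strict_mono, fact G0_bij)
  let ?F = "boot_filter M"
  let ?s = "\<lambda>z::nat \<times> 'a \<times> (nat \<Rightarrow> nat). sqrt (real (fst z))"
  define m where "m = chart_mean G0 P"
  define c0 where "c0 = m \<theta>0"
  define q where "q = inv G0 c0"
  define b0 where "b0 = chart_center G0 P \<theta>0"
  define d where "d = deriv (chart G0 \<theta>0) b0"
  have c0: "0 < c0" "c0 < 1" using chart_mean_bounds by (simp_all add: c0_def m_def)
  have b0: "b0 = fst \<theta>0 + snd \<theta>0 * q"
    using inv_chart[OF \<theta>0 c0] by (simp add: b0_def chart_center_def q_def c0_def m_def)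
  have "d > 0" using G_deriv_pos by (simp add: d_def b0_def)
  have chart_deriv: "(chart G0 \<theta>0 has_real_derivative d) (at b0)"
    using G_diff unfolding d_def b0_def by (simp add: DERIV_deriv_iff_real_differentiable)
  obtain m' where m': "(m has_derivative m') (at \<theta>0)"
    using m_diff unfolding m_def differentiable_def by blast
  have m'_lin: "bounded_linear m'" using m' by (rule has_derivative_bounded_linear)

  define \<beta> where "\<beta> p = fst (fst p) + snd (fst p) * inv G0 (snd p)" for p :: "(real \<times> real) \<times> real"
  \<comment> \<open>The parameter part of the derivative of \<open>\<beta>\<close>. It is minus the
    \<open>\<theta>\<close>-derivative of the chart at \<open>b0\<close>, divided by
    \<open>d\<close>: the source of the subtracted gradient in \<open>\<Delta>\<close>.\<close>
  define B where "B h = fst h + snd h * q" for h :: "real \<times> real"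
  define \<beta>' where "\<beta>' p = B (fst p) + snd p / d" for p :: "(real \<times> real) \<times> real"
  have B_lin: "bounded_linear B"
    unfolding B_def by (intro bounded_linear_add bounded_linear_fst bounded_linear_mult_const bounded_linear_snd)
  have \<beta>': "(\<beta> has_derivative \<beta>') (at (\<theta>0, c0))"
    using center_map_has_derivative(1)[OF \<theta>0 c0 chart_deriv[unfolded b0 q_def] \<open>d > 0\<close>]
    unfolding \<beta>_def \<beta>'_def B_def q_def .
  \<comment> \<open>This is \<open>\<beta>'\<close> applied to the first-order terms:
    \<open>\<psi> x\<close> for the parameter,
    \<open>chart G0 \<theta>0 x - c0 + m' (\<psi> x)\<close> for the chart mean.\<close>
  define IF where "IF x = B (\<psi> x) + (chart G0 \<theta>0 x - c0 + m' (\<psi> x)) / d" for x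
  have IF_eq: "IF_ad G0 P \<psi> \<theta>0 x = IF x" for x
  proof -
    have "gradient m \<theta>0 \<bullet> \<psi> x = m' (\<psi> x)" by (rule gradient_inner[OF m'])
    moreover have "gradient (\<lambda>\<theta>. chart G0 \<theta> b0) \<theta>0 \<bullet> \<psi> x = - d * B (\<psi> x)"
      unfolding B_def b0 q_def
      by (rule gradient_inner[OF center_map_has_derivative(2)[OF \<theta>0 c0 chart_deriv[unfolded b0 q_def] \<open>d > 0\<close>]])
    ultimately show ?thesis
      unfolding IF_ad_def Let_def b0_def[symmetric] m_def[symmetric] c0_def[symmetric] d_def[symmetric] IF_def
      using \<open>d > 0\<close> by (simp add: inner_diff_left field_simps)
  qed

  have \<psi>P: "\<psi> \<in> borel_measurable P" using \<psi>(1) by (simp add: measurable_cong_sets[OF sets_P refl])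
  have coord: "(\<lambda>x. f (\<psi> x)) \<in> borel_measurable borel" "integrable P (\<lambda>x. (f (\<psi> x))\<^sup>2)" "(\<integral>x. f (\<psi> x) \<partial>P) = 0"
    if f: "bounded_linear f" for f :: "real \<times> real \<Rightarrow> real"
  proof -
    interpret P: prob_space P by (rule P_prob_space)
    have "f \<in> borel_measurable borel"
      by (intro borel_measurable_continuous_onI linear_continuous_on f)
    from measurable_compose[OF \<psi>(1) this] show fm: "(\<lambda>x. f (\<psi> x)) \<in> borel_measurable borel" .
    have "integrable P (\<lambda>x. norm (\<psi> x))"
      using P.square_integrable_imp_integrable[OF _ \<psi>(2)] \<psi>P by simp
    then have i: "integrable P \<psi>" using \<psi>P by (simp add: integrable_norm_iff)
    from integral_bounded_linear[OF f i] show "(\<integral>x. f (\<psi> x) \<partial>P) = 0"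
      using \<psi>(3) linear_0[OF bounded_linear.linear[OF f]] by simp
    obtain K where K: "\<And>x. norm (f x) \<le> norm x * K" using bounded_linear.bounded[OF f] by blast
    show "integrable P (\<lambda>x. (f (\<psi> x))\<^sup>2)"
    proof (rule Bochner_Integration.integrable_bound)
      show "integrable P (\<lambda>x. K\<^sup>2 * (norm (\<psi> x))\<^sup>2)" using \<psi>(2) by simp
      show "(\<lambda>x. (f (\<psi> x))\<^sup>2) \<in> borel_measurable P" using fm by (simp add: measurable_cong_sets[OF sets_P refl])
      have "(f (\<psi> x))\<^sup>2 \<le> K\<^sup>2 * (norm (\<psi> x))\<^sup>2" for x
        using power_mono[OF K[of "\<psi> x"] norm_ge_zero, of 2] by (simp add: power_mult_distrib mult.commute)
      then show "AE x in P. norm ((f (\<psi> x))\<^sup>2) \<le> norm (K\<^sup>2 * (norm (\<psi> x))\<^sup>2)" by simp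
    qed
  qed
  define A where "A h = B h + m' h / d" for h
  have A_lin: "bounded_linear A"
    unfolding A_def
    using bounded_linear_add[OF B_lin bounded_linear_compose[OF bounded_linear_divide m'_lin]] by simp
  have IF_alt: "IF x = A (\<psi> x) + (chart G0 \<theta>0 x - c0) / d" for x
    by (simp add: IF_def A_def add_divide_distrib)
  have IF: "IF \<in> borel_measurable borel" "integrable P (\<lambda>x. (IF x)\<^sup>2)" "integral\<^sup>L P IF = 0"
  proof -
    interpret P: prob_space P by (rule P_prob_space)
    note A = coord[OF A_lin]
    note A(1)[measurable]
    show IFm[measurable]: "IF \<in> borel_measurable borel" unfolding IF_alt by measurable
    have Ai: "integrable P (\<lambda>x. A (\<psi> x))"
      using P.square_integrable_imp_integrable[OF _ A(2)] A(1) by (simp add: measurable_cong_sets[OF sets_P refl])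
    define g where "g x = (chart G0 \<theta>0 x - c0) / d" for x
    have g[measurable]: "g \<in> borel_measurable borel" unfolding g_def by measurable
    have gb: "\<bar>g x\<bar> \<le> 1 / d" for x
      using chart_bounds[of \<theta>0 x] c0 \<open>d > 0\<close> by (simp add: g_def abs_divide divide_right_mono abs_le_iff)
    have gi: "integrable P g" by (rule P.integrable_const_bound[where B = "1 / d"]) (use gb in auto)
    have g2: "(g x)\<^sup>2 \<le> (1 / d)\<^sup>2" for x
      using gb[of x] \<open>d > 0\<close> abs_le_square_iff[of "g x" "1 / d"] by simp
    show "integral\<^sup>L P IF = 0"
    proof -
      have "integral\<^sup>L P g = (integral\<^sup>L P (chart G0 \<theta>0) - c0) / d"
        unfolding g_def using chart_integrable(1) by (simp add: P.prob_space[simplified])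
      then have "integral\<^sup>L P g = 0" by (simp add: c0_def m_def chart_mean_def)
      then show ?thesis unfolding IF_alt g_def[symmetric] using Ai gi A(3) by simp
    qed
    show "integrable P (\<lambda>x. (IF x)\<^sup>2)"
    proof (rule Bochner_Integration.integrable_bound)
      show "integrable P (\<lambda>x. 2 * (A (\<psi> x))\<^sup>2 + 2 * (1 / d)\<^sup>2)" using A(2) by simp
      have "(IF x)\<^sup>2 \<le> 2 * (A (\<psi> x))\<^sup>2 + 2 * (1 / d)\<^sup>2" for x
        using sum_squares_bound[of "A (\<psi> x)" "g x"] g2[of x]
        unfolding IF_alt g_def[symmetric] by (simp add: power2_sum)
      then show "AE x in P. norm ((IF x)\<^sup>2) \<le> norm (2 * (A (\<psi> x))\<^sup>2 + 2 * (1 / d)\<^sup>2)" by simp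
    qed measurable
  qed

  \<comment> \<open>A trailing \<open>s\<close> marks bootstrap quantities; \<open>U\<close> and
    \<open>W\<close> are the root-n errors of the parameter and of the chart mean.\<close>
  define Th where "Th = (\<lambda>(n, \<omega>, J :: nat \<Rightarrow> nat). estimate T n (\<lambda>i. X i \<omega>))"
  define Ths where "Ths = (\<lambda>(n, \<omega>, J). estimate T n (resample (\<lambda>i. X i \<omega>) J))"
  define a where "a = (\<lambda>(n, \<omega>, J). (\<Sum>i<n. chart G0 (Th (n, \<omega>, J)) (X i \<omega>)) / real n)"
  define as where "as = (\<lambda>(n, \<omega>, J). (\<Sum>i<n. chart G0 (Ths (n, \<omega>, J)) (X (J i) \<omega>)) / real n)"
  define Psi where "Psi = (\<lambda>(n, \<omega>, J). boot_process n (\<lambda>i. X i \<omega>) J \<psi>)"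
  define Gn where "Gn = (\<lambda>(n, \<omega>, J :: nat \<Rightarrow> nat). emp n \<omega> (chart G0 \<theta>0))"
  define Gs where "Gs = (\<lambda>(n, \<omega>, J). boot_process n (\<lambda>i. X i \<omega>) J (chart G0 \<theta>0))"
  define U where "U z = ?s z *\<^sub>R (Th z - \<theta>0)" for z
  define Us where "Us z = ?s z *\<^sub>R (Ths z - \<theta>0)" for z
  define W where "W z = ?s z * (a z - c0)" for z
  define Ws where "Ws z = ?s z * (as z - c0)" for z

  have good: "\<forall>\<^sub>F z in ?F. 0 < fst z \<and> (\<forall>j<fst z. snd (snd z) j < fst z)"
  proof (rule eventually_boot_filterI)
    show "\<forall>\<^sub>F n in sequentially. \<forall>\<omega>\<in>space M. \<forall>J\<in>set_pmf (boot_indices n).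
      0 < fst (n, \<omega>, J) \<and> (\<forall>j<fst (n, \<omega>, J). snd (snd (n, \<omega>, J)) j < fst (n, \<omega>, J))"
      using eventually_gt_at_top[of 0] by (rule eventually_mono) (auto dest: boot_indices_lt)
  qed

  have U_bdd: "boot_bounded M U"
  proof (rule boot_bounded_cong_tendsto)
    define S where "S = (\<lambda>(n, \<omega>, J :: nat \<Rightarrow> nat). (1 / sqrt (real n)) *\<^sub>R (\<Sum>i<n. \<psi> (X i \<omega>)))"
    from tendsto_zero_in_prob_imp_boot_filter[OF finite_measure_axioms asymp_linear]
    show "((\<lambda>z. U z - S z) \<longlongrightarrow> 0) ?F"
      unfolding U_def S_def Th_def by (simp add: case_prod_unfold)
    \<comment> \<open>Since \<open>\<psi>\<close> has mean 0, the coordinates are empirical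
      processes, and a pair is bounded if its coordinates are.\<close>
    have "S = (\<lambda>z. ((\<lambda>(n, \<omega>, J :: nat \<Rightarrow> nat). emp n \<omega> (\<lambda>x. fst (\<psi> x))) z, (\<lambda>(n, \<omega>, J :: nat \<Rightarrow> nat). emp n \<omega> (\<lambda>x. snd (\<psi> x))) z))"
      using coord(3)[OF bounded_linear_fst] coord(3)[OF bounded_linear_snd]
      by (auto simp: S_def emp_eq fun_eq_iff prod_eq_iff fst_sum snd_sum)
    then show "boot_bounded M S"
      using boot_bounded_Pair[OF boot_bounded_emp[OF coord(1,2)[OF bounded_linear_fst]] boot_bounded_emp[OF coord(1,2)[OF bounded_linear_snd]]]
      by simp
  qed
  have Psi_bdd: "boot_bounded M Psi"
  proof -
    have "Psi = (\<lambda>z. ((\<lambda>(n, \<omega>, J). boot_process n (\<lambda>i. X i \<omega>) J (\<lambda>x. fst (\<psi> x))) z,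
        (\<lambda>(n, \<omega>, J). boot_process n (\<lambda>i. X i \<omega>) J (\<lambda>x. snd (\<psi> x))) z))"
      by (auto simp: Psi_def fun_eq_iff prod_eq_iff boot_process_linear[OF linear_fst] boot_process_linear[OF linear_snd])
    then show ?thesis
      using boot_bounded_Pair[OF boot_bounded_boot_process[OF coord(1,2)[OF bounded_linear_fst]]
          boot_bounded_boot_process[OF coord(1,2)[OF bounded_linear_snd]]] by simp
  qed
  \<comment> \<open>\<open>Us - U\<close> is the scaled difference of the two estimates. The
    hypothesis makes it \<open>Psi\<close> up to a null term, through which \<open>Us\<close>
    inherits boundedness.\<close>
  have V: "((\<lambda>z. Us z - U z - Psi z) \<longlongrightarrow> 0) ?F"
    using boot_linear unfolding boot_tendsto_zero_iff[OF finite_measure_axioms] Us_def U_def Psi_def Th_def Ths_def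
    by (simp add: case_prod_unfold scaleR_diff_right)
  have Us_bdd: "boot_bounded M Us"
  proof (rule boot_bounded_cong_tendsto)
    show "((\<lambda>z. Us z - (U z + Psi z)) \<longlongrightarrow> 0) ?F" using V by (simp add: diff_diff_eq)
    show "boot_bounded M (\<lambda>z. U z + Psi z)" by (rule boot_bounded_add[OF U_bdd Psi_bdd])
  qed
  have Th_lim: "(Th \<longlongrightarrow> \<theta>0) ?F" using tendsto_of_boot_bounded[OF U_bdd[unfolded U_def]] .
  have Ths_lim: "(Ths \<longlongrightarrow> \<theta>0) ?F" using tendsto_of_boot_bounded[OF Us_bdd[unfolded Us_def]] .

  define E1 where "E1 = (\<lambda>(n, \<omega>, J). emp n \<omega> (chart G0 (Th (n, \<omega>, J))) - emp n \<omega> (chart G0 \<theta>0))"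
  define E2 where "E2 = (\<lambda>(n, \<omega>, J). emp n \<omega> (chart G0 (Ths (n, \<omega>, J))) - emp n \<omega> (chart G0 \<theta>0))"
  define E3 where "E3 = (\<lambda>(n, \<omega>, J). boot_process n (\<lambda>i. X i \<omega>) J (\<lambda>x. chart G0 (Ths (n, \<omega>, J)) x - chart G0 \<theta>0 x))"
  define E4 where "E4 z = ?s z *\<^sub>R (m (Th z) - m \<theta>0) - m' (U z)" for z
  define E5 where "E5 z = ?s z *\<^sub>R (m (Ths z) - m \<theta>0) - m' (Us z)" for z
  have E1: "(E1 \<longlongrightarrow> 0) ?F" unfolding E1_def by (rule emp_chart_equicontinuous[OF \<theta>0 nbhd(1) donsker Th_lim])
  have E2: "(E2 \<longlongrightarrow> 0) ?F" unfolding E2_def by (rule emp_chart_equicontinuous[OF \<theta>0 nbhd(1) donsker Ths_lim])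
  have E3: "(E3 \<longlongrightarrow> 0) ?F"
    unfolding E3_def by (rule boot_process_chart_equicontinuous[OF \<theta>0 boot_equicont Us_bdd[unfolded Us_def]])
  have E4: "(E4 \<longlongrightarrow> 0) ?F" unfolding E4_def U_def by (rule boot_delta_method[OF U_bdd[unfolded U_def] m'])
  have E5: "(E5 \<longlongrightarrow> 0) ?F" unfolding E5_def Us_def by (rule boot_delta_method[OF Us_bdd[unfolded Us_def] m'])

  have emp_chart: "emp n \<omega> (chart G0 \<theta>) = sqrt (real n) * ((\<Sum>i<n. chart G0 \<theta> (X i \<omega>)) / real n - m \<theta>)" for n \<omega> \<theta>
    by (simp add: emp_def m_def chart_mean_def)
  \<comment> \<open>An exact split: the fluctuation at \<open>\<theta>0\<close>, its change
    \<open>E1\<close> when the parameter is estimated, and the drift of \<open>m\<close>, linearised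
    with error \<open>E4\<close>.\<close>
  have W_eq: "W z = Gn z + m' (U z) + (E1 z + E4 z)" for z
    by (cases z) (simp add: W_def Gn_def E1_def E4_def a_def emp_chart c0_def algebra_simps)
  \<comment> \<open>The bootstrap chart mean is centred at the sample mean, that at
    \<open>m (Ths z)\<close>, and that at \<open>m \<theta>0\<close>. The side conditions hold along
    the filter by \<open>good\<close>.\<close>
  have Ws_eq: "Ws z = Gs z + Gn z + m' (Us z) + (E2 z + E3 z + E5 z)" if "0 < fst z" "\<forall>j<fst z. snd (snd z) j < fst z" for z
  proof -
    obtain n \<omega> J where z: "z = (n, \<omega>, J)" by (cases z) auto
    have J: "n > 0" "\<And>j. j < n \<Longrightarrow> J j < n" using that z by auto
    let ?f = "chart G0 (Ths z)"
    have "boot_process n (\<lambda>i. X i \<omega>) J ?f = (1 / sqrt (real n)) * ((\<Sum>j<n. ?f (X (J j) \<omega>)) - (\<Sum>i<n. ?f (X i \<omega>)))"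
      using J by (subst boot_process_eq) (auto simp: sum_subtractf)
    also have "1 / sqrt (real n) = sqrt (real n) / real n"
      using sqrt_divide_self_eq[of "real n"] by (simp add: inverse_eq_divide)
    finally have "boot_process n (\<lambda>i. X i \<omega>) J ?f = sqrt (real n) * (as z - (\<Sum>i<n. ?f (X i \<omega>)) / real n)"
      by (simp add: as_def z diff_divide_distrib[symmetric])
    then have "Ws z = boot_process n (\<lambda>i. X i \<omega>) J ?f + emp n \<omega> ?f + sqrt (real n) * (m (Ths z) - m \<theta>0)"
      by (simp add: Ws_def z emp_chart c0_def algebra_simps)
    then show ?thesis
      by (simp add: z Gn_def Gs_def E2_def E3_def E5_def boot_process_diff)
  qed
  have Gn_bdd: "boot_bounded M Gn" unfolding Gn_def by (rule boot_bounded_emp[OF chart_measurable chart_integrable(2)])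
  have Gs_bdd: "boot_bounded M Gs" unfolding Gs_def by (rule boot_bounded_boot_process[OF chart_measurable chart_integrable(2)])
  have W_bdd: "boot_bounded M W"
    unfolding W_eq
    by (intro boot_bounded_add Gn_bdd boot_bounded_linear[OF U_bdd m'_lin] boot_bounded_tendsto_zero tendsto_add_zero E1 E4)
  have Ws_rem: "((\<lambda>z. Ws z - (Gs z + Gn z + m' (Us z))) \<longlongrightarrow> 0) ?F"
  proof (rule Lim_transform_eventually)
    show "((\<lambda>z. E2 z + E3 z + E5 z) \<longlongrightarrow> 0) ?F" by (intro tendsto_add_zero E2 E3 E5)
    show "\<forall>\<^sub>F z in ?F. E2 z + E3 z + E5 z = Ws z - (Gs z + Gn z + m' (Us z))"
      using good by eventually_elim (simp add: Ws_eq)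
  qed
  have Ws_bdd: "boot_bounded M Ws"
    by (rule boot_bounded_cong_tendsto[OF Ws_rem])
      (intro boot_bounded_add Gs_bdd Gn_bdd boot_bounded_linear[OF Us_bdd m'_lin])

  define R1 where "R1 z = ?s z *\<^sub>R (\<beta> (Th z, a z) - \<beta> (\<theta>0, c0)) - \<beta>' (U z, W z)" for z
  define R2 where "R2 z = ?s z *\<^sub>R (\<beta> (Ths z, as z) - \<beta> (\<theta>0, c0)) - \<beta>' (Us z, Ws z)" for z
  have R1: "(R1 \<longlongrightarrow> 0) ?F"
  proof -
    have e: "?s z *\<^sub>R ((Th z, a z) - (\<theta>0, c0)) = (U z, W z)" for z by (simp add: U_def W_def)
    have "boot_bounded M (\<lambda>z. ?s z *\<^sub>R ((Th z, a z) - (\<theta>0, c0)))"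
      unfolding e by (rule boot_bounded_Pair[OF U_bdd W_bdd])
    from boot_delta_method[OF this \<beta>'] show ?thesis unfolding e R1_def .
  qed
  have R2: "(R2 \<longlongrightarrow> 0) ?F"
  proof -
    have e: "?s z *\<^sub>R ((Ths z, as z) - (\<theta>0, c0)) = (Us z, Ws z)" for z by (simp add: Us_def Ws_def)
    have "boot_bounded M (\<lambda>z. ?s z *\<^sub>R ((Ths z, as z) - (\<theta>0, c0)))"
      unfolding e by (rule boot_bounded_Pair[OF Us_bdd Ws_bdd])
    from boot_delta_method[OF this \<beta>'] show ?thesis unfolding e R2_def .
  qed

  let ?R = "\<lambda>n \<omega> J. sqrt (real n) * (b_ad G0 T n (resample (\<lambda>i. X i \<omega>) J) - b_ad G0 T n (\<lambda>i. X i \<omega>))"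
  let ?S = "\<lambda>n \<omega> J. boot_process n (\<lambda>i. X i \<omega>) J IF"
  have "((\<lambda>(n, \<omega>, J). ?R n \<omega> J - ?S n \<omega> J) \<longlongrightarrow> 0) ?F"
  proof (rule Lim_transform_eventually)
    \<comment> \<open>Each group is a remainder known to vanish, and together they are an exact
      rewriting of the target: \<open>Gn\<close> occurs in the expansions of \<open>W\<close> and of
      \<open>Ws\<close> and cancels, while \<open>V\<close> replaces the parameter difference by
      \<open>Psi\<close>.\<close>
    have "((\<lambda>z. R2 z - R1 z + B (Us z - U z - Psi z) +
        ((Ws z - (Gs z + Gn z + m' (Us z))) - (E1 z + E4 z) + m' (Us z - U z - Psi z)) / d)
      \<longlongrightarrow> 0 - 0 + B 0 + (0 - (0 + 0) + m' 0) / d) ?F"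
      using \<open>d > 0\<close>
      by (intro tendsto_add tendsto_diff tendsto_divide tendsto_const R1 R2 E1 E4 Ws_rem
          bounded_linear.tendsto[OF B_lin V] bounded_linear.tendsto[OF m'_lin V]) auto
    then show "((\<lambda>z. R2 z - R1 z + B (Us z - U z - Psi z) +
        ((Ws z - (Gs z + Gn z + m' (Us z))) - (E1 z + E4 z) + m' (Us z - U z - Psi z)) / d) \<longlongrightarrow> 0) ?F"
      using linear_0[OF bounded_linear.linear[OF B_lin]] linear_0[OF bounded_linear.linear[OF m'_lin]] by simp
    \<comment> \<open>The closed form of the inverse requires a positive scale, which both estimates
      have along the filter by consistency.\<close>
    have "open param_space" unfolding param_space_def by (intro open_Collect_less continuous_intros)
    from topological_tendstoD[OF Th_lim this \<theta>0] topological_tendstoD[OF Ths_lim this \<theta>0] good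
    show "\<forall>\<^sub>F z in ?F. R2 z - R1 z + B (Us z - U z - Psi z) +
        ((Ws z - (Gs z + Gn z + m' (Us z))) - (E1 z + E4 z) + m' (Us z - U z - Psi z)) / d =
      (case z of (n, \<omega>, J) \<Rightarrow> ?R n \<omega> J - ?S n \<omega> J)"
    proof eventually_elim
      case (elim z)
      obtain n \<omega> J where z: "z = (n, \<omega>, J)" by (cases z) auto
      have J: "n > 0" "\<And>j. j < n \<Longrightarrow> J j < n" using elim(3) z by auto
      have b: "b_ad G0 T n (\<lambda>i. X i \<omega>) = \<beta> (Th z, a z)"
        unfolding b_ad_def \<beta>_def using elim(1) inv_chart[OF _ mean_chart_bounds[OF J(1)]]
        by (simp add: z Th_def a_def)
      have bs: "b_ad G0 T n (resample (\<lambda>i. X i \<omega>) J) = \<beta> (Ths z, as z)"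
        unfolding b_ad_def \<beta>_def using elim(2) inv_chart[OF _ mean_chart_bounds[OF J(1)]]
        by (simp add: z Ths_def as_def resample_def)
      \<comment> \<open>The bootstrap process annihilates constants, so the centring at
        \<open>c0\<close> disappears.\<close>
      have IFs: "?S n \<omega> J = B (Psi z) + (Gs z + m' (Psi z)) / d"
      proof -
        have "IF = (\<lambda>x. A (\<psi> x) + (1 / d) *\<^sub>R (chart G0 \<theta>0 x - c0))" by (simp add: IF_alt fun_eq_iff)
        then have "?S n \<omega> J = A (Psi z) + (1 / d) *\<^sub>R boot_process n (\<lambda>i. X i \<omega>) J (\<lambda>x. chart G0 \<theta>0 x - c0)"
          by (simp only: boot_process_add boot_process_linear[OF bounded_linear.linear[OF A_lin]]
              boot_process_linear[OF linear_scaleR] Psi_def z prod.case)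
        also have "boot_process n (\<lambda>i. X i \<omega>) J (\<lambda>x. chart G0 \<theta>0 x - c0) = Gs z"
          by (simp add: boot_process_diff boot_process_const[OF J(2)] Gs_def z)
        finally show ?thesis by (simp add: A_def add_divide_distrib)
      qed
      have R: "?R n \<omega> J = R2 z - R1 z + \<beta>' (Us z, Ws z) - \<beta>' (U z, W z)"
        by (simp add: R1_def R2_def b bs z algebra_simps)
      have lin: "f (Us z - U z - Psi z) = f (Us z) - f (U z) - f (Psi z)" if "bounded_linear f" for f :: "real \<times> real \<Rightarrow> real"
        by (simp add: linear_diff[OF bounded_linear.linear[OF that]])
      have "(case z of (n, \<omega>, J) \<Rightarrow> ?R n \<omega> J - ?S n \<omega> J) = ?R n \<omega> J - ?S n \<omega> J" by (simp add: z)
      then show ?case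
        unfolding R IFs \<beta>'_def fst_conv snd_conv W_eq[of z] lin[OF B_lin] lin[OF m'_lin]
        by (simp only: diff_divide_distrib add_divide_distrib)
    qed
  qed
  then have RS: "boot_tendsto_zero M (\<lambda>n \<omega> J. ?R n \<omega> J - ?S n \<omega> J)"
    unfolding boot_tendsto_zero_iff[OF finite_measure_axioms] .
  have "prob_space (normal_law 0 (\<integral>x. (IF x)\<^sup>2 \<partial>P))"
    using real_distribution_normal_law[of "\<integral>x. (IF x)\<^sup>2 \<partial>P"] by (simp add: real_distribution_def)
  from boot_Slutsky[OF finite_measure_axioms this bootstrap_CLT[OF IF] RS]
  show ?thesis unfolding IF_eq .
qed

end
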